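(* Let $\beta$ be a number such that AlgoFor-DDP-NS uses at most $\beta$ times the optimum number of drones on every instance of DDP-NS. Then for every instance of DDP-SC (each station being a charging station or a swapping station), AlgoFor-DDP-SC (described in the context) runs in $\mathcal O(n\log n+n_e+r)$ time, assigns every delivery to exactly one drone, every drone's assignment is feasible, and it uses at most $\beta\cdot OPT_{SC}+2\omega$ drones.
   Context: Model: $n$ deliveries; delivery $j$ has closed delivery time interval $I_j=[t_j^L,t_j^R]$ and cost $cost(I_j)\in(0,B]$, $B>0$ the battery capacity of identical drones. Intervals are compatible if disjoint, otherwise conflicting; $n_e$ is the number of conflicting pairs and $\omega$ the maximum number of pairwise conflicting delivery intervals. There are $r$ battery stations with waiting intervals $I_\ell^c=[t_\ell^A,t_\ell^D]$, $t_1^A<t_1^D<\dots<t_r^A<t_r^D$; no delivery interval is contained in a waiting interval and none intersects two waiting intervals. At a swapping station $\ell$, a drone swapping its battery occupies all of $I_\ell^c$, ends with battery $B$, and cannot serve deliveries intersecting $I_\ell^c$. At a charging station $\ell$, a drone may charge during a subinterval $[t',t'']\subseteq I_\ell^c$, its battery going from $rem$ to $Ch_\ell([t',t''],rem)\le B$ with $Ch_\ell(I_\ell^c,rem)=B$ for all $rem$, and cannot serve deliveries intersecting $[t',t'']$. Several drones may use a station simultaneously. A drone starts with battery $B$; a feasible assignment is a set of delivery intervals and swapping/charging intervals, pairwise disjoint, such that in time order each delivery's cost is at most the remaining battery when taken. DDP-SC: minimize the number of drones so that each delivery is assigned to exactly one drone and all assignments are feasible; $OPT_{SC}$ is the minimum.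 DDP-NS is the special case with no stations (feasible assignment = pairwise compatible set of total cost $\le B$). AlgoFor-DDP-NS: properly color the interval graph of the delivery intervals with $\omega$ colors; in each color class process intervals in arbitrary order, putting each into some already used drone of that class with remaining capacity at least its cost, else into a new drone. A block is a pairwise compatible set of delivery intervals with total cost at most $B$. AlgoFor-DDP-SC: (1) compute $\omega$. (2) $\mathcal I_1=\{I_j: t_j^L<t_1^A\}$, $\mathcal I_\ell=\{I_j: t_{\ell-1}^A\le t_j^L<t_\ell^A\}$ ($2\le\ell\le r$), $\mathcal I_{r+1}=\{I_j: t_j^L\ge t_r^A\}$; $\mathcal I_\ell^{first}$ ($\ell\ge2$) is the set of intervals of $\mathcal I_\ell$ containing $t_{\ell-1}^D$, $\mathcal I_\ell^{last}$ ($\ell\le r$) those containing $t_\ell^A$. (3) Apply AlgoFor-DDP-NS to each $\mathcal I_\ell$, obtaining $m_\ell$ blocks. (4) $m_{max}=\max_\ell m_\ell$; use $m_{max}+2\omega$ drones. (5) For $\ell=1,\dots,r+1$: assign the blocks containing intervals of $\mathcal I_\ell^{first}$ to distinct drones not assigned to any block of $\mathcal I_{\ell-1}$ and not in $\mathcal D_{\ell-2}^{last}$ (the drones assigned to blocks containing intervals of $\mathcal I_{\ell-2}^{last}$); the set of these drones is $\mathcal D_\ell^{first}$; assign the remaining blocks of $\mathcal I_\ell$ to distinct drones outside $\mathcal D_{\ell-1}^{last}\cup\mathcal D_\ell^{first}$. If $\ell\le r$, every used drone with battery below $B$ not in $\mathcal D_\ell^{last}$ then recharges (or swaps) over the whole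 interval $I_\ell^c$. Nonexistent sets and $\mathcal I_0,\mathcal D_0^{last},\mathcal D_{-1}^{last}$ are empty. *)

theory Defs
  imports Complex_Main "HOL-Library.Monad_Syntax"
begin

section \<open>Instances\<close>

text \<open>Deliveries are elements of a set; the label lets distinct deliveries have the same interval
  and cost.\<close>

record delivery =
  label :: nat
  tL :: real
  tR :: real
  cost :: real

text \<open>\<open>Charging Ch\<close>: charging during \<open>[t', t'']\<close> takes a battery level \<open>rem\<close> to \<open>Ch t' t'' rem\<close>.\<close>

datatype station_kind = Swapping | Charging "real \<Rightarrow> real \<Rightarrow> real \<Rightarrow> real"

record station =
  arr :: real
  dep :: real
  kind :: station_kind

record instance_SC =
  cap :: real
  deliveries :: "delivery set"
  stations :: "station list"

definition interval :: "delivery \<Rightarrow> real set" where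
  "interval d = {tL d..tR d}"

definition conflicting :: "delivery \<Rightarrow> delivery \<Rightarrow> bool" where
  "conflicting d e \<longleftrightarrow> interval d \<inter> interval e \<noteq> {}"

definition compatible :: "delivery \<Rightarrow> delivery \<Rightarrow> bool" where
  "compatible d e \<longleftrightarrow> interval d \<inter> interval e = {}"

definition n_conf :: "delivery set \<Rightarrow> nat" where
  "n_conf D = card {{d, e} | d e. d \<in> D \<and> e \<in> D \<and> d \<noteq> e \<and> conflicting d e}"

definition omega :: "delivery set \<Rightarrow> nat" where
  "omega D = Max (card ` {S. S \<subseteq> D \<and> pairwise conflicting S})"

definition block :: "real \<Rightarrow> delivery set \<Rightarrow> bool" where
  "block B S \<longleftrightarrow> finite S \<and> pairwise compatible S \<and> sum cost S \<le> B"

text \<open>Stations are numbered from 1.\<close>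

definition num_stations :: "instance_SC \<Rightarrow> nat" where
  "num_stations I = length (stations I)"

definition station_at :: "instance_SC \<Rightarrow> nat \<Rightarrow> station" where
  "station_at I l = stations I ! (l - 1)"

definition tA :: "instance_SC \<Rightarrow> nat \<Rightarrow> real" where
  "tA I l = arr (station_at I l)"

definition tD :: "instance_SC \<Rightarrow> nat \<Rightarrow> real" where
  "tD I l = dep (station_at I l)"

definition waiting :: "instance_SC \<Rightarrow> nat \<Rightarrow> real set" where
  "waiting I l = {tA I l..tD I l}"

definition valid_charge :: "real \<Rightarrow> real \<Rightarrow> real \<Rightarrow> (real \<Rightarrow> real \<Rightarrow> real \<Rightarrow> real) \<Rightarrow> bool" where
  "valid_charge B a b Ch \<longleftrightarrow>
    (\<forall>rem. 0 \<le> rem \<and> rem \<le> B \<longrightarrow>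
      (\<forall>t t'. a \<le> t \<and> t \<le> t' \<and> t' \<le> b \<longrightarrow> 0 \<le> Ch t t' rem \<and> Ch t t' rem \<le> B) \<and>
      Ch a b rem = B)"

definition valid_SC :: "instance_SC \<Rightarrow> bool" where
  "valid_SC I \<longleftrightarrow>
    0 < cap I \<and> finite (deliveries I) \<and>
    (\<forall>d \<in> deliveries I. tL d \<le> tR d \<and> 0 < cost d \<and> cost d \<le> cap I) \<and>
    (\<forall>l \<in> {1..num_stations I}. tA I l < tD I l) \<and>
    (\<forall>l \<in> {1..<num_stations I}. tD I l < tA I (l + 1)) \<and>
    (\<forall>l \<in> {1..num_stations I}. \<forall>Ch. kind (station_at I l) = Charging Ch \<longrightarrow>
      valid_charge (cap I) (tA I l) (tD I l) Ch) \<and>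
    (\<forall>d \<in> deliveries I. \<forall>l \<in> {1..num_stations I}. \<not> interval d \<subseteq> waiting I l) \<and>
    (\<forall>d \<in> deliveries I. \<forall>k \<in> {1..num_stations I}. \<forall>l \<in> {1..num_stations I}.
      k \<noteq> l \<longrightarrow> interval d \<inter> waiting I k = {} \<or> interval d \<inter> waiting I l = {})"


section \<open>Feasible assignments and optimum\<close>

text \<open>\<open>Recharge l t t'\<close> is a charging or swapping interval \<open>[t, t']\<close> at station \<open>l\<close>.\<close>

datatype activity = Deliver delivery | Recharge nat real real

fun period :: "activity \<Rightarrow> real \<times> real" where
  "period (Deliver d) = (tL d, tR d)"
| "period (Recharge l t t') = (t, t')"

definition span :: "activity \<Rightarrow> real set" where
  "span x = {fst (period x)..snd (period x)}"

fun admissible :: "instance_SC \<Rightarrow> activity \<Rightarrow> bool" where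
  "admissible I (Deliver d) \<longleftrightarrow> d \<in> deliveries I"
| "admissible I (Recharge l t t') \<longleftrightarrow> l \<in> {1..num_stations I} \<and>
    (case kind (station_at I l) of
       Swapping \<Rightarrow> t = tA I l \<and> t' = tD I l
     | Charging Ch \<Rightarrow> tA I l \<le> t \<and> t \<le> t' \<and> t' \<le> tD I l)"

definition recharged :: "instance_SC \<Rightarrow> nat \<Rightarrow> real \<Rightarrow> real \<Rightarrow> real \<Rightarrow> real" where
  "recharged I l t t' rem =
    (case kind (station_at I l) of Swapping \<Rightarrow> cap I | Charging Ch \<Rightarrow> Ch t t' rem)"

fun battery_suffices :: "instance_SC \<Rightarrow> real \<Rightarrow> activity list \<Rightarrow> bool" where
  "battery_suffices I rem [] \<longleftrightarrow> True"
| "battery_suffices I rem (Deliver d # xs) \<longleftrightarrow>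
    cost d \<le> rem \<and> battery_suffices I (rem - cost d) xs"
| "battery_suffices I rem (Recharge l t t' # xs) \<longleftrightarrow>
    battery_suffices I (recharged I l t t' rem) xs"

definition feasible :: "instance_SC \<Rightarrow> activity set \<Rightarrow> bool" where
  "feasible I X \<longleftrightarrow>
    (\<forall>x \<in> X. admissible I x) \<and>
    pairwise (\<lambda>x y. span x \<inter> span y = {}) X \<and>
    (\<exists>xs. distinct xs \<and> set xs = X \<and> sorted (map (fst \<circ> period) xs) \<and>
      battery_suffices I (cap I) xs)"

definition solution :: "instance_SC \<Rightarrow> nat \<Rightarrow> (nat \<Rightarrow> activity set) \<Rightarrow> bool" where
  "solution I k S \<longleftrightarrow>
    (\<forall>i<k. feasible I (S i)) \<and>
    (\<forall>d \<in> deliveries I. \<exists>!i. i < k \<and> Deliver d \<in> S i)"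

definition OPT_SC :: "instance_SC \<Rightarrow> nat" where
  "OPT_SC I = (LEAST k. \<exists>S. solution I k S)"

definition instance_NS :: "real \<Rightarrow> delivery set \<Rightarrow> instance_SC" where
  "instance_NS B D = \<lparr>cap = B, deliveries = D, stations = []\<rparr>"

definition valid_NS :: "real \<Rightarrow> delivery set \<Rightarrow> bool" where
  "valid_NS B D \<longleftrightarrow> valid_SC (instance_NS B D)"

definition OPT_NS :: "real \<Rightarrow> delivery set \<Rightarrow> nat" where
  "OPT_NS B D = OPT_SC (instance_NS B D)"


section \<open>AlgoFor-DDP-NS\<close>

text \<open>The algorithm leaves the colouring, the processing order and the drone that receives a
  delivery open. It is therefore a relation between an instance and the possible results; a result
  is the set of loads of the used drones. Loads are nonempty and pairwise disjoint, so its
  cardinality is the number of drones used.\<close>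

definition proper_colouring :: "delivery set \<Rightarrow> nat \<Rightarrow> (delivery \<Rightarrow> nat) \<Rightarrow> bool" where
  "proper_colouring D k c \<longleftrightarrow>
    c ` D \<subseteq> {..<k} \<and> (\<forall>d \<in> D. \<forall>e \<in> D. d \<noteq> e \<and> conflicting d e \<longrightarrow> c d \<noteq> c e)"

definition fits :: "real \<Rightarrow> delivery set \<Rightarrow> delivery \<Rightarrow> bool" where
  "fits B S d \<longleftrightarrow> sum cost S + cost d \<le> B"

inductive place :: "real \<Rightarrow> delivery set list \<Rightarrow> delivery \<Rightarrow> delivery set list \<Rightarrow> bool" for B where
  used_drone: "i < length Ss \<Longrightarrow> fits B (Ss ! i) d \<Longrightarrow> place B Ss d (Ss[i := insert d (Ss ! i)])"
| new_drone: "(\<forall>S \<in> set Ss. \<not> fits B S d) \<Longrightarrow> place B Ss d (Ss @ [{d}])"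

inductive pack :: "real \<Rightarrow> delivery set list \<Rightarrow> delivery list \<Rightarrow> delivery set list \<Rightarrow> bool" for B where
  "pack B Ss [] Ss"
| "place B Ss d Ss' \<Longrightarrow> pack B Ss' ds Ss'' \<Longrightarrow> pack B Ss (d # ds) Ss''"

definition algo_NS :: "real \<Rightarrow> delivery set \<Rightarrow> delivery set set \<Rightarrow> bool" where
  "algo_NS B D BB \<longleftrightarrow>
    (\<exists>c P. proper_colouring D (omega D) c \<and>
      (\<forall>k < omega D. \<exists>ds. distinct ds \<and> set ds = {d \<in> D. c d = k} \<and> pack B [] ds (P k)) \<and>
      BB = (\<Union>k < omega D. set (P k)))"


section \<open>AlgoFor-DDP-SC\<close>

definition group :: "instance_SC \<Rightarrow> nat \<Rightarrow> delivery set" where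
  "group I l = {d \<in> deliveries I.
    (2 \<le> l \<longrightarrow> tA I (l - 1) \<le> tL d) \<and> (l \<le> num_stations I \<longrightarrow> tL d < tA I l)}"

definition I_first :: "instance_SC \<Rightarrow> nat \<Rightarrow> delivery set" where
  "I_first I l = (if 2 \<le> l then {d \<in> group I l. tD I (l - 1) \<in> interval d} else {})"

definition I_last :: "instance_SC \<Rightarrow> nat \<Rightarrow> delivery set" where
  "I_last I l = (if l \<le> num_stations I then {d \<in> group I l. tA I l \<in> interval d} else {})"

text \<open>\<open>A\<close> is AlgoFor-DDP-NS with any of its choices possibly fixed; \<open>Bl l\<close> are the blocks
  of group \<open>l\<close>.\<close>

definition SC_blocks ::
  "(real \<Rightarrow> delivery set \<Rightarrow> delivery set set \<Rightarrow> bool) \<Rightarrow> instance_SC \<Rightarrow> (nat \<Rightarrow> delivery set set) \<Rightarrow> bool"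
where
  "SC_blocks A I Bl \<longleftrightarrow> (\<forall>l \<in> {1..num_stations I + 1}. A (cap I) (group I l) (Bl l))"

definition num_drones :: "instance_SC \<Rightarrow> (nat \<Rightarrow> delivery set set) \<Rightarrow> nat" where
  "num_drones I Bl =
    Max ((\<lambda>l. card (Bl l)) ` {1..num_stations I + 1}) + 2 * omega (deliveries I)"

text \<open>States of the assignment phase: \<open>stage\<close> is the index of the current group,
  \<open>(l, b, i) \<in> assigned\<close> means that block \<open>b\<close> of group \<open>l\<close> was given to drone \<open>i\<close>, and
  \<open>(l, i) \<in> charged\<close> that drone \<open>i\<close> recharges over the whole waiting interval \<open>l\<close>.\<close>

record state =
  stage :: nat
  assigned :: "(nat \<times> delivery set \<times> nat) set"
  charged :: "(nat \<times> nat) set"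
  battery :: "nat \<Rightarrow> real"

definition init :: "instance_SC \<Rightarrow> state" where
  "init I = \<lparr>stage = 1, assigned = {}, charged = {}, battery = (\<lambda>_. cap I)\<rparr>"

definition busy :: "state \<Rightarrow> nat \<Rightarrow> nat set" where
  "busy s l = {i. \<exists>b. (l, b, i) \<in> assigned s}"

definition used :: "state \<Rightarrow> nat set" where
  "used s = {i. \<exists>l b. (l, b, i) \<in> assigned s}"

definition D_first :: "instance_SC \<Rightarrow> state \<Rightarrow> nat \<Rightarrow> nat set" where
  "D_first I s l = {i. \<exists>b. (l, b, i) \<in> assigned s \<and> b \<inter> I_first I l \<noteq> {}}"

definition D_last :: "instance_SC \<Rightarrow> state \<Rightarrow> nat \<Rightarrow> nat set" where
  "D_last I s l = {i. \<exists>b. (l, b, i) \<in> assigned s \<and> b \<inter> I_last I l \<noteq> {}}"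

definition done_block :: "state \<Rightarrow> delivery set \<Rightarrow> bool" where
  "done_block s b \<longleftrightarrow> (\<exists>i. (stage s, b, i) \<in> assigned s)"

definition assign :: "state \<Rightarrow> delivery set \<Rightarrow> nat \<Rightarrow> state" where
  "assign s b i = s\<lparr>assigned := insert (stage s, b, i) (assigned s),
                    battery := (battery s)(i := battery s i - sum cost b)\<rparr>"

definition rechargers :: "instance_SC \<Rightarrow> state \<Rightarrow> nat set" where
  "rechargers I s = {i \<in> used s. battery s i < cap I \<and> i \<notin> D_last I s (stage s)}"

definition recharge :: "instance_SC \<Rightarrow> state \<Rightarrow> state" where
  "recharge I s = (let l = stage s; X = rechargers I s in
    s\<lparr>stage := l + 1,
      charged := charged s \<union> {(l, i) | i. i \<in> X},
      battery := (\<lambda>i. if i \<in> X then recharged I l (tA I l) (tD I l) (battery s i) else battery s i)\<rparr>)"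

text \<open>For \<open>l \<le> 2\<close> the truncated indices \<open>l - 1\<close>, \<open>l - 2\<close> may be 0; nothing is ever assigned
  at stage 0, so the corresponding sets of drones are empty.\<close>

inductive step :: "instance_SC \<Rightarrow> (nat \<Rightarrow> delivery set set) \<Rightarrow> state \<Rightarrow> state \<Rightarrow> bool" for I Bl where
  assign_first:
    "b \<in> Bl (stage s) \<Longrightarrow> b \<inter> I_first I (stage s) \<noteq> {} \<Longrightarrow> \<not> done_block s b \<Longrightarrow>
     i < num_drones I Bl \<Longrightarrow> i \<notin> busy s (stage s) \<Longrightarrow>
     i \<notin> busy s (stage s - 1) \<Longrightarrow> i \<notin> D_last I s (stage s - 2) \<Longrightarrow>
     step I Bl s (assign s b i)"
| assign_rest:
    "(\<forall>b' \<in> Bl (stage s). b' \<inter> I_first I (stage s) \<noteq> {} \<longrightarrow> done_block s b') \<Longrightarrow>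
     b \<in> Bl (stage s) \<Longrightarrow> b \<inter> I_first I (stage s) = {} \<Longrightarrow> \<not> done_block s b \<Longrightarrow>
     i < num_drones I Bl \<Longrightarrow> i \<notin> busy s (stage s) \<Longrightarrow>
     i \<notin> D_last I s (stage s - 1) \<union> D_first I s (stage s) \<Longrightarrow>
     step I Bl s (assign s b i)"
| recharge:
    "(\<forall>b \<in> Bl (stage s). done_block s b) \<Longrightarrow> stage s \<le> num_stations I \<Longrightarrow>
     step I Bl s (recharge I s)"

definition final :: "instance_SC \<Rightarrow> (nat \<Rightarrow> delivery set set) \<Rightarrow> state \<Rightarrow> bool" where
  "final I Bl s \<longleftrightarrow> stage s = num_stations I + 1 \<and> (\<forall>b \<in> Bl (stage s). done_block s b)"

definition schedule :: "instance_SC \<Rightarrow> state \<Rightarrow> nat \<Rightarrow> activity set" where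
  "schedule I s i =
    {Deliver d | d l b. (l, b, i) \<in> assigned s \<and> d \<in> b} \<union>
    {Recharge l (tA I l) (tD I l) | l. (l, i) \<in> charged s}"

text \<open>\<open>always_reaches R P s\<close>: whatever choices are made, an execution of \<open>R\<close> from \<open>s\<close> arrives
  after finitely many steps, and without getting stuck before, at a state satisfying \<open>P\<close>.\<close>

inductive always_reaches :: "('s \<Rightarrow> 's \<Rightarrow> bool) \<Rightarrow> ('s \<Rightarrow> bool) \<Rightarrow> 's \<Rightarrow> bool" for R P where
  "P s \<Longrightarrow> always_reaches R P s"
| "R s s' \<Longrightarrow> (\<And>t. R s t \<Longrightarrow> always_reaches R P t) \<Longrightarrow> always_reaches R P s"

text \<open>\<open>algo_SC A I M S\<close>: some execution uses \<open>M\<close> drones and yields the assignments \<open>S\<close>.\<close>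

definition algo_SC ::
  "(real \<Rightarrow> delivery set \<Rightarrow> delivery set set \<Rightarrow> bool) \<Rightarrow> instance_SC \<Rightarrow> nat \<Rightarrow> (nat \<Rightarrow> activity set) \<Rightarrow> bool"
where
  "algo_SC A I M S \<longleftrightarrow>
    (\<exists>Bl s. SC_blocks A I Bl \<and> (step I Bl)\<^sup>*\<^sup>* (init I) s \<and> final I Bl s \<and>
      M = num_drones I Bl \<and> S = schedule I s)"


section \<open>Step-counting implementation\<close>

text \<open>The value of a computation is paired with its number of steps. Every call of a recursive
  function costs one step plus the steps of the calls it makes; arithmetic and comparisons on
  numbers, constructors, projections and case distinctions are constant-time operations and are
  accounted for by the step of the enclosing call.\<close>

type_synonym 'a tm = "'a \<times> nat"

definition ret :: "'a \<Rightarrow> 'a tm" where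
  "ret x = (x, 0)"

definition tm_bind :: "'a tm \<Rightarrow> ('a \<Rightarrow> 'b tm) \<Rightarrow> 'b tm" where
  "tm_bind m f = (let (x, t) = m; (y, u) = f x in (y, t + u))"

definition tick :: "'a tm \<Rightarrow> 'a tm" where
  "tick m = (fst m, snd m + 1)"

adhoc_overloading Monad_Syntax.bind \<rightleftharpoons> tm_bind

abbreviation val :: "'a tm \<Rightarrow> 'a" where "val \<equiv> fst"
abbreviation time :: "'a tm \<Rightarrow> nat" where "time \<equiv> snd"

fun len :: "'a list \<Rightarrow> nat tm" where
  "len [] = tick (ret 0)"
| "len (x # xs) = tick (do { k \<leftarrow> len xs; ret (k + 1) })"

fun app :: "'a list \<Rightarrow> 'a list \<Rightarrow> 'a list tm" where
  "app [] ys = tick (ret ys)"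
| "app (x # xs) ys = tick (do { zs \<leftarrow> app xs ys; ret (x # zs) })"

fun countdown :: "nat \<Rightarrow> nat list tm" where
  "countdown 0 = tick (ret [])"
| "countdown (Suc k) = tick (do { xs \<leftarrow> countdown k; ret (k # xs) })"

fun merge :: "('a \<Rightarrow> 'a \<Rightarrow> bool) \<Rightarrow> 'a list \<Rightarrow> 'a list \<Rightarrow> 'a list tm" where
  "merge le [] ys = tick (ret ys)"
| "merge le (x # xs) [] = tick (ret (x # xs))"
| "merge le (x # xs) (y # ys) = tick (
    if le x y then do { zs \<leftarrow> merge le xs (y # ys); ret (x # zs) }
    else do { zs \<leftarrow> merge le (x # xs) ys; ret (y # zs) })"

text \<open>\<open>sort_prefix le k xs\<close> sorts the first \<open>k\<close> elements and returns the rest unchanged.\<close>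

fun sort_prefix :: "('a \<Rightarrow> 'a \<Rightarrow> bool) \<Rightarrow> nat \<Rightarrow> 'a list \<Rightarrow> ('a list \<times> 'a list) tm" where
  "sort_prefix le k xs = tick (
    if k = 0 \<or> xs = [] then ret ([], xs)
    else if k = 1 then ret ([hd xs], tl xs)
    else do {
      (as, ys) \<leftarrow> sort_prefix le (k div 2) xs;
      (bs, zs) \<leftarrow> sort_prefix le (k - k div 2) ys;
      cs \<leftarrow> merge le as bs;
      ret (cs, zs) })"

declare sort_prefix.simps [simp del]

definition msort :: "('a \<Rightarrow> 'a \<Rightarrow> bool) \<Rightarrow> 'a list \<Rightarrow> 'a list tm" where
  "msort le xs = tick (do { k \<leftarrow> len xs; (ys, zs) \<leftarrow> sort_prefix le k xs; ret ys })"

definition by_start :: "delivery \<Rightarrow> delivery \<Rightarrow> bool" where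
  "by_start d e \<longleftrightarrow> tL d \<le> tL e"

definition by_colour_cost :: "delivery \<times> nat \<Rightarrow> delivery \<times> nat \<Rightarrow> bool" where
  "by_colour_cost x y \<longleftrightarrow> snd x < snd y \<or> snd x = snd y \<and> cost (fst x) \<le> cost (fst y)"

text \<open>Sweep over the deliveries by start time, keeping the coloured deliveries still in progress
  and the colours that became free. Each delivery that survives \<open>expire\<close> conflicts with the
  current one, which gives the contribution of the conflicting pairs to the running time. The
  second result of \<open>colour\<close> is the number of colours used, which is \<open>omega\<close>.\<close>

fun expire :: "real \<Rightarrow> (delivery \<times> nat) list \<Rightarrow> nat list \<Rightarrow> ((delivery \<times> nat) list \<times> nat list) tm" where
  "expire t [] fr = tick (ret ([], fr))"
| "expire t ((e, c) # act) fr = tick (do {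
    (act', fr') \<leftarrow> expire t act fr;
    if tR e < t then ret (act', c # fr') else ret ((e, c) # act', fr') })"

fun sweep :: "delivery list \<Rightarrow> (delivery \<times> nat) list \<Rightarrow> nat list \<Rightarrow> nat \<Rightarrow> ((delivery \<times> nat) list \<times> nat) tm" where
  "sweep [] act fr k = tick (ret ([], k))"
| "sweep (d # ds) act fr k = tick (do {
    (act', fr') \<leftarrow> expire (tL d) act fr;
    case fr' of
      [] \<Rightarrow> do { (cs, m) \<leftarrow> sweep ds ((d, k) # act') [] (k + 1); ret ((d, k) # cs, m) }
    | c # fr'' \<Rightarrow> do { (cs, m) \<leftarrow> sweep ds ((d, c) # act') fr'' k; ret ((d, c) # cs, m) } })"

definition colour :: "delivery list \<Rightarrow> ((delivery \<times> nat) list \<times> nat) tm" where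
  "colour ds = tick (do { xs \<leftarrow> msort by_start ds; sweep xs [] [] 0 })"

text \<open>Each class is processed by increasing cost: once a delivery does not fit into a drone, no
  later one of its class does, so only the drone opened last has to be examined.\<close>

fun fill :: "real \<Rightarrow> nat \<Rightarrow> real \<Rightarrow> delivery list \<Rightarrow> (delivery \<times> nat) list \<Rightarrow> delivery list list tm" where
  "fill B c rem b [] = tick (ret [b])"
| "fill B c rem b ((d, c') # xs) = tick (
    if c' = c \<and> cost d \<le> rem then fill B c (rem - cost d) (d # b) xs
    else do { bs \<leftarrow> fill B c' (B - cost d) [d] xs; ret (b # bs) })"

definition prog_NS :: "real \<Rightarrow> delivery list \<Rightarrow> delivery list list tm" where
  "prog_NS B ds = tick (do {
    (cs, m) \<leftarrow> colour ds;
    xs \<leftarrow> msort by_colour_cost cs;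
    case xs of [] \<Rightarrow> ret [] | (d, c) # ys \<Rightarrow> fill B c (B - cost d) [d] ys })"

text \<open>Input of \<open>groups\<close> sorted by start time.\<close>

fun split_before :: "real \<Rightarrow> delivery list \<Rightarrow> (delivery list \<times> delivery list) tm" where
  "split_before t [] = tick (ret ([], []))"
| "split_before t (d # ds) = tick (
    if tL d < t then do { (xs, ys) \<leftarrow> split_before t ds; ret (d # xs, ys) } else ret ([], d # ds))"

fun groups :: "station list \<Rightarrow> delivery list \<Rightarrow> delivery list list tm" where
  "groups [] ds = tick (ret [ds])"
| "groups (s # ss) ds = tick (do {
    (xs, ys) \<leftarrow> split_before (arr s) ds;
    gs \<leftarrow> groups ss ys;
    ret (xs # gs) })"

fun blocks :: "real \<Rightarrow> delivery list list \<Rightarrow> (delivery list list list \<times> nat) tm" where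
  "blocks B [] = tick (ret ([], 0))"
| "blocks B (g # gs) = tick (do {
    bs \<leftarrow> prog_NS B g;
    m \<leftarrow> len bs;
    (bss, m') \<leftarrow> blocks B gs;
    ret (bs # bss, max m m') })"

fun any_contains :: "real \<Rightarrow> delivery list \<Rightarrow> bool tm" where
  "any_contains t [] = tick (ret False)"
| "any_contains t (d # ds) = tick (if tL d \<le> t \<and> t \<le> tR d then ret True else any_contains t ds)"

fun split_first :: "real option \<Rightarrow> delivery list list \<Rightarrow> (delivery list list \<times> delivery list list) tm" where
  "split_first p [] = tick (ret ([], []))"
| "split_first p (b # bs) = tick (do {
    f \<leftarrow> (case p of None \<Rightarrow> ret False | Some t \<Rightarrow> any_contains t b);
    (fs, rs) \<leftarrow> split_first p bs;
    if f then ret (b # fs, rs) else ret (fs, b # rs) })"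

fun hand_out :: "delivery list list \<Rightarrow> nat list \<Rightarrow> ((nat \<times> delivery list) list \<times> nat list) tm" where
  "hand_out [] is = tick (ret ([], is))"
| "hand_out (b # bs) [] = tick (ret ([], []))"
| "hand_out (b # bs) (i # is) = tick (do {
    (as, js) \<leftarrow> hand_out bs is;
    ret ((i, b) # as, js) })"

fun log_block :: "nat \<Rightarrow> delivery list \<Rightarrow> (nat \<times> activity) list \<Rightarrow> (nat \<times> activity) list tm" where
  "log_block i [] acc = tick (ret acc)"
| "log_block i (d # ds) acc = tick (log_block i ds ((i, Deliver d) # acc))"

fun log_blocks :: "(nat \<times> delivery list) list \<Rightarrow> (nat \<times> activity) list \<Rightarrow> (nat \<times> activity) list tm" where
  "log_blocks [] acc = tick (ret acc)"
| "log_blocks ((i, b) # as) acc = tick (do { acc' \<leftarrow> log_block i b acc; log_blocks as acc' })"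

fun log_recharges :: "nat \<Rightarrow> station \<Rightarrow> nat list \<Rightarrow> (nat \<times> activity) list \<Rightarrow> (nat \<times> activity) list tm" where
  "log_recharges l s [] acc = tick (ret acc)"
| "log_recharges l s (i # is) acc = tick (log_recharges l s is ((i, Recharge l (arr s) (dep s)) # acc))"

fun split_last :: "real \<Rightarrow> (nat \<times> delivery list) list \<Rightarrow> (nat list \<times> nat list) tm" where
  "split_last t [] = tick (ret ([], []))"
| "split_last t ((i, b) # as) = tick (do {
    f \<leftarrow> any_contains t b;
    (ns, ls) \<leftarrow> split_last t as;
    if f then ret (ns, i # ls) else ret (i # ns, ls) })"

text \<open>In \<open>allot l p ss bss F N L1 L2 acc\<close>, the drones are split into the lists \<open>N\<close> (assigned to
  blocks of group \<open>l - 1\<close> but not in \<open>D_last\<close> there), \<open>L1\<close> (\<open>D_last\<close> of group \<open>l - 1\<close>),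
  \<open>L2\<close> (\<open>D_last\<close> of group \<open>l - 2\<close>) and \<open>F\<close> (all others); \<open>p\<close> is the departure time of station
  \<open>l - 1\<close>, and \<open>ss\<close> are the stations from \<open>l\<close> on. The drones in \<open>L1\<close> and the drones of group
  \<open>l\<close> outside \<open>D_last\<close> are exactly those that recharge at station \<open>l\<close>.\<close>

fun allot :: "nat \<Rightarrow> real option \<Rightarrow> station list \<Rightarrow> delivery list list list \<Rightarrow>
    nat list \<Rightarrow> nat list \<Rightarrow> nat list \<Rightarrow> nat list \<Rightarrow> (nat \<times> activity) list \<Rightarrow> (nat \<times> activity) list tm" where
  "allot l p ss [] F N L1 L2 acc = tick (ret acc)"
| "allot l p ss (bs # bss) F N L1 L2 acc = tick (do {
    (fs, rs) \<leftarrow> split_first p bs;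
    (as1, F1) \<leftarrow> hand_out fs F;
    G1 \<leftarrow> app L2 F1;
    G2 \<leftarrow> app N G1;
    (as2, F2) \<leftarrow> hand_out rs G2;
    as \<leftarrow> app as1 as2;
    acc1 \<leftarrow> log_blocks as acc;
    case ss of
      [] \<Rightarrow> ret acc1
    | s # ss' \<Rightarrow> do {
        (ns, ls) \<leftarrow> split_last (arr s) as;
        acc2 \<leftarrow> log_recharges l s ns acc1;
        acc3 \<leftarrow> log_recharges l s L1 acc2;
        allot (l + 1) (Some (dep s)) ss' bss F2 ns ls L1 acc3 } })"

definition prog_SC :: "real \<Rightarrow> delivery list \<Rightarrow> station list \<Rightarrow> (nat \<times> (nat \<times> activity) list) tm" where
  "prog_SC B ds ss = tick (do {
    (cs, w) \<leftarrow> colour ds;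
    xs \<leftarrow> msort by_start ds;
    gs \<leftarrow> groups ss xs;
    (bss, m) \<leftarrow> blocks B gs;
    is \<leftarrow> countdown (m + 2 * w);
    acc \<leftarrow> allot 1 None ss bss is [] [] [] [];
    ret (m + 2 * w, acc) })"

definition impl_NS :: "real \<Rightarrow> delivery set \<Rightarrow> delivery set set \<Rightarrow> bool" where
  "impl_NS B D BB \<longleftrightarrow>
    (\<exists>ds. distinct ds \<and> set ds = D \<and> BB = set ` set (val (prog_NS B ds)))"

definition log_of :: "(nat \<times> activity) list \<Rightarrow> nat \<Rightarrow> activity set" where
  "log_of acc i = {x. (i, x) \<in> set acc}"

end

theory Submission
  imports Defs "HOL-Library.Multiset"
begin

text \<open>
  Correctness rests on one invariant: at the start of stage \<open>l\<close> exactly the drones of \<open>D_last\<close> of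
  group \<open>l - 1\<close> have a battery below the capacity. A drone that gets a block at stage \<open>l\<close> is
  therefore full, and everything it did before ends before the block starts, since a delivery of an
  earlier group reaches at most one waiting interval. An execution cannot get stuck because all
  deliveries of \<open>I_first\<close> (and of \<open>I_last\<close>) of a group share a point, so they lie in at most
  \<open>omega\<close> blocks, and at most \<open>m_max\<close> drones serve a group.

  For the approximation bound, no recharging interval separates two deliveries of the same group, as
  a delivery of the group before a recharge at the preceding station would lie inside the waiting
  interval. So the restriction of any solution to a group is a solution of DDP-NS, and the optimum of
  each group is at most \<open>OPT_SC\<close>.

  For the running time, the sweep is paid for by one expiry per delivery and one conflicting pair per
  survivor, and the conflicting pairs of the groups are disjoint.
\<close>


section \<open>Blocks and the groups between stations\<close>

text \<open>The surplus of two times \<open>omega\<close> drones has the following origin. A drone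
  that is still serving a delivery at the arrival time of station l misses this station. It gets no
  block of group l + 1, recharges at station l + 1 instead, and stays there until the departure
  time, so a delivery of group l + 2 containing that time is closed to it, as it is to every drone
  that served group l + 1. A block meeting \<open>I_first\<close> must therefore avoid all drones of
  the previous group and the late rechargers of the group before it. One \<open>omega\<close> pays
  for those late rechargers, the other for the blocks meeting \<open>I_first\<close> themselves. The
  program gets no separate feasibility proof: its log is shown to be the schedule of one execution
  of \<open>step\<close>, whose open choices it resolves by a cost order inside each colour class
  and by taking drones from the front of suitable lists.\<close>

lemma omega_upper:
  assumes "finite D" "S \<subseteq> D" "pairwise conflicting S"
  shows "card S \<le> omega D"
  unfolding omega_def using assms by (intro Max_ge) auto

lemma omega_least:
  assumes "finite D" "\<And>S. S \<subseteq> D \<Longrightarrow> pairwise conflicting S \<Longrightarrow> card S \<le> k"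
  shows "omega D \<le> k"
  unfolding omega_def
proof (subst Max_le_iff)
  show "card ` {S. S \<subseteq> D \<and> pairwise conflicting S} \<noteq> {}"
    by (auto intro!: exI[of _ "{}"])
qed (use assms in auto)

lemma omega_le_card: "finite D \<Longrightarrow> omega D \<le> card D"
  by (intro omega_least) (auto intro: card_mono)

text \<open>Indexed by positions and not by the set of loads, so that it can be followed through the
  list update in \<open>place\<close>.\<close>

definition separate :: "'a set list \<Rightarrow> bool" where
  "separate Ss \<longleftrightarrow> (\<forall>i < length Ss. \<forall>j < length Ss. i \<noteq> j \<longrightarrow> Ss ! i \<inter> Ss ! j = {})"

lemma separate_disjoint: "separate Ss \<Longrightarrow> pairwise disjnt (set Ss)"
  unfolding separate_def pairwise_def disjnt_def by (metis in_set_conv_nth)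

lemma place_separate:
  assumes "place B Ss d Ss'" "separate Ss" "d \<notin> \<Union>(set Ss)"
  shows "separate Ss'"
  using assms
proof (induction rule: place.induct)
  case (used_drone i Ss d)
  then show ?case by (auto simp: separate_def nth_list_update)
next
  case (new_drone Ss d)
  then show ?case by (auto simp: separate_def nth_append less_Suc_eq)
qed

lemma place_Union:
  "place B Ss d Ss' \<Longrightarrow> \<Union>(set Ss') = insert d (\<Union>(set Ss))"
proof (induction rule: place.induct)
  case (used_drone i Ss d)
  have "set (Ss[i := insert d (Ss ! i)]) \<subseteq> insert (insert d (Ss ! i)) (set Ss)"
    by (rule set_update_subset_insert)
  moreover have "Ss ! i \<in> set Ss" using used_drone by simp
  moreover have "x \<in> \<Union> (set (Ss[i := insert d (Ss ! i)]))" if x: "x \<in> \<Union>(set Ss)" for x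
  proof -
    obtain j where "j < length Ss" "x \<in> Ss ! j" using x by (auto simp: in_set_conv_nth)
    then have "x \<in> Ss[i := insert d (Ss ! i)] ! j" "j < length (Ss[i := insert d (Ss ! i)])"
      using used_drone.hyps by (auto simp: nth_list_update)
    then show ?thesis by (metis UnionI nth_mem)
  qed
  moreover have "insert d (Ss ! i) \<in> set (Ss[i := insert d (Ss ! i)])"
    using used_drone by (simp add: set_update_memI)
  ultimately show ?case by (intro set_eqI iffI) fast+
next
  case (new_drone Ss d)
  then show ?case by auto
qed

lemma place_loads:
  assumes "place B Ss d Ss'" "cost d \<le> B" "\<And>S. S \<in> set Ss \<Longrightarrow> finite S \<and> d \<notin> S"
    and "\<And>S. S \<in> set Ss \<Longrightarrow> S \<noteq> {} \<and> sum cost S \<le> B" "S \<in> set Ss'"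
  shows "finite S \<and> S \<noteq> {} \<and> sum cost S \<le> B"
  using assms
proof (induction rule: place.induct)
  case (used_drone i Ss d)
  have "S = insert d (Ss ! i) \<or> S \<in> set Ss"
    using used_drone.prems(4) set_update_subset_insert by fastforce
  moreover have "Ss ! i \<in> set Ss" using used_drone by simp
  ultimately show ?case using used_drone by (auto simp: fits_def add.commute)
qed auto

text \<open>No delivery is loaded twice, which keeps the loads disjoint. The capacity bound survives
  because a used drone only takes what fits, and a new drone can carry any single delivery.\<close>

lemma pack_loads:
  assumes "pack B Ss ds Ss'" "distinct ds" "separate Ss" "\<Union>(set Ss) \<inter> set ds = {}"
    and "\<And>d. d \<in> set ds \<Longrightarrow> cost d \<le> B"
    and "\<And>S. S \<in> set Ss \<Longrightarrow> finite S \<and> S \<noteq> {} \<and> sum cost S \<le> B"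
  shows "separate Ss' \<and> \<Union>(set Ss') = \<Union>(set Ss) \<union> set ds \<and>
    (\<forall>S \<in> set Ss'. finite S \<and> S \<noteq> {} \<and> sum cost S \<le> B)"
  using assms
proof (induction rule: pack.induct)
  case (1 Ss)
  then show ?case by simp
next
  case (2 Ss d Ss' ds Ss'')
  have d: "d \<notin> \<Union>(set Ss)" using 2 by auto
  have "separate Ss'" by (rule place_separate[OF 2(1) 2(5) d])
  moreover have U: "\<Union>(set Ss') = insert d (\<Union>(set Ss))" by (rule place_Union[OF 2(1)])
  moreover have "finite S \<and> S \<noteq> {} \<and> sum cost S \<le> B" if S: "S \<in> set Ss'" for S
    by (rule place_loads[OF 2(1) _ _ _ S]) (use 2(7,8) d in auto)
  moreover have "\<Union>(set Ss') \<inter> set ds = {}" using 2(4,6) by (auto simp: U)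
  ultimately have "separate Ss'' \<and> \<Union>(set Ss'') = \<Union>(set Ss') \<union> set ds \<and>
    (\<forall>S \<in> set Ss''. finite S \<and> S \<noteq> {} \<and> sum cost S \<le> B)"
    using 2(4,7) by (intro 2(3)) simp_all
  then show ?case by (simp add: U)
qed

text \<open>What the assignment phase knows about the blocks of a group; colouring and packing order
  are forgotten here. Without the empty block every block has positive cost, so a full drone that
  receives one always drops below capacity.\<close>

definition block_partition :: "real \<Rightarrow> delivery set \<Rightarrow> delivery set set \<Rightarrow> bool" where
  "block_partition B D BB \<longleftrightarrow>
    finite BB \<and> {} \<notin> BB \<and> (\<forall>b \<in> BB. block B b) \<and> pairwise disjnt BB \<and> \<Union>BB = D"

lemma block_partitionD:
  assumes "block_partition B D BB"
  shows "finite BB" "\<And>b. b \<in> BB \<Longrightarrow> b \<noteq> {}" "\<And>b. b \<in> BB \<Longrightarrow> finite b"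
    "\<And>b. b \<in> BB \<Longrightarrow> pairwise compatible b" "\<And>b. b \<in> BB \<Longrightarrow> sum cost b \<le> B"
    "\<And>b. b \<in> BB \<Longrightarrow> b \<subseteq> D" "\<Union>BB = D"
    "\<And>b b' d. b \<in> BB \<Longrightarrow> b' \<in> BB \<Longrightarrow> d \<in> b \<Longrightarrow> d \<in> b' \<Longrightarrow> b = b'"
  using assms unfolding block_partition_def block_def pairwise_def disjnt_def by blast+

lemma valid_NS_iff:
  "valid_NS B D \<longleftrightarrow> 0 < B \<and> finite D \<and> (\<forall>d \<in> D. tL d \<le> tR d \<and> 0 < cost d \<and> cost d \<le> B)"
  by (auto simp: valid_NS_def valid_SC_def instance_NS_def num_stations_def)

text \<open>Loads from different classes are disjoint because the classes are, loads of one class by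
  \<open>pack_loads\<close>; compatibility inside a block is properness of the colouring.\<close>

lemma algo_NS_block_partition:
  assumes "valid_NS B D" "algo_NS B D BB"
  shows "block_partition B D BB"
proof -
  obtain c P where c: "proper_colouring D (omega D) c"
    and P: "\<And>k. k < omega D \<Longrightarrow> \<exists>ds. distinct ds \<and> set ds = {d \<in> D. c d = k} \<and> pack B [] ds (P k)"
    and BB: "BB = (\<Union>k < omega D. set (P k))"
    using assms(2) unfolding algo_NS_def by blast
  have P': "separate (P k) \<and> \<Union>(set (P k)) = {d \<in> D. c d = k} \<and>
     (\<forall>S \<in> set (P k). finite S \<and> S \<noteq> {} \<and> sum cost S \<le> B)" if k: "k < omega D" for k
  proof -
    obtain ds where "distinct ds" "set ds = {d \<in> D. c d = k}" "pack B [] ds (P k)"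
      using P[OF k] by blast
    then show ?thesis
      using pack_loads[of B "[]" ds "P k"] assms(1) by (auto simp: valid_NS_iff separate_def)
  qed
  have comp: "compatible d e" if "d \<in> D" "e \<in> D" "d \<noteq> e" "c d = c e" for d e
    using c that unfolding proper_colouring_def compatible_def conflicting_def by blast
  have colD: "c d < omega D" if "d \<in> D" for d
    using c that unfolding proper_colouring_def by auto
  show ?thesis
    unfolding block_partition_def
  proof (intro conjI ballI)
    show "finite BB" by (simp add: BB)
    show "{} \<notin> BB" using P' by (auto simp: BB)
    show "\<Union>BB = D"
    proof
      show "\<Union>BB \<subseteq> D" using P' by (fastforce simp: BB)
      show "D \<subseteq> \<Union>BB"
      proof
        fix d assume d: "d \<in> D"
        then have "d \<in> \<Union>(set (P (c d)))" using P'[OF colD[OF d]] by auto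
        then show "d \<in> \<Union>BB" using colD[OF d] by (auto simp: BB)
      qed
    qed
    show "pairwise disjnt BB"
    proof (rule pairwiseI)
      fix b b' assume "b \<in> BB" "b' \<in> BB" "b \<noteq> b'"
      then obtain k k' where k: "k < omega D" "b \<in> set (P k)" "k' < omega D" "b' \<in> set (P k')"
        by (auto simp: BB)
      show "disjnt b b'"
      proof (cases "k = k'")
        case True
        then show ?thesis using separate_disjoint P'[OF k(1)] k \<open>b \<noteq> b'\<close>
          unfolding pairwise_def by blast
      next
        case False
        have "b \<subseteq> {d \<in> D. c d = k}" "b' \<subseteq> {d \<in> D. c d = k'}"
          using P'[OF k(1)] P'[OF k(3)] k by blast+
        then show ?thesis using False by (auto simp: disjnt_def)
      qed
    qed
    fix b assume "b \<in> BB"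
    then obtain k where k: "k < omega D" "b \<in> set (P k)" by (auto simp: BB)
    have b: "b \<subseteq> {d \<in> D. c d = k}" using P'[OF k(1)] k by blast
    show "block B b"
      unfolding block_def
    proof (intro conjI)
      show "pairwise compatible b" by (rule pairwiseI) (use b comp in auto)
    qed (use P'[OF k(1)] k in auto)
  qed
qed

section \<open>Position of the groups relative to the waiting intervals\<close>

context
  fixes I :: instance_SC
  assumes valid: "valid_SC I"
begin

lemma cap_pos: "0 < cap I" and finite_deliveries: "finite (deliveries I)"
  and delivery_bounds: "d \<in> deliveries I \<Longrightarrow> tL d \<le> tR d \<and> 0 < cost d \<and> cost d \<le> cap I"
  using valid unfolding valid_SC_def by auto

lemma arr_dep: "1 \<le> l \<Longrightarrow> l \<le> num_stations I \<Longrightarrow> tA I l < tD I l"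
  using valid unfolding valid_SC_def by auto

lemma dep_arr_Suc: "1 \<le> l \<Longrightarrow> l < num_stations I \<Longrightarrow> tD I l < tA I (Suc l)"
  using valid unfolding valid_SC_def by auto

lemma dep_arr: "1 \<le> k \<Longrightarrow> k < l \<Longrightarrow> l \<le> num_stations I \<Longrightarrow> tD I k < tA I l"
proof (induction l)
  case (Suc l)
  show ?case
  proof (cases "k = l")
    case True
    then show ?thesis using Suc dep_arr_Suc by simp
  next
    case False
    then have "tD I k < tA I l" using Suc by simp
    then show ?thesis using arr_dep[of l] dep_arr_Suc[of l] Suc by simp
  qed
qed simp

lemma arr_mono: "1 \<le> k \<Longrightarrow> k \<le> l \<Longrightarrow> l \<le> num_stations I \<Longrightarrow> tA I k \<le> tA I l"
  using dep_arr[of k l] arr_dep[of k] by (cases "k = l") auto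

lemma not_within_waiting:
  "d \<in> deliveries I \<Longrightarrow> 1 \<le> l \<Longrightarrow> l \<le> num_stations I \<Longrightarrow> tL d < tA I l \<or> tD I l < tR d"
proof -
  assume "d \<in> deliveries I" "1 \<le> l" "l \<le> num_stations I"
  moreover have "\<forall>d \<in> deliveries I. \<forall>l \<in> {1..num_stations I}. \<not> interval d \<subseteq> waiting I l"
    using valid unfolding valid_SC_def by (elim conjE)
  ultimately have "\<not> interval d \<subseteq> waiting I l" by simp
  then show ?thesis by (auto simp: interval_def waiting_def)
qed

lemma meets_one_waiting:
  assumes "d \<in> deliveries I" "k \<in> {1..num_stations I}" "l \<in> {1..num_stations I}" "k \<noteq> l"
    "x \<in> interval d" "x \<in> waiting I k"
  shows "interval d \<inter> waiting I l = {}"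
proof -
  have "\<forall>d \<in> deliveries I. \<forall>k \<in> {1..num_stations I}. \<forall>l \<in> {1..num_stations I}.
      k \<noteq> l \<longrightarrow> interval d \<inter> waiting I k = {} \<or> interval d \<inter> waiting I l = {}"
    using valid unfolding valid_SC_def by (elim conjE)
  then have "interval d \<inter> waiting I k = {} \<or> interval d \<inter> waiting I l = {}"
    using assms(1-4) by blast
  then show ?thesis using assms(5,6) by blast
qed

lemma group_subset: "group I l \<subseteq> deliveries I"
  by (auto simp: group_def)

lemma finite_group: "finite (group I l)"
  using group_subset finite_deliveries finite_subset by blast

lemma valid_NS_group: "valid_NS (cap I) (group I l)"
  using cap_pos finite_group delivery_bounds group_subset by (auto simp: valid_NS_iff)

lemma group_unique:
  assumes "1 \<le> k" "k < l" "l \<le> num_stations I + 1" "d \<in> group I k" "d \<in> group I l"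
  shows False
proof -
  have "tL d < tA I k" "tA I (l - 1) \<le> tL d" using assms by (auto simp: group_def)
  moreover have "tA I k \<le> tA I (l - 1)" using assms by (intro arr_mono) auto
  ultimately show False by simp
qed

lemma in_some_group:
  assumes "d \<in> deliveries I"
  shows "\<exists>l \<in> {1..num_stations I + 1}. d \<in> group I l"
proof -
  let ?P = "\<lambda>l. 1 \<le> l \<and> (l \<le> num_stations I \<longrightarrow> tL d < tA I l)"
  \<comment> \<open>The first station that arrives after the delivery starts, or one past the last
    station; minimality gives the lower bound on \<open>tL d\<close>.\<close>
  define l where "l = (LEAST l. ?P l)"
  have P: "?P (num_stations I + 1)" by simp
  have l: "?P l" unfolding l_def by (rule LeastI[of ?P]) (rule P)
  have le: "l \<le> num_stations I + 1" unfolding l_def by (rule Least_le) (rule P)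
  have "tA I (l - 1) \<le> tL d" if "2 \<le> l"
  proof -
    have "\<not> ?P (l - 1)" using not_less_Least[of "l - 1" ?P] that unfolding l_def[symmetric] by auto
    then show ?thesis using that le by auto
  qed
  then show ?thesis using l le assms by (auto simp: group_def intro!: bexI[of _ l])
qed

lemma groups_disjoint:
  assumes "k \<in> {1..num_stations I + 1}" "l \<in> {1..num_stations I + 1}"
    "d \<in> group I k" "d \<in> group I l"
  shows "k = l"
  using assms group_unique[of k l d] group_unique[of l k d] by (metis atLeastAtMost_iff nat_neq_iff)

lemma not_last_end:
  assumes "d \<in> group I l" "d \<notin> I_last I l" "1 \<le> l" "l \<le> num_stations I"
  shows "tR d < tA I l"
  using assms by (auto simp: I_last_def group_def interval_def)

text \<open>A delivery still running at the arrival time of station l meets waiting interval l, so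
  it avoids the next waiting interval and, having started earlier, ends before it. Hence a drone
  that misses one station is always in time for the next.\<close>

lemma group_end:
  assumes "d \<in> group I l" "1 \<le> l" "l < num_stations I"
  shows "tR d < tA I (Suc l)"
proof (cases "d \<in> I_last I l")
  case True
  have "tA I l \<in> waiting I l" using arr_dep[of l] assms by (simp add: waiting_def)
  then have "interval d \<inter> waiting I (Suc l) = {}"
    using True assms group_subset by (intro meets_one_waiting[of d l "Suc l" "tA I l"]) (auto simp: I_last_def)
  moreover have "tA I (Suc l) \<in> waiting I (Suc l)"
    using arr_dep[of "Suc l"] assms by (simp add: waiting_def)
  moreover have "tL d < tA I l" using assms by (simp add: group_def)
  ultimately show ?thesis
    using dep_arr[of l "Suc l"] arr_dep[of l] assms
    by (metis (no_types, lifting) IntI atLeastAtMost_iff empty_iff interval_def le_less_linear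
        lessI less_imp_le order_less_trans Suc_leI)
next
  case False
  then have "tR d < tA I l" using not_last_end assms by simp
  then show ?thesis using arr_mono[of l "Suc l"] assms by simp
qed

lemma group_end_le:
  assumes "d \<in> group I k" "1 \<le> k" "k < l" "l \<le> num_stations I"
  shows "tR d < tA I l"
  using group_end[of d k] arr_mono[of "Suc k" l] assms by force

text \<open>The delivery starts at or after the arrival time, so ending by the departure time would
  put it inside the waiting interval. It thus ends later, and since it does not contain the
  departure time, it also starts later.\<close>

lemma not_first_start:
  assumes "d \<in> group I l" "d \<notin> I_first I l" "2 \<le> l" "l \<le> num_stations I + 1"
  shows "tD I (l - 1) < tL d"
proof -
  have "tL d < tA I (l - 1) \<or> tD I (l - 1) < tR d"
    using assms by (intro not_within_waiting) (auto simp: group_def)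
  then show ?thesis using assms by (auto simp: I_first_def group_def interval_def)
qed

end


section \<open>Executions of the assignment phase\<close>

fun remaining :: "instance_SC \<Rightarrow> real \<Rightarrow> activity list \<Rightarrow> real" where
  "remaining I rem [] = rem"
| "remaining I rem (Deliver d # xs) = remaining I (rem - cost d) xs"
| "remaining I rem (Recharge l t t' # xs) = remaining I (recharged I l t t' rem) xs"

lemma remaining_append: "remaining I rem (xs @ ys) = remaining I (remaining I rem xs) ys"
  by (induction I rem xs rule: remaining.induct) auto

lemma battery_suffices_append:
  "battery_suffices I rem (xs @ ys) \<longleftrightarrow>
     battery_suffices I rem xs \<and> battery_suffices I (remaining I rem xs) ys"
  by (induction I rem xs rule: remaining.induct) auto

lemma remaining_deliveries: "remaining I rem (map Deliver ds) = rem - sum_list (map cost ds)"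
  by (induction ds arbitrary: rem) auto

lemma battery_suffices_deliveries:
  "(\<And>d. d \<in> set ds \<Longrightarrow> 0 \<le> cost d) \<Longrightarrow> sum_list (map cost ds) \<le> rem \<Longrightarrow>
    battery_suffices I rem (map Deliver ds)"
proof (induction ds arbitrary: rem)
  case (Cons d ds)
  have "0 \<le> sum_list (map cost ds)" using Cons.prems(1) by (intro sum_list_nonneg) auto
  then show ?case using Cons by (auto simp: algebra_simps)
qed simp

text \<open>For activities that start no later than they end, this one relation yields distinctness,
  sorted starts and disjoint spans together, and an appended list only needs comparisons across the
  cut.\<close>

definition chron :: "activity list \<Rightarrow> bool" where
  "chron = sorted_wrt (\<lambda>x y. snd (period x) < fst (period y))"

lemma chron_append:
  "chron (xs @ ys) \<longleftrightarrow> chron xs \<and> chron ys \<and>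
     (\<forall>x \<in> set xs. \<forall>y \<in> set ys. snd (period x) < fst (period y))"
  by (simp add: chron_def sorted_wrt_append)

lemma chron_feasible:
  assumes "chron xs" "\<And>x. x \<in> set xs \<Longrightarrow> admissible I x"
    and le: "\<And>x. x \<in> set xs \<Longrightarrow> fst (period x) \<le> snd (period x)"
    and "battery_suffices I (cap I) xs"
  shows "feasible I (set xs)"
proof -
  let ?R = "\<lambda>x y. snd (period x) < fst (period y)"
  have "distinct xs \<and> sorted (map (fst \<circ> period) xs) \<and>
    pairwise (\<lambda>x y. span x \<inter> span y = {}) (set xs)"
    using assms(1) le
  proof (induction xs)
    case (Cons x xs)
    have x: "snd (period x) < fst (period y)" if "y \<in> set xs" for y
      using Cons.prems(1) that by (simp add: chron_def)
    have IH: "distinct xs \<and> sorted (map (fst \<circ> period) xs) \<and>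
      pairwise (\<lambda>x y. span x \<inter> span y = {}) (set xs)"
      using Cons by (simp add: chron_def comp_def)
    have sep: "span x \<inter> span y = {}" if "y \<in> set xs" for y
      using x[OF that] by (auto simp: span_def)
    have "x \<notin> set xs" using x[of x] Cons.prems(2)[of x] by auto
    moreover have "fst (period x) \<le> fst (period y)" if "y \<in> set xs" for y
      using x[OF that] Cons.prems(2)[of x] by simp
    ultimately show ?case using IH sep by (auto simp: pairwise_insert comp_def)
  qed simp
  then show ?thesis using assms unfolding feasible_def by blast
qed

text \<open>Sorting by start is enough: of two disjoint closed intervals, the one with the smaller
  start ends strictly before the other begins.\<close>

lemma block_chron:
  assumes "finite b" "pairwise compatible b" "\<And>d. d \<in> b \<Longrightarrow> tL d \<le> tR d"
  obtains ds where "distinct ds" "set ds = b" "chron (map Deliver ds)"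
proof -
  obtain xs where xs: "distinct xs" "set xs = b" using finite_distinct_list[OF assms(1)] by blast
  define ds where "ds = sort_key tL xs"
  have ds: "distinct ds" "set ds = b" "sorted (map tL ds)"
    using xs by (auto simp: ds_def)
  have "sorted_wrt (\<lambda>d e. tR d < tL e) ds"
    unfolding sorted_wrt_iff_nth_less
  proof (intro allI impI)
    fix i j assume ij: "i < j" "j < length ds"
    then have "tL (ds ! i) \<le> tL (ds ! j)"
      using sorted_nth_mono[OF ds(3), of i j] by simp
    moreover have "ds ! i \<in> b" "ds ! j \<in> b" "ds ! i \<noteq> ds ! j"
      using ds ij nth_eq_iff_index_eq[OF ds(1)] nth_mem by auto
    moreover from this have "compatible (ds ! i) (ds ! j)"
      using assms(2) by (simp add: pairwise_def)
    ultimately show "tR (ds ! i) < tL (ds ! j)"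
      using assms(3)[of "ds ! j"] by (fastforce simp: compatible_def interval_def)
  qed
  then have "chron (map Deliver ds)" by (simp add: chron_def sorted_wrt_map)
  then show ?thesis using that ds by blast
qed

section \<open>Effect of assigning and of recharging on the state\<close>

lemma busy_assign: "busy (assign s b i) l = busy s l \<union> (if l = stage s then {i} else {})"
  by (auto simp: busy_def assign_def)

lemma D_last_assign: "l \<noteq> stage s \<Longrightarrow> D_last I (assign s b i) l = D_last I s l"
  by (auto simp: D_last_def assign_def)

lemma schedule_assign:
  "schedule I (assign s b i) j = schedule I s j \<union> (if j = i then Deliver ` b else {})"
  by (auto simp: schedule_def assign_def)

lemma recharge_simps:
  "stage (recharge I s) = Suc (stage s)"
  "assigned (recharge I s) = assigned s"
  "charged (recharge I s) = charged s \<union> {(stage s, i) | i. i \<in> rechargers I s}"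
  "battery (recharge I s) i = (if i \<in> rechargers I s
     then recharged I (stage s) (tA I (stage s)) (tD I (stage s)) (battery s i) else battery s i)"
  "busy (recharge I s) l = busy s l"
  "D_last I (recharge I s) l = D_last I s l"
  by (auto simp: recharge_def Let_def busy_def D_last_def)

lemma schedule_recharge:
  "schedule I (recharge I s) j = schedule I s j \<union> (if j \<in> rechargers I s
     then {Recharge (stage s) (tA I (stage s)) (tD I (stage s))} else {})"
  by (auto simp: schedule_def recharge_simps)

lemma D_last_busy: "D_last I s l \<subseteq> busy s l"
  by (auto simp: D_last_def busy_def)

lemma D_first_busy: "D_first I s l \<subseteq> busy s l"
  by (auto simp: D_first_def busy_def)

section \<open>The invariant of the assignment phase\<close>

definition block_families :: "instance_SC \<Rightarrow> (nat \<Rightarrow> delivery set set) \<Rightarrow> bool" where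
  "block_families I Bl \<longleftrightarrow>
    (\<forall>l \<in> {1..num_stations I + 1}. block_partition (cap I) (group I l) (Bl l))"

text \<open>During a stage the drones below capacity are those already given a block of the current
  group and those that missed the previous station. The clause on \<open>charged\<close> lets a
  drone eligible for a block meeting \<open>I_first\<close> be recognised as one that did not
  recharge at the previous station. Feasibility is carried by a chronological witness list ending at
  the current battery level. The last clause, that other blocks wait for those meeting
  \<open>I_first\<close>, bounds the number of busy drones in \<open>progress\<close>.\<close>

definition inv :: "instance_SC \<Rightarrow> (nat \<Rightarrow> delivery set set) \<Rightarrow> state \<Rightarrow> bool" where
  "inv I Bl s \<longleftrightarrow>
    1 \<le> stage s \<and> stage s \<le> num_stations I + 1 \<and>
    (\<forall>l b i. (l, b, i) \<in> assigned s \<longrightarrow> 1 \<le> l \<and> l \<le> stage s \<and> b \<in> Bl l \<and> i < num_drones I Bl) \<and>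
    (\<forall>l b. 1 \<le> l \<longrightarrow> l < stage s \<longrightarrow> b \<in> Bl l \<longrightarrow> (\<exists>i. (l, b, i) \<in> assigned s)) \<and>
    (\<forall>l b i j. (l, b, i) \<in> assigned s \<longrightarrow> (l, b, j) \<in> assigned s \<longrightarrow> i = j) \<and>
    (\<forall>l i. (l, i) \<in> charged s \<longrightarrow> 1 \<le> l \<and> l < stage s \<and> i \<in> busy s l \<union> D_last I s (l - 1)) \<and>
    (\<forall>i. 0 \<le> battery s i \<and> battery s i \<le> cap I \<and>
      (battery s i < cap I \<longleftrightarrow> i \<in> busy s (stage s) \<union> D_last I s (stage s - 1))) \<and>
    (\<forall>i. \<exists>xs. chron xs \<and> set xs = schedule I s i \<and> battery_suffices I (cap I) xs \<and>
      remaining I (cap I) xs = battery s i) \<and>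
    (\<forall>b i. (stage s, b, i) \<in> assigned s \<longrightarrow> b \<inter> I_first I (stage s) = {} \<longrightarrow>
      (\<forall>b' \<in> Bl (stage s). b' \<inter> I_first I (stage s) \<noteq> {} \<longrightarrow> done_block s b'))"

lemma invI:
  assumes "1 \<le> stage s" "stage s \<le> num_stations I + 1"
    "\<And>l b i. (l, b, i) \<in> assigned s \<Longrightarrow> 1 \<le> l \<and> l \<le> stage s \<and> b \<in> Bl l \<and> i < num_drones I Bl"
    "\<And>l b. 1 \<le> l \<Longrightarrow> l < stage s \<Longrightarrow> b \<in> Bl l \<Longrightarrow> \<exists>i. (l, b, i) \<in> assigned s"
    "\<And>l b i j. (l, b, i) \<in> assigned s \<Longrightarrow> (l, b, j) \<in> assigned s \<Longrightarrow> i = j"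
    "\<And>l i. (l, i) \<in> charged s \<Longrightarrow> 1 \<le> l \<and> l < stage s \<and> i \<in> busy s l \<union> D_last I s (l - 1)"
    "\<And>i. 0 \<le> battery s i \<and> battery s i \<le> cap I \<and>
      (battery s i < cap I \<longleftrightarrow> i \<in> busy s (stage s) \<union> D_last I s (stage s - 1))"
    "\<And>i. \<exists>xs. chron xs \<and> set xs = schedule I s i \<and> battery_suffices I (cap I) xs \<and>
      remaining I (cap I) xs = battery s i"
    "\<And>b i b'. (stage s, b, i) \<in> assigned s \<Longrightarrow> b \<inter> I_first I (stage s) = {} \<Longrightarrow>
      b' \<in> Bl (stage s) \<Longrightarrow> b' \<inter> I_first I (stage s) \<noteq> {} \<Longrightarrow> done_block s b'"
  shows "inv I Bl s"
  unfolding inv_def by (intro conjI) (use assms in blast)+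

lemma invD:
  assumes "inv I Bl s"
  shows "1 \<le> stage s" "stage s \<le> num_stations I + 1"
    "\<And>l b i. (l, b, i) \<in> assigned s \<Longrightarrow> 1 \<le> l \<and> l \<le> stage s \<and> b \<in> Bl l \<and> i < num_drones I Bl"
    "\<And>l b. 1 \<le> l \<Longrightarrow> l < stage s \<Longrightarrow> b \<in> Bl l \<Longrightarrow> \<exists>i. (l, b, i) \<in> assigned s"
    "\<And>l b i j. (l, b, i) \<in> assigned s \<Longrightarrow> (l, b, j) \<in> assigned s \<Longrightarrow> i = j"
    "\<And>l i. (l, i) \<in> charged s \<Longrightarrow> 1 \<le> l \<and> l < stage s \<and> i \<in> busy s l \<union> D_last I s (l - 1)"
    "\<And>i. 0 \<le> battery s i \<and> battery s i \<le> cap I \<and>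
      (battery s i < cap I \<longleftrightarrow> i \<in> busy s (stage s) \<union> D_last I s (stage s - 1))"
    "\<And>i. \<exists>xs. chron xs \<and> set xs = schedule I s i \<and> battery_suffices I (cap I) xs \<and>
      remaining I (cap I) xs = battery s i"
    "\<And>b i b'. (stage s, b, i) \<in> assigned s \<Longrightarrow> b \<inter> I_first I (stage s) = {} \<Longrightarrow>
      b' \<in> Bl (stage s) \<Longrightarrow> b' \<inter> I_first I (stage s) \<noteq> {} \<Longrightarrow> done_block s b'"
  subgoal using assms[unfolded inv_def, THEN conjunct1] by blast
  subgoal using assms[unfolded inv_def, THEN conjunct2, THEN conjunct1] by blast
  subgoal using assms[unfolded inv_def, THEN conjunct2, THEN conjunct2, THEN conjunct1] by blast
  subgoal using assms[unfolded inv_def, THEN conjunct2, THEN conjunct2, THEN conjunct2, THEN conjunct1] by blast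
  subgoal using assms[unfolded inv_def, THEN conjunct2, THEN conjunct2, THEN conjunct2, THEN conjunct2, THEN conjunct1] by blast
  subgoal using assms[unfolded inv_def, THEN conjunct2, THEN conjunct2, THEN conjunct2, THEN conjunct2, THEN conjunct2, THEN conjunct1] by blast
  subgoal using assms[unfolded inv_def, THEN conjunct2, THEN conjunct2, THEN conjunct2, THEN conjunct2, THEN conjunct2, THEN conjunct2, THEN conjunct1] by blast
  subgoal using assms[unfolded inv_def, THEN conjunct2, THEN conjunct2, THEN conjunct2, THEN conjunct2, THEN conjunct2, THEN conjunct2, THEN conjunct2, THEN conjunct1] by blast
  subgoal using assms[unfolded inv_def, THEN conjunct2, THEN conjunct2, THEN conjunct2, THEN conjunct2, THEN conjunct2, THEN conjunct2, THEN conjunct2, THEN conjunct2] by blast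
  done

context
  fixes I :: instance_SC and Bl :: "nat \<Rightarrow> delivery set set"
  assumes valid: "valid_SC I" and families: "block_families I Bl"
begin

lemma block_facts:
  assumes "1 \<le> l" "l \<le> num_stations I + 1" "b \<in> Bl l"
  shows "finite b" "b \<noteq> {}" "pairwise compatible b" "sum cost b \<le> cap I" "b \<subseteq> group I l"
    "0 < sum cost b" "\<And>d. d \<in> b \<Longrightarrow> tL d \<le> tR d \<and> 0 < cost d"
proof -
  have p: "block_partition (cap I) (group I l) (Bl l)"
    using families assms by (simp add: block_families_def)
  show b: "finite b" "b \<noteq> {}" "pairwise compatible b" "sum cost b \<le> cap I" "b \<subseteq> group I l"
    using block_partitionD[OF p] assms(3) by auto
  show d: "tL d \<le> tR d \<and> 0 < cost d" if "d \<in> b" for d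
    using that b(5) group_subset[OF valid] delivery_bounds[OF valid] by blast
  show "0 < sum cost b" using b(1,2) d by (intro sum_pos) auto
qed

lemma families_facts:
  assumes "1 \<le> l" "l \<le> num_stations I + 1"
  shows "finite (Bl l)" "\<Union>(Bl l) = group I l"
    "\<And>b b' d. b \<in> Bl l \<Longrightarrow> b' \<in> Bl l \<Longrightarrow> d \<in> b \<Longrightarrow> d \<in> b' \<Longrightarrow> b = b'"
proof -
  have p: "block_partition (cap I) (group I l) (Bl l)"
    using families assms by (simp add: block_families_def)
  show "finite (Bl l)" "\<Union>(Bl l) = group I l"
    by (rule block_partitionD[OF p])+
  show "b = b'" if "b \<in> Bl l" "b' \<in> Bl l" "d \<in> b" "d \<in> b'" for b b' d
    using block_partitionD(8)[OF p that] .
qed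

lemma inv_init: "inv I Bl (init I)"
proof (rule invI)
  fix i show "\<exists>xs. chron xs \<and> set xs = schedule I (init I) i \<and> battery_suffices I (cap I) xs \<and>
      remaining I (cap I) xs = battery (init I) i"
    by (rule exI[of _ "[]"]) (auto simp: chron_def schedule_def init_def)
qed (use cap_pos[OF valid] in \<open>auto simp: init_def busy_def D_last_def\<close>)

lemma scheduled_cases:
  assumes "inv I Bl s" "x \<in> schedule I s i"
  obtains (deliver) d k b where "x = Deliver d" "(k, b, i) \<in> assigned s" "d \<in> b" "d \<in> group I k"
      "1 \<le> k" "k \<le> stage s"
    | (recharge) k where "x = Recharge k (tA I k) (tD I k)" "(k, i) \<in> charged s"
      "1 \<le> k" "k < stage s"
proof -
  consider d k b where "x = Deliver d" "(k, b, i) \<in> assigned s" "d \<in> b"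
    | k where "x = Recharge k (tA I k) (tD I k)" "(k, i) \<in> charged s"
    using assms(2) by (auto simp: schedule_def)
  then show ?thesis
  proof cases
    case 1
    have k: "1 \<le> k" "k \<le> stage s" "b \<in> Bl k" using invD(3)[OF assms(1) 1(2)] by auto
    moreover have "d \<in> group I k"
      using block_facts(5)[of k b] k invD(2)[OF assms(1)] 1(3) by auto
    ultimately show ?thesis using deliver 1 by blast
  next
    case 2
    then show ?thesis using recharge invD(6)[OF assms(1) 2(2)] by blast
  qed
qed

text \<open>The delivery starts no earlier than \<open>tA I (stage s - 1)\<close>. Deliveries of
  earlier groups end before that time, those of the preceding group because the drone is outside its
  \<open>D_last\<close>, and so do recharges at earlier stations. Only a recharge at the preceding
  station reaches further, up to its departure time; this hurts just the deliveries of
  \<open>I_first\<close>, whence the hypothesis \<open>first\<close>.\<close>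

lemma scheduled_before_assign:
  assumes "inv I Bl s" "i \<notin> busy s (stage s)" "i \<notin> D_last I s (stage s - 1)"
    and d: "d \<in> group I (stage s)"
    and first: "d \<in> I_first I (stage s) \<Longrightarrow> (stage s - 1, i) \<notin> charged s"
    and x: "x \<in> schedule I s i"
  shows "snd (period x) < tL d"
  using assms(1) x
proof (cases rule: scheduled_cases)
  case (deliver e k b)
  have r: "stage s \<le> num_stations I + 1" by (rule invD[OF assms(1)])
  have "k \<noteq> stage s" using assms(2) deliver by (auto simp: busy_def)
  then have k: "k < stage s" using deliver by simp
  then have start: "tA I (stage s - 1) \<le> tL d" using d deliver by (simp add: group_def)
  show ?thesis
  proof (cases "k = stage s - 1")
    case True
    have "e \<notin> I_last I k" using assms(3) deliver True by (auto simp: D_last_def)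
    then have "tR e < tA I k" using not_last_end[OF valid] deliver k r by simp
    then show ?thesis using deliver start True by simp
  next
    case False
    then have "tR e < tA I (stage s - 1)"
      using deliver k r by (intro group_end_le[OF valid]) auto
    then show ?thesis using deliver start by simp
  qed
next
  case (recharge k)
  have r: "stage s \<le> num_stations I + 1" by (rule invD[OF assms(1)])
  have start: "tA I (stage s - 1) \<le> tL d" using d recharge by (simp add: group_def)
  show ?thesis
  proof (cases "k = stage s - 1")
    case True
    then have "d \<notin> I_first I (stage s)" using first recharge by auto
    then show ?thesis using not_first_start[OF valid d] recharge True r by simp
  next
    case False
    then have "tD I k < tA I (stage s - 1)" using recharge r by (intro dep_arr[OF valid]) auto
    then show ?thesis using recharge start by simp
  qed
qed

text \<open>Membership in \<open>D_last\<close> of the preceding group does no harm: by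
  \<open>group_end_le\<close> such a delivery is over before the present station opens.\<close>

lemma scheduled_before_recharge:
  assumes "inv I Bl s" "i \<notin> D_last I s (stage s)" "stage s \<le> num_stations I"
    and x: "x \<in> schedule I s i"
  shows "snd (period x) < tA I (stage s)"
  using assms(1) x
proof (cases rule: scheduled_cases)
  case (deliver e k b)
  show ?thesis
  proof (cases "k = stage s")
    case True
    have "e \<notin> I_last I k" using assms(2) deliver True by (auto simp: D_last_def)
    then show ?thesis using not_last_end[OF valid] deliver True assms(3) by simp
  next
    case False
    then show ?thesis using group_end_le[OF valid] deliver assms(3) by simp
  qed
next
  case (recharge k)
  then show ?thesis using dep_arr[OF valid] assms(3) by simp
qed

lemma recharged_full:
  assumes "1 \<le> l" "l \<le> num_stations I" "0 \<le> rem" "rem \<le> cap I"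
  shows "recharged I l (tA I l) (tD I l) rem = cap I"
proof -
  have "\<forall>l \<in> {1..num_stations I}. \<forall>Ch. kind (station_at I l) = Charging Ch \<longrightarrow>
      valid_charge (cap I) (tA I l) (tD I l) Ch"
    using valid unfolding valid_SC_def by (elim conjE)
  then show ?thesis using assms
    by (auto simp: recharged_def valid_charge_def split: station_kind.split)
qed

text \<open>The exclusions on \<open>i\<close> make its battery full, so a block of total cost at
  most the capacity can be served without looking at its order; appending it to the witness list is
  justified by \<open>scheduled_before_assign\<close>.\<close>

lemma inv_assign:
  assumes inv: "inv I Bl s"
    and b: "b \<in> Bl (stage s)" and new: "\<not> done_block s b" and i: "i < num_drones I Bl"
    and free: "i \<notin> busy s (stage s)" "i \<notin> D_last I s (stage s - 1)"
    and first: "b \<inter> I_first I (stage s) \<noteq> {} \<Longrightarrow> (stage s - 1, i) \<notin> charged s"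
    and rest: "\<And>b'. b \<inter> I_first I (stage s) = {} \<Longrightarrow> b' \<in> Bl (stage s) \<Longrightarrow>
      b' \<inter> I_first I (stage s) \<noteq> {} \<Longrightarrow> done_block s b'"
  shows "inv I Bl (assign s b i)"
proof -
  let ?t = "assign s b i"
  note D = invD[OF inv]
  have sl: "1 \<le> stage s" "stage s \<le> num_stations I + 1" using D(1,2) .
  note bf = block_facts[OF sl b]
  have [simp]: "stage ?t = stage s" "charged ?t = charged s"
    "assigned ?t = insert (stage s, b, i) (assigned s)"
    "battery ?t = (battery s)(i := battery s i - sum cost b)" by (simp_all add: assign_def)
  have full: "battery s i = cap I" using D(7)[of i] free by force
  show ?thesis
  proof (rule invI)
    fix l b' j k
    show "(l, b', j) \<in> assigned ?t \<Longrightarrow> (l, b', k) \<in> assigned ?t \<Longrightarrow> j = k"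
      using D(5) new by (auto simp: done_block_def)
  next
    fix l b' j
    show "(l, b', j) \<in> assigned ?t \<Longrightarrow> 1 \<le> l \<and> l \<le> stage ?t \<and> b' \<in> Bl l \<and> j < num_drones I Bl"
      using D(3) b i sl by auto
  next
    fix l b'
    show "1 \<le> l \<Longrightarrow> l < stage ?t \<Longrightarrow> b' \<in> Bl l \<Longrightarrow> \<exists>i. (l, b', i) \<in> assigned ?t"
      using D(4) by auto
  next
    fix l j
    assume "(l, j) \<in> charged ?t"
    then have "1 \<le> l \<and> l < stage s \<and> j \<in> busy s l \<union> D_last I s (l - 1)" using D(6) by simp
    then show "1 \<le> l \<and> l < stage ?t \<and> j \<in> busy ?t l \<union> D_last I ?t (l - 1)"
      by (auto simp: busy_assign D_last_assign)
  next
    fix j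
    have "D_last I ?t (stage s - 1) = D_last I s (stage s - 1)"
      using sl by (intro D_last_assign) auto
    then show "0 \<le> battery ?t j \<and> battery ?t j \<le> cap I \<and>
      (battery ?t j < cap I \<longleftrightarrow> j \<in> busy ?t (stage ?t) \<union> D_last I ?t (stage ?t - 1))"
      using D(7)[of j] full bf(4,6) by (auto simp: busy_assign)
  next
    fix j
    obtain xs where xs: "chron xs" "set xs = schedule I s j" "battery_suffices I (cap I) xs"
        "remaining I (cap I) xs = battery s j"
      using D(8)[of j] by blast
    show "\<exists>xs. chron xs \<and> set xs = schedule I ?t j \<and> battery_suffices I (cap I) xs \<and>
      remaining I (cap I) xs = battery ?t j"
    proof (cases "j = i")
      case False
      then show ?thesis using xs by (intro exI[of _ xs]) (simp add: schedule_assign)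
    next
      case True
      obtain ds where ds: "distinct ds" "set ds = b" "chron (map Deliver ds)"
        using block_chron[OF bf(1,3)] bf(7) by blast
      have sum: "sum_list (map cost ds) = sum cost b"
        using ds by (simp add: sum_list_distinct_conv_sum_set)
      have before: "snd (period x) < tL d" if "x \<in> schedule I s i" "d \<in> b" for x d
        using that bf(5) first by (intro scheduled_before_assign[OF inv free]) auto
      have "battery_suffices I (battery s i) (map Deliver ds)"
        using ds bf(4,7) sum full by (intro battery_suffices_deliveries) force+
      then show ?thesis
        using xs ds sum before True
        by (intro exI[of _ "xs @ map Deliver ds"])
          (auto simp: chron_append schedule_assign battery_suffices_append remaining_append
            remaining_deliveries)
    qed
  next
    fix b' j b''
    have "done_block s b'' \<Longrightarrow> done_block ?t b''" by (auto simp: done_block_def)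
    moreover assume "(stage ?t, b', j) \<in> assigned ?t" "b' \<inter> I_first I (stage ?t) = {}"
      "b'' \<in> Bl (stage ?t)" "b'' \<inter> I_first I (stage ?t) \<noteq> {}"
    ultimately show "done_block ?t b''"
      using rest[of b''] D(9)[of b' j b''] by auto
  qed (use sl in simp_all)
qed

text \<open>The late drones of the preceding group recharge now together with the current ones, so
  only \<open>D_last\<close> of the finished stage stays below capacity. After the stage counter
  advances, this is the previous-stage term of the battery clause, while nobody is busy yet.\<close>

lemma inv_recharge:
  assumes inv: "inv I Bl s"
    and finished: "\<And>b. b \<in> Bl (stage s) \<Longrightarrow> done_block s b"
    and st: "stage s \<le> num_stations I"
  shows "inv I Bl (recharge I s)"
proof -
  let ?t = "recharge I s" and ?l = "stage s"
  note D = invD[OF inv]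
  have full: "recharged I ?l (tA I ?l) (tD I ?l) (battery s i) = cap I" for i
    using recharged_full[OF D(1) st] D(7)[of i] by simp
  have chargers: "i \<in> busy s ?l \<union> D_last I s (?l - 1)" "i \<notin> D_last I s ?l"
    if "i \<in> rechargers I s" for i
    using that D(7)[of i] by (auto simp: rechargers_def)
  show ?thesis
  proof (rule invI)
    fix l b i
    show "(l, b, i) \<in> assigned ?t \<Longrightarrow> 1 \<le> l \<and> l \<le> stage ?t \<and> b \<in> Bl l \<and> i < num_drones I Bl"
      using D(3)[of l b i] by (auto simp: recharge_simps)
  next
    fix l b
    assume "1 \<le> l" "l < stage ?t" "b \<in> Bl l"
    then show "\<exists>i. (l, b, i) \<in> assigned ?t"
      using D(4)[of l b] finished[of b] by (cases "l = ?l") (auto simp: recharge_simps done_block_def)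
  next
    fix l b i j
    show "(l, b, i) \<in> assigned ?t \<Longrightarrow> (l, b, j) \<in> assigned ?t \<Longrightarrow> i = j"
      using D(5) by (simp add: recharge_simps)
  next
    fix l i
    assume "(l, i) \<in> charged ?t"
    then consider "(l, i) \<in> charged s" | "l = ?l" "i \<in> rechargers I s"
      by (auto simp: recharge_simps)
    then show "1 \<le> l \<and> l < stage ?t \<and> i \<in> busy ?t l \<union> D_last I ?t (l - 1)"
    proof cases
      case 1
      then show ?thesis using D(6) by (fastforce simp: recharge_simps)
    next
      case 2
      then show ?thesis using chargers D(1) by (simp add: recharge_simps)
    qed
  next
    fix i
    have "i \<notin> busy s (Suc ?l)" using D(3) by (fastforce simp: busy_def)
    moreover have "i \<in> used s" if "i \<in> busy s ?l \<union> D_last I s (?l - 1)"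
      using that by (auto simp: busy_def D_last_def used_def)
    moreover have "i \<in> D_last I s ?l \<Longrightarrow> i \<in> busy s ?l" using D_last_busy by blast
    ultimately show "0 \<le> battery ?t i \<and> battery ?t i \<le> cap I \<and>
      (battery ?t i < cap I \<longleftrightarrow> i \<in> busy ?t (stage ?t) \<union> D_last I ?t (stage ?t - 1))"
      using D(7)[of i] full[of i] cap_pos[OF valid] by (auto simp: recharge_simps rechargers_def)
  next
    fix i
    obtain xs where xs: "chron xs" "set xs = schedule I s i" "battery_suffices I (cap I) xs"
        "remaining I (cap I) xs = battery s i"
      using D(8)[of i] by blast
    show "\<exists>xs. chron xs \<and> set xs = schedule I ?t i \<and> battery_suffices I (cap I) xs \<and>
      remaining I (cap I) xs = battery ?t i"
    proof (cases "i \<in> rechargers I s")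
      case False
      then show ?thesis using xs by (intro exI[of _ xs]) (simp add: schedule_recharge recharge_simps)
    next
      case True
      have before: "snd (period x) < tA I ?l" if "x \<in> schedule I s i" for x
        using scheduled_before_recharge[OF inv chargers(2)[OF True] st that] .
      then show ?thesis
        using xs True
        by (intro exI[of _ "xs @ [Recharge ?l (tA I ?l) (tD I ?l)]"])
          (auto simp: chron_append schedule_recharge battery_suffices_append remaining_append
            recharge_simps, simp add: chron_def)
    qed
  next
    fix b i b'
    show "(stage ?t, b, i) \<in> assigned ?t \<Longrightarrow> b \<inter> I_first I (stage ?t) = {} \<Longrightarrow>
      b' \<in> Bl (stage ?t) \<Longrightarrow> b' \<inter> I_first I (stage ?t) \<noteq> {} \<Longrightarrow> done_block ?t b'"
      using D(3)[of "Suc ?l" b i] by (simp add: recharge_simps)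
  qed (use D(1) st in \<open>simp_all add: recharge_simps\<close>)
qed

lemma inv_step:
  assumes "step I Bl s t" "inv I Bl s"
  shows "inv I Bl t"
  using assms
proof cases
  case (assign_first b i)
  \<comment> \<open>By the invariant, a drone that recharged at the preceding station was busy in
    that stage or in \<open>D_last\<close> one stage earlier; these are the two exclusions of
    \<open>assign_first\<close>.\<close>
  have "(stage s - 1, i) \<notin> charged s"
    using invD(6)[OF assms(2), of "stage s - 1" i] assign_first by (auto simp: numeral_2_eq_2)
  then show ?thesis
    using assign_first assms(2) D_last_busy[of I s "stage s - 1"] by (auto intro!: inv_assign)
next
  case (assign_rest b i)
  then show ?thesis using assms(2) by (auto intro!: inv_assign)
next
  case recharge
  then show ?thesis using assms(2) by (auto intro!: inv_recharge)
qed

lemma inv_reachable: "(step I Bl)\<^sup>*\<^sup>* s t \<Longrightarrow> inv I Bl s \<Longrightarrow> inv I Bl t"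
  by (induction rule: rtranclp_induct) (auto intro: inv_step)

lemma card_drones_le:
  assumes "inv I Bl s" "finite X" "\<And>b i. (l, b, i) \<in> assigned s \<Longrightarrow> P b \<Longrightarrow> b \<in> X"
  shows "finite {i. \<exists>b. (l, b, i) \<in> assigned s \<and> P b} \<and>
    card {i. \<exists>b. (l, b, i) \<in> assigned s \<and> P b} \<le> card X"
proof -
  \<comment> \<open>A block has at most one drone, so the drones to be counted are images of
    blocks.\<close>
  let ?f = "\<lambda>b. THE i. (l, b, i) \<in> assigned s"
  have f: "?f b = i" if "(l, b, i) \<in> assigned s" for b i
    using that invD(5)[OF assms(1)] by blast
  have "{i. \<exists>b. (l, b, i) \<in> assigned s \<and> P b} \<subseteq> ?f ` X"
  proof clarify
    fix i b assume *: "(l, b, i) \<in> assigned s" "P b"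
    then show "i \<in> ?f ` X" using assms(3)[OF *] f[OF *(1)] by (intro rev_image_eqI[of b]) auto
  qed
  then show ?thesis using assms(2)
    by (meson card_image_le card_mono finite_imageI finite_subset order_trans)
qed

text \<open>One delivery of \<open>T\<close> is chosen from each block. Disjointness of the blocks
  makes the choice injective, and the chosen deliveries conflict pairwise because they share
  \<open>p\<close>.\<close>

lemma card_blocks_at_point:
  assumes "1 \<le> l" "l \<le> num_stations I + 1" "T \<subseteq> deliveries I" "\<And>d. d \<in> T \<Longrightarrow> p \<in> interval d"
  shows "card {b \<in> Bl l. b \<inter> T \<noteq> {}} \<le> omega (deliveries I)"
proof -
  let ?X = "{b \<in> Bl l. b \<inter> T \<noteq> {}}"
  define f where "f = (\<lambda>b. SOME d. d \<in> b \<inter> T)"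
  have f: "f b \<in> b \<inter> T" if "b \<in> ?X" for b
    unfolding f_def using that by (intro someI_ex[of "\<lambda>d. d \<in> b \<inter> T"]) auto
  have "inj_on f ?X"
    using f families_facts(3)[OF assms(1,2)] by (intro inj_onI) (metis (no_types, lifting) IntD1 mem_Collect_eq)
  then have "card ?X = card (f ` ?X)" by (simp add: card_image)
  also have "\<dots> \<le> omega (deliveries I)"
  proof (rule omega_upper)
    have sub: "f ` ?X \<subseteq> T" using f by blast
    then show "f ` ?X \<subseteq> deliveries I" using assms(3) by blast
    show "pairwise conflicting (f ` ?X)"
      using sub assms(4) unfolding conflicting_def by (intro pairwiseI) blast
  qed (rule finite_deliveries[OF valid])
  finally show ?thesis .
qed

lemma card_first_blocks:
  assumes "1 \<le> l" "l \<le> num_stations I + 1"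
  shows "card {b \<in> Bl l. b \<inter> I_first I l \<noteq> {}} \<le> omega (deliveries I)"
  using assms group_subset[OF valid]
  by (intro card_blocks_at_point[where p = "tD I (l - 1)"]) (auto simp: I_first_def split: if_splits)

lemma card_last_blocks:
  assumes "1 \<le> l" "l \<le> num_stations I + 1"
  shows "card {b \<in> Bl l. b \<inter> I_last I l \<noteq> {}} \<le> omega (deliveries I)"
  using assms group_subset[OF valid]
  by (intro card_blocks_at_point[where p = "tA I l"]) (auto simp: I_last_def split: if_splits)

lemma card_D_last:
  assumes "inv I Bl s"
  shows "finite (D_last I s l) \<and> card (D_last I s l) \<le> omega (deliveries I)"
proof (cases "1 \<le> l \<and> l \<le> stage s")
  case True
  then have l: "1 \<le> l" "l \<le> num_stations I + 1" using invD(2)[OF assms] by auto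
  have "finite (D_last I s l) \<and> card (D_last I s l) \<le> card {b \<in> Bl l. b \<inter> I_last I l \<noteq> {}}"
    unfolding D_last_def
    using families_facts(1)[OF l] invD(3)[OF assms] by (intro card_drones_le[OF assms]) auto
  then show ?thesis using card_last_blocks[OF l] by linarith
next
  case False
  then have "D_last I s l = {}" using invD(3)[OF assms] by (fastforce simp: D_last_def)
  then show ?thesis by simp
qed

lemma card_busy:
  assumes "inv I Bl s" "finite X" "\<And>b i. (l, b, i) \<in> assigned s \<Longrightarrow> b \<in> X"
  shows "finite (busy s l) \<and> card (busy s l) \<le> card X"
  using card_drones_le[OF assms(1,2), of l "\<lambda>_. True"] assms(3) by (simp add: busy_def)

lemma card_family_le:
  assumes "1 \<le> l" "l \<le> num_stations I + 1"
  shows "card (Bl l) + 2 * omega (deliveries I) \<le> num_drones I Bl"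
  unfolding num_drones_def using assms by (intro add_right_mono Max_ge) auto

lemma card_busy_le:
  assumes "inv I Bl s"
  shows "finite (busy s l) \<and> card (busy s l) + 2 * omega (deliveries I) \<le> num_drones I Bl"
proof (cases "1 \<le> l \<and> l \<le> stage s")
  case True
  then have l: "1 \<le> l" "l \<le> num_stations I + 1" using invD(2)[OF assms] by auto
  have "finite (busy s l) \<and> card (busy s l) \<le> card (Bl l)"
    using card_busy[OF assms families_facts(1)[OF l]] invD(3)[OF assms] by blast
  then show ?thesis using card_family_le[OF l] by linarith
next
  case False
  then have "busy s l = {}" using invD(3)[OF assms] by (fastforce simp: busy_def)
  moreover have "2 * omega (deliveries I) \<le> num_drones I Bl" by (simp add: num_drones_def)
  ultimately show ?thesis by simp
qed

lemma free_drone: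
  assumes "finite X" "card X < n"
  obtains i where "i < n" "i \<notin> X"
proof -
  have "\<not> {..<n} \<subseteq> X" using card_mono[OF assms(1), of "{..<n}"] assms(2) by auto
  then show ?thesis using that by blast
qed

lemma progress:
  assumes inv: "inv I Bl s" and "\<not> final I Bl s"
  shows "\<exists>t. step I Bl s t"
proof -
  let ?l = "stage s"
  note D = invD[OF inv]
  have l: "1 \<le> ?l" "?l \<le> num_stations I + 1" using D(1,2) .
  let ?F = "{b \<in> Bl ?l. b \<inter> I_first I ?l \<noteq> {}}"
  have fin: "finite (Bl ?l)" by (rule families_facts[OF l])
  show ?thesis
  proof (cases "\<exists>b \<in> ?F. \<not> done_block s b")
    case True
    then obtain b where 1: "b \<in> ?F" "\<not> done_block s b" by blast
    \<comment> \<open>While a block meeting \<open>I_first\<close> is open, only such blocks have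
      been assigned, so fewer than \<open>omega\<close> drones are busy.\<close>
    have "card (busy s ?l) \<le> card (?F - {b})"
    proof (rule card_busy[OF inv, THEN conjunct2])
      fix b' i assume b': "(?l, b', i) \<in> assigned s"
      then have "done_block s b'" by (auto simp: done_block_def)
      moreover have "b' \<inter> I_first I ?l \<noteq> {}" using D(9)[OF b', of b] 1 by blast
      ultimately show "b' \<in> ?F - {b}" using D(3)[OF b'] 1 by auto
    qed (use fin in simp)
    also have "\<dots> < card ?F" using fin 1 by (intro card_Diff1_less) auto
    also have "\<dots> \<le> omega (deliveries I)" by (rule card_first_blocks[OF l])
    \<comment> \<open>Fewer than \<open>omega\<close> drones are busy now, the preceding group
      occupies at most the total minus twice \<open>omega\<close>, and \<open>D_last\<close> before
      it at most \<open>omega\<close>: the surplus is exactly consumed.\<close>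
    finally have lt: "card (busy s ?l \<union> busy s (?l - 1) \<union> D_last I s (?l - 2)) < num_drones I Bl"
      using card_busy_le[OF inv, of "?l - 1"] card_D_last[OF inv, of "?l - 2"]
        card_Un_le[of "busy s ?l" "busy s (?l - 1)"]
        card_Un_le[of "busy s ?l \<union> busy s (?l - 1)" "D_last I s (?l - 2)"] by linarith
    have fi: "finite (busy s ?l \<union> busy s (?l - 1) \<union> D_last I s (?l - 2))"
      using card_busy_le[OF inv] card_D_last[OF inv] by simp
    obtain i where i: "i < num_drones I Bl"
      "i \<notin> busy s ?l \<union> busy s (?l - 1) \<union> D_last I s (?l - 2)"
      by (rule free_drone[OF fi lt])
    then have "step I Bl s (assign s b i)" using 1 by (intro step.assign_first) auto
    then show ?thesis ..
  next
    case rest: False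
    show ?thesis
    proof (cases "\<exists>b \<in> Bl ?l. \<not> done_block s b")
      case True
      then obtain b where 2: "b \<in> Bl ?l" "\<not> done_block s b" by blast
      have "card (busy s ?l) \<le> card (Bl ?l - {b})"
      proof (rule card_busy[OF inv, THEN conjunct2])
        fix b' i assume b': "(?l, b', i) \<in> assigned s"
        then have "done_block s b'" by (auto simp: done_block_def)
        then show "b' \<in> Bl ?l - {b}" using D(3)[OF b'] 2 by auto
      qed (use fin in simp)
      also have "\<dots> < card (Bl ?l)" using fin 2 by (intro card_Diff1_less) auto
      \<comment> \<open>Here fewer than \<open>card (Bl ?l)\<close> drones are busy and at most
        \<open>omega\<close> are late, so one \<open>omega\<close> of the surplus would do.\<close>
      finally have lt: "card (busy s ?l \<union> D_last I s (?l - 1)) < num_drones I Bl"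
        using card_family_le[OF l] card_D_last[OF inv, of "?l - 1"]
          card_Un_le[of "busy s ?l" "D_last I s (?l - 1)"] by linarith
      have fi: "finite (busy s ?l \<union> D_last I s (?l - 1))"
        using card_busy_le[OF inv] card_D_last[OF inv] by simp
      obtain i where i: "i < num_drones I Bl" "i \<notin> busy s ?l \<union> D_last I s (?l - 1)"
        by (rule free_drone[OF fi lt])
      then have "step I Bl s (assign s b i)"
        using 2 rest D_first_busy[of I s ?l] by (intro step.assign_rest) auto
      then show ?thesis ..
    next
      case False
      then have "?l \<le> num_stations I" using assms(2) l by (auto simp: final_def)
      then show ?thesis using step.recharge[of Bl s I] False by blast
    qed
  qed
qed

section \<open>Termination of every execution\<close>

definition pending :: "state \<Rightarrow> nat" where
  "pending s = card {b \<in> Bl (stage s). \<not> done_block s b}"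

lemma pending_assign:
  assumes "inv I Bl s" "b \<in> Bl (stage s)" "\<not> done_block s b"
  shows "pending (assign s b i) < pending s"
proof -
  have "finite (Bl (stage s))" using families_facts invD[OF assms(1)] by blast
  then show ?thesis
    unfolding pending_def using assms(2,3)
    by (intro psubset_card_mono) (auto simp: assign_def done_block_def)
qed

text \<open>Lexicographic: an assignment keeps the stage and closes a block; a recharge opens the
  blocks of a new group, but is enabled only up to the last station and so lowers the first
  component.\<close>

lemma step_measure:
  assumes "step I Bl s t" "inv I Bl s"
  shows "(t, s) \<in> measures [\<lambda>s. num_stations I + 1 - stage s, pending]"
  using assms
proof cases
  case (assign_first b i)
  then show ?thesis using pending_assign[OF assms(2)] by (simp add: assign_def)
next
  case (assign_rest b i)
  then show ?thesis using pending_assign[OF assms(2)] by (simp add: assign_def)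
next
  case recharge
  then show ?thesis by (simp add: recharge_simps Suc_diff_le)
qed

lemma always_reaches_final:
  "inv I Bl s \<Longrightarrow> always_reaches (step I Bl) (\<lambda>t. final I Bl t \<and> inv I Bl t) s"
proof (induction s rule: wf_induct_rule[OF wf_measures[of "[\<lambda>s. num_stations I + 1 - stage s, pending]"]])
  case (1 s)
  show ?case
  proof (cases "final I Bl s")
    case True
    then show ?thesis using 1 by (intro always_reaches.intros(1)) simp
  next
    case False
    then obtain t where "step I Bl s t" using progress 1(2) by blast
    then show ?thesis
    proof (rule always_reaches.intros(2))
      fix u assume u: "step I Bl s u"
      show "always_reaches (step I Bl) (\<lambda>t. final I Bl t \<and> inv I Bl t) u"
        by (rule 1(1)[OF step_measure[OF u 1(2)] inv_step[OF u 1(2)]])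
    qed
  qed
qed

lemma always_reaches_mono:
  "always_reaches R P s \<Longrightarrow> (\<And>t. P t \<Longrightarrow> Q t) \<Longrightarrow> always_reaches R Q s"
  by (induction rule: always_reaches.induct) (auto intro: always_reaches.intros)

lemma final_solution:
  assumes inv: "inv I Bl s" and fin: "final I Bl s"
  shows "solution I (num_drones I Bl) (schedule I s)"
  unfolding solution_def
proof (intro conjI allI impI ballI)
  note D = invD[OF inv]
  have st: "stage s = num_stations I + 1" using fin by (simp add: final_def)
  fix i
  obtain xs where xs: "chron xs" "set xs = schedule I s i" "battery_suffices I (cap I) xs"
    using D(8)[of i] by blast
  have "admissible I x \<and> fst (period x) \<le> snd (period x)" if "x \<in> schedule I s i" for x
    using inv that
  proof (cases rule: scheduled_cases)
    case (deliver d k b)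
    then have "d \<in> deliveries I" using group_subset[OF valid] by blast
    then show ?thesis using deliver delivery_bounds[OF valid] by simp
  next
    case (recharge k)
    then show ?thesis using arr_dep[OF valid, of k] st by (simp split: station_kind.split)
  qed
  then show "feasible I (schedule I s i)"
    using chron_feasible[OF xs(1)] xs by auto
next
  note D = invD[OF inv]
  have st: "stage s = num_stations I + 1" using fin by (simp add: final_def)
  fix d assume "d \<in> deliveries I"
  then obtain l where l: "1 \<le> l" "l \<le> num_stations I + 1" "d \<in> group I l"
    using in_some_group[OF valid, of d] by auto
  then obtain b where b: "b \<in> Bl l" "d \<in> b" using families_facts(2)[OF l(1,2)] by auto
  have "\<exists>i. (l, b, i) \<in> assigned s"
  proof (cases "l = stage s")
    case True
    then show ?thesis using fin b by (auto simp: final_def done_block_def)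
  next
    case False
    then show ?thesis using D(4)[of l b] l b st by simp
  qed
  then obtain i where i: "(l, b, i) \<in> assigned s" ..
  show "\<exists>!i. i < num_drones I Bl \<and> Deliver d \<in> schedule I s i"
  proof (rule ex1I[of _ i])
    show "i < num_drones I Bl \<and> Deliver d \<in> schedule I s i"
      using i b D(3)[OF i] by (auto simp: schedule_def)
    fix j assume "j < num_drones I Bl \<and> Deliver d \<in> schedule I s j"
    then obtain k b' where j: "(k, b', j) \<in> assigned s" "d \<in> b'"
      by (auto simp: schedule_def)
    have k: "1 \<le> k" "k \<le> num_stations I + 1" "b' \<in> Bl k" using D(3)[OF j(1)] st by auto
    then have "d \<in> group I k" using block_facts(5) j(2) by blast
    then have "k = l" using groups_disjoint[OF valid, of k l d] k l by simp
    then have "b' = b" using families_facts(3)[OF l(1,2)] b k j by blast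
    then show "j = i" using D(5) i j \<open>k = l\<close> by blast
  qed
qed

lemma algorithm_correct:
  "always_reaches (step I Bl)
    (\<lambda>s. final I Bl s \<and> solution I (num_drones I Bl) (schedule I s)) (init I)"
  by (rule always_reaches_mono[OF always_reaches_final[OF inv_init]]) (auto intro: final_solution)

end


section \<open>Comparison with the optimum\<close>

definition of_group :: "delivery set \<Rightarrow> activity \<Rightarrow> bool" where
  "of_group G x \<longleftrightarrow> (\<exists>d \<in> G. x = Deliver d)"

fun load :: "delivery set \<Rightarrow> activity list \<Rightarrow> real" where
  "load G [] = 0"
| "load G (Deliver d # xs) = (if d \<in> G then cost d else 0) + load G xs"
| "load G (Recharge l t t' # xs) = load G xs"

lemma load_eq_0: "(\<And>x. x \<in> set xs \<Longrightarrow> \<not> of_group G x) \<Longrightarrow> load G xs = 0"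
  by (induction G xs rule: load.induct) (auto simp: of_group_def)

lemma load_nonneg: "(\<And>d. d \<in> G \<Longrightarrow> 0 \<le> cost d) \<Longrightarrow> 0 \<le> load G xs"
  by (induction G xs rule: load.induct) auto

text \<open>After filtering no recharge is left, and with nonnegative costs every partial sum is
  bounded by the total.\<close>

lemma battery_suffices_filter:
  "(\<And>d. d \<in> G \<Longrightarrow> 0 \<le> cost d) \<Longrightarrow> load G xs \<le> rem \<Longrightarrow>
    battery_suffices J rem (filter (of_group G) xs)"
proof (induction G xs arbitrary: rem rule: load.induct)
  case (2 G d xs)
  have "0 \<le> load G xs" by (rule load_nonneg) (rule 2)
  moreover have "of_group G (Deliver d) \<longleftrightarrow> d \<in> G" by (auto simp: of_group_def)
  ultimately show ?case using 2 by (auto simp: algebra_simps)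
qed (auto simp: of_group_def)

context
  fixes I :: instance_SC and l :: nat
  assumes valid: "valid_SC I" and l: "1 \<le> l" "l \<le> num_stations I + 1"
begin

text \<open>The relation between an activity and a later one that forces every recharge to come before or
  after all deliveries of group \<open>l\<close>.\<close>

definition unmixed :: "activity \<Rightarrow> activity \<Rightarrow> bool" where
  "unmixed x y \<longleftrightarrow>
    (of_group (group I l) x \<longrightarrow> (\<forall>k t t'. y = Recharge k t t' \<longrightarrow> l \<le> k)) \<and>
    ((\<exists>k t t'. x = Recharge k t t' \<and> l \<le> k) \<longrightarrow> \<not> of_group (group I l) y)"

lemma recharge_period:
  assumes "admissible I (Recharge k t t')"
  shows "1 \<le> k" "k \<le> num_stations I" "tA I k \<le> t" "t \<le> t'" "t' \<le> tD I k"
  using assms arr_dep[OF valid, of k] by (auto split: station_kind.splits)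

text \<open>Suppose a recharge at a station before l follows a delivery of group l. At station l - 1
  this would enclose the delivery in the waiting interval; an earlier station has closed before the
  group begins. Conversely, a recharge at station l or later starts after every delivery of the
  group has started.\<close>

lemma unmixed_ordered:
  assumes adm: "admissible I x" "admissible I y"
    and le: "fst (period x) \<le> fst (period y)" and sep: "span x \<inter> span y = {}"
  shows "unmixed x y"
  unfolding unmixed_def
proof (intro conjI impI allI)
  fix k t t' assume x: "of_group (group I l) x" and y: "y = Recharge k t t'"
  obtain d where d: "d \<in> group I l" "x = Deliver d" using x by (auto simp: of_group_def)
  note k = recharge_period[OF adm(2)[unfolded y]]
  show "l \<le> k"
  proof (rule ccontr)
    assume "\<not> l \<le> k"
    then have kl: "k \<le> l - 1" "2 \<le> l" using k(1) by auto
    then have start: "tA I (l - 1) \<le> tL d" using d by (simp add: group_def)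
    have "t \<notin> span x" using sep k(4) y by (auto simp: span_def)
    then have "tR d < t" using le d y by (auto simp: span_def)
    show False
    proof (cases "k = l - 1")
      case True
      have "d \<in> deliveries I" using d group_subset[OF valid] by blast
      then show False
        using not_within_waiting[OF valid, of d k] k start \<open>tR d < t\<close> True by auto
    next
      case False
      then have "tD I k < tA I (l - 1)" using kl k(1) l by (intro dep_arr[OF valid]) auto
      then show False using k start le d y by simp
    qed
  qed
next
  assume "\<exists>k t t'. x = Recharge k t t' \<and> l \<le> k"
  then obtain k t t' where x: "x = Recharge k t t'" "l \<le> k" by blast
  note k = recharge_period[OF adm(1)[unfolded x(1)]]
  show "\<not> of_group (group I l) y"
  proof
    assume "of_group (group I l) y"
    then obtain e where e: "e \<in> group I l" "y = Deliver e" by (auto simp: of_group_def)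
    have "tL e < tA I l" using e x k by (simp add: group_def)
    also have "\<dots> \<le> tA I k" using arr_mono[OF valid, of l k] l x k by simp
    finally show False using le x e k by simp
  qed
qed

lemma recharged_bounds:
  assumes "admissible I (Recharge k t t')" "0 \<le> rem" "rem \<le> cap I"
  shows "0 \<le> recharged I k t t' rem \<and> recharged I k t t' rem \<le> cap I"
proof -
  have "\<forall>l \<in> {1..num_stations I}. \<forall>Ch. kind (station_at I l) = Charging Ch \<longrightarrow>
      valid_charge (cap I) (tA I l) (tD I l) Ch"
    using valid unfolding valid_SC_def by (elim conjE)
  then show ?thesis using recharge_period[OF assms(1)] assms(2,3) cap_pos[OF valid]
    by (auto simp: recharged_def valid_charge_def split: station_kind.split)
qed

text \<open>If only stations from l on occur, the first recharge ends the deliveries of the group.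
  Up to there the battery only falls, and deliveries of other groups make the bound
  stricter.\<close>

lemma load_le_remaining:
  assumes "sorted_wrt unmixed xs" "battery_suffices I rem xs" "0 \<le> rem"
    "\<And>k t t'. Recharge k t t' \<in> set xs \<Longrightarrow> l \<le> k" "\<And>d. Deliver d \<in> set xs \<Longrightarrow> 0 \<le> cost d"
  shows "load (group I l) xs \<le> rem"
  using assms
proof (induction xs arbitrary: rem)
  case (Cons x xs)
  show ?case
  proof (cases x)
    case (Deliver d)
    then have "load (group I l) xs \<le> rem - cost d" using Cons by auto
    moreover have "0 \<le> cost d" using Cons.prems(5) Deliver by simp
    ultimately show ?thesis using Deliver by simp
  next
    case (Recharge k t t')
    have "\<not> of_group (group I l) y" if "y \<in> set xs" for y
    proof -
      have "unmixed (Recharge k t t') y" "l \<le> k" using Cons.prems(1,4) Recharge that by auto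
      then show ?thesis by (auto simp: unmixed_def)
    qed
    then show ?thesis using load_eq_0[of xs] Cons.prems(3) Recharge by simp
  qed
qed simp

text \<open>Until the first delivery of the group, it is only tracked that the battery stays between
  0 and the capacity. From that delivery on, all recharges belong to stations from l on and
  \<open>load_le_remaining\<close> applies.\<close>

lemma load_le_cap:
  assumes "sorted_wrt unmixed xs" "battery_suffices I rem xs" "0 \<le> rem" "rem \<le> cap I"
    "\<And>x. x \<in> set xs \<Longrightarrow> admissible I x"
  shows "load (group I l) xs \<le> cap I"
  using assms
proof (induction xs arbitrary: rem)
  case Nil
  then show ?case by simp
next
  case (Cons x xs)
  have nn: "0 \<le> cost d" if "Deliver d \<in> set (x # xs)" for d
    using Cons.prems(5)[OF that] delivery_bounds[OF valid] by force
  show ?case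
  proof (cases x)
    case x: (Deliver d)
    show ?thesis
    proof (cases "d \<in> group I l")
      case True
      have "l \<le> k" if "Recharge k t t' \<in> set (x # xs)" for k t t'
      proof -
        have "unmixed x (Recharge k t t')" using that x Cons.prems(1) by auto
        then show ?thesis using True x by (auto simp: unmixed_def of_group_def)
      qed
      then have "load (group I l) (x # xs) \<le> rem"
        using load_le_remaining[OF Cons.prems(1-3)] nn by blast
      then show ?thesis using Cons.prems(4) by simp
    next
      case False
      have "0 \<le> cost d" using nn x by simp
      then show ?thesis using Cons.prems x False by (auto intro!: Cons.IH[of "rem - cost d"])
    qed
  next
    case x: (Recharge k t t')
    have "0 \<le> recharged I k t t' rem \<and> recharged I k t t' rem \<le> cap I"
      using Cons.prems(3,4) Cons.prems(5)[of x] x by (intro recharged_bounds) simp_all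
    then show ?thesis using Cons.prems x by (auto intro!: Cons.IH[of "recharged I k t t' rem"])
  qed
qed

lemma feasible_restrict:
  assumes "feasible I X"
  shows "feasible (instance_NS (cap I) (group I l)) {x \<in> X. of_group (group I l) x}"
proof -
  let ?G = "group I l"
  obtain xs where xs: "distinct xs" "set xs = X" "sorted (map (fst \<circ> period) xs)"
      "battery_suffices I (cap I) xs"
    using assms unfolding feasible_def by blast
  have adm: "admissible I x" if "x \<in> X" for x using assms that unfolding feasible_def by blast
  have sep: "pairwise (\<lambda>x y. span x \<inter> span y = {}) X" using assms unfolding feasible_def by blast
  have "sorted_wrt unmixed xs"
    unfolding sorted_wrt_iff_nth_less
  proof (intro allI impI)
    fix i j assume ij: "i < j" "j < length xs"
    have ne: "xs ! i \<noteq> xs ! j" using ij nth_eq_iff_index_eq[OF xs(1)] by auto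
    have m: "xs ! i \<in> X" "xs ! j \<in> X" using ij xs(2) nth_mem by auto
    have "fst (period (xs ! i)) \<le> fst (period (xs ! j))"
      using sorted_nth_mono[OF xs(3), of i j] ij by simp
    then show "unmixed (xs ! i) (xs ! j)"
      using sep ne m adm by (intro unmixed_ordered) (auto simp: pairwise_def)
  qed
  then have "load ?G xs \<le> cap I"
    using load_le_cap[of xs "cap I"] xs adm cap_pos[OF valid] by simp
  moreover have "0 \<le> cost d" if "d \<in> ?G" for d
    using that group_subset[OF valid] delivery_bounds[OF valid] by force
  ultimately have "battery_suffices (instance_NS (cap I) ?G) (cap I) (filter (of_group ?G) xs)"
    by (intro battery_suffices_filter)
  moreover have "sorted (map (fst \<circ> period) (filter (of_group ?G) xs))"
    using xs(3) by (simp add: sorted_filter)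
  moreover have "pairwise (\<lambda>x y. span x \<inter> span y = {}) {x \<in> X. of_group ?G x}"
    using sep by (rule pairwise_subset) auto
  moreover have "admissible (instance_NS (cap I) ?G) x" if "of_group ?G x" for x
    using that by (auto simp: of_group_def instance_NS_def)
  ultimately show ?thesis
    unfolding feasible_def using xs(1,2)
    by (auto simp: instance_NS_def intro!: exI[of _ "filter (of_group ?G) xs"])
qed

lemma OPT_NS_group_le:
  assumes "solution I k S"
  shows "OPT_NS (cap I) (group I l) \<le> k"
  unfolding OPT_NS_def OPT_SC_def
proof (rule Least_le, rule exI)
  let ?G = "group I l"
  let ?S = "\<lambda>i. {x \<in> S i. of_group ?G x}"
  show "solution (instance_NS (cap I) ?G) k ?S"
    unfolding solution_def
  proof (intro conjI allI impI ballI)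
    fix i assume "i < k"
    then show "feasible (instance_NS (cap I) ?G) (?S i)"
      using assms feasible_restrict unfolding solution_def by blast
  next
    fix d assume "d \<in> deliveries (instance_NS (cap I) ?G)"
    then have d: "d \<in> ?G" by (simp add: instance_NS_def)
    then have "of_group ?G (Deliver d)" by (auto simp: of_group_def)
    moreover have "\<exists>!i. i < k \<and> Deliver d \<in> S i"
      using assms d group_subset[OF valid] unfolding solution_def by blast
    ultimately show "\<exists>!i. i < k \<and> Deliver d \<in> ?S i" by simp
  qed
qed

end

text \<open>Ensures that the \<open>LEAST\<close> in \<open>OPT_SC\<close> is attained. One drone
  per delivery works because no single cost exceeds the capacity.\<close>

lemma solution_exists:
  assumes "valid_SC I"
  shows "\<exists>k S. solution I k S"
proof -
  obtain f where f: "bij_betw f {0..<card (deliveries I)} (deliveries I)"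
    using ex_bij_betw_nat_finite[OF finite_deliveries[OF assms]] by blast
  have "solution I (card (deliveries I)) (\<lambda>i. {Deliver (f i)})"
    unfolding solution_def
  proof (intro conjI allI impI ballI)
    fix i assume "i < card (deliveries I)"
    then have "f i \<in> deliveries I" using f by (auto simp: bij_betw_def)
    then show "feasible I {Deliver (f i)}"
      using delivery_bounds[OF assms]
      unfolding feasible_def by (auto intro!: exI[of _ "[Deliver (f i)]"])
  next
    fix d assume "d \<in> deliveries I"
    then have "d \<in> f ` {0..<card (deliveries I)}" using f by (simp add: bij_betw_def)
    then obtain i where i: "i < card (deliveries I)" "f i = d" by auto
    then show "\<exists>!i. i < card (deliveries I) \<and> Deliver d \<in> {Deliver (f i)}"
      using f by (intro ex1I[of _ i]) (auto simp: bij_betw_def inj_on_def)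
  qed
  then show ?thesis by blast
qed

lemma OPT_NS_group_le_OPT_SC:
  assumes "valid_SC I" "1 \<le> l" "l \<le> num_stations I + 1"
  shows "OPT_NS (cap I) (group I l) \<le> OPT_SC I"
proof -
  have "\<exists>S. solution I (OPT_SC I) S"
    unfolding OPT_SC_def by (rule LeastI_ex) (rule solution_exists[OF assms(1)])
  then show ?thesis using OPT_NS_group_le[OF assms] by blast
qed

lemma SC_blocks_families:
  assumes "\<And>B D BB. valid_NS B D \<Longrightarrow> A B D BB \<Longrightarrow> algo_NS B D BB"
    and "valid_SC I" "SC_blocks A I Bl"
  shows "block_families I Bl"
  using assms valid_NS_group[OF assms(2)] algo_NS_block_partition
  unfolding block_families_def SC_blocks_def by blast

lemma num_drones_bound:
  fixes \<beta> :: real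
  assumes A: "\<And>B D BB. valid_NS B D \<Longrightarrow> A B D BB \<Longrightarrow> algo_NS B D BB"
    and \<beta>: "\<And>B D BB. valid_NS B D \<Longrightarrow> A B D BB \<Longrightarrow> real (card BB) \<le> \<beta> * real (OPT_NS B D)"
    and valid: "valid_SC I" and Bl: "SC_blocks A I Bl"
  shows "real (num_drones I Bl) \<le> \<beta> * real (OPT_SC I) + 2 * real (omega (deliveries I))"
proof -
  let ?L = "{1..num_stations I + 1}"
  have fam: "block_families I Bl" using SC_blocks_families[OF A valid Bl] by blast
  have card: "real (card (Bl l)) \<le> \<beta> * real (OPT_NS (cap I) (group I l))" if "l \<in> ?L" for l
    using that Bl \<beta> valid_NS_group[OF valid] unfolding SC_blocks_def by blast
  have "Max ((\<lambda>l. card (Bl l)) ` ?L) \<in> (\<lambda>l. card (Bl l)) ` ?L" by (intro Max_in) auto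
  then obtain m where m: "m \<in> ?L" "Max ((\<lambda>l. card (Bl l)) ` ?L) = card (Bl m)" by (elim imageE)
  have "real (card (Bl m)) \<le> \<beta> * real (OPT_SC I)"
  proof (cases "0 \<le> \<beta>")
    case True
    have "\<beta> * real (OPT_NS (cap I) (group I m)) \<le> \<beta> * real (OPT_SC I)"
      using OPT_NS_group_le_OPT_SC[OF valid, of m] m True by (intro mult_left_mono) auto
    then show ?thesis using card[OF m(1)] by simp
  next
    case False
    \<comment> \<open>A negative factor is not excluded. It forces all block families to be empty,
      hence there are no deliveries, the optimum is 0, and both sides of the bound on blocks
      vanish.\<close>
    have empty: "Bl l = {}" if "l \<in> ?L" for l
    proof -
      have "\<beta> * real (OPT_NS (cap I) (group I l)) \<le> 0" using False by (simp add: mult_nonpos_nonneg)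
      then have "card (Bl l) = 0" using card[OF that] by simp
      then show ?thesis using families_facts(1)[OF valid fam, of l] that by simp
    qed
    have "deliveries I = {}"
    proof (rule ccontr)
      assume "deliveries I \<noteq> {}"
      then obtain d where "d \<in> deliveries I" by blast
      then obtain l where l: "l \<in> ?L" "d \<in> group I l" using in_some_group[OF valid, of d] by blast
      then show False using families_facts(2)[OF valid fam, of l] empty[OF l(1)] by auto
    qed
    then have "solution I 0 (\<lambda>_. {})" by (simp add: solution_def)
    then have "OPT_SC I \<le> 0" unfolding OPT_SC_def by (intro Least_le) blast
    then show ?thesis using empty[OF m(1)] by simp
  qed
  then show ?thesis unfolding num_drones_def m(2) by simp
qed


section \<open>The implementation of AlgoFor-DDP-NS\<close>

lemma tm_simps [simp]:
  "val (ret x) = x" "time (ret x) = 0"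
  "val (tick m) = val m" "time (tick m) = Suc (time m)"
  "val (tm_bind m f) = val (f (val m))" "time (tm_bind m f) = time m + time (f (val m))"
  by (simp_all add: ret_def tick_def tm_bind_def Let_def split: prod.split)

lemma val_len [simp]: "val (len xs) = length xs"
  by (induction xs) auto

lemma val_app [simp]: "val (app xs ys) = xs @ ys"
  by (induction xs) auto

lemma val_countdown [simp]: "val (countdown k) = rev [0..<k]"
  by (induction k) auto

section \<open>Merge sort\<close>

lemma mset_merge: "mset (val (merge le xs ys)) = mset xs + mset ys"
  by (induction le xs ys rule: merge.induct) auto

lemma set_merge: "set (val (merge le xs ys)) = set xs \<union> set ys"
  using arg_cong[OF mset_merge[of le xs ys], of set_mset] by simp

lemma sorted_merge:
  assumes "transp le" "\<And>x y. le x y \<or> le y x" "sorted_wrt le xs" "sorted_wrt le ys"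
  shows "sorted_wrt le (val (merge le xs ys))"
  using assms
proof (induction le xs ys rule: merge.induct)
  case (3 le x xs y ys)
  have "le x z" if "le x y" "le y z" for z using 3(3) that by (rule transpD)
  moreover have "le y z" if "\<not> le x y" "le x z" for z
    using transpD[OF 3(3) _ that(2)] 3(4)[of x y] that(1) by blast
  ultimately show ?case using 3 by (auto simp: set_merge)
qed auto

lemma mset_sort_prefix:
  "k \<le> length xs \<Longrightarrow>
    mset (fst (val (sort_prefix le k xs))) = mset (take k xs) \<and> snd (val (sort_prefix le k xs)) = drop k xs"
proof (induction k arbitrary: xs rule: less_induct)
  case (less k)
  consider "k = 0" | "k = 1" | "2 \<le> k" by linarith
  then show ?case
  proof cases
    case 2
    then obtain y ys where "xs = y # ys" using less.prems by (cases xs) auto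
    then show ?thesis using 2 by (simp add: sort_prefix.simps)
  next
    case 3
    have "xs \<noteq> []" using 3 less.prems by auto
    let ?h = "k div 2" and ?as = "sort_prefix le (k div 2) xs"
    let ?bs = "sort_prefix le (k - ?h) (drop ?h xs)"
    have 1: "mset (fst (val ?as)) = mset (take ?h xs) \<and> snd (val ?as) = drop ?h xs"
      using 3 less.prems by (intro less.IH) auto
    have 2: "mset (fst (val ?bs)) = mset (take (k - ?h) (drop ?h xs)) \<and>
        snd (val ?bs) = drop (k - ?h) (drop ?h xs)"
      using 3 less.prems by (intro less.IH) auto
    have "take k xs = take ?h xs @ take (k - ?h) (drop ?h xs)"
      using take_add[of ?h "k - ?h" xs] by simp
    then show ?thesis
      using 1 2 3 \<open>xs \<noteq> []\<close>
      by (subst (1 2) sort_prefix.simps) (simp add: case_prod_beta mset_merge)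
  qed (simp add: sort_prefix.simps)
qed

lemma sorted_sort_prefix:
  assumes "transp le" "\<And>x y. le x y \<or> le y x"
  shows "sorted_wrt le (fst (val (sort_prefix le k xs)))"
proof (induction k arbitrary: xs rule: less_induct)
  case (less k)
  then show ?case
    by (subst sort_prefix.simps) (auto simp: case_prod_beta intro!: sorted_merge[OF assms] less)
qed

lemma mset_msort [simp]: "mset (val (msort le xs)) = mset xs"
  using mset_sort_prefix[of "length xs" xs le] by (simp add: msort_def case_prod_beta)

lemma set_msort [simp]: "set (val (msort le xs)) = set xs"
  by (rule mset_eq_setD) simp

lemma length_msort [simp]: "length (val (msort le xs)) = length xs"
  by (rule mset_eq_length) simp

lemma distinct_msort [simp]: "distinct (val (msort le xs)) = distinct xs"
  by (metis mset_eq_imp_distinct_iff mset_msort)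

lemma sorted_msort:
  assumes "transp le" "\<And>x y. le x y \<or> le y x"
  shows "sorted_wrt le (val (msort le xs))"
  using sorted_sort_prefix[OF assms] by (simp add: msort_def case_prod_beta)

lemma sorted_by_start: "sorted_wrt by_start (val (msort by_start xs))"
  by (rule sorted_msort) (auto simp: by_start_def intro!: transpI)

lemma sorted_by_colour_cost: "sorted_wrt by_colour_cost (val (msort by_colour_cost xs))"
  by (rule sorted_msort) (auto simp: by_colour_cost_def intro!: transpI)

section \<open>The sweep colouring\<close>

lemma val_expire:
  "val (expire t act fr) =
    (filter (\<lambda>(e, c). t \<le> tR e) act, map snd (filter (\<lambda>(e, c). tR e < t) act) @ fr)"
  by (induction t act fr rule: expire.induct) (auto simp: case_prod_beta)

text \<open>The colours in progress and the free ones are together exactly those below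
  \<open>k\<close>, without repetition. An empty free list therefore means that the deliveries in
  progress hold all \<open>k\<close> colours, which is what makes the sweep optimal.\<close>

definition sweep_ok :: "delivery list \<Rightarrow> (delivery \<times> nat) list \<Rightarrow> nat list \<Rightarrow> nat \<Rightarrow> bool" where
  "sweep_ok ds act fr k \<longleftrightarrow>
    distinct (map fst act @ ds) \<and> distinct (map snd act @ fr) \<and> set (map snd act @ fr) = {..<k} \<and>
    sorted_wrt by_start ds \<and> (\<forall>d \<in> set ds \<union> fst ` set act. tL d \<le> tR d) \<and>
    (\<forall>e \<in> fst ` set act. \<forall>d \<in> set ds. tL e \<le> tL d)"

lemma mset_filter_part:
  "mset (map f (filter (\<lambda>x. \<not> P x) xs)) + mset (map f (filter P xs)) = mset (map f xs)"
  by (induction xs) auto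

lemma expire_colours:
  assumes "val (expire t act fr) = (act', fr')"
  shows "mset (map snd act' @ fr') = mset (map snd act @ fr)"
proof -
  have act': "act' = filter (\<lambda>x. \<not> (case x of (e, c) \<Rightarrow> tR e < t)) act"
    and fr': "fr' = map snd (filter (\<lambda>(e, c). tR e < t) act) @ fr"
    using assms by (auto simp: val_expire not_less case_prod_unfold)
  show ?thesis
    unfolding act' fr' using mset_filter_part[of snd "\<lambda>(e, c). tR e < t" act] by simp
qed

text \<open>Expiry only moves colours from the active list to the free one. The two conclusions are
  the branches of the sweep: opening colour \<open>k\<close>, or reusing a free colour.\<close>

lemma sweep_ok_expire:
  assumes ok: "sweep_ok (d # ds) act fr k" and ex: "val (expire (tL d) act fr) = (act', fr')"
  shows "fr' = [] \<Longrightarrow> sweep_ok ds ((d, k) # act') [] (Suc k)"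
    and "fr' = c # fr'' \<Longrightarrow> sweep_ok ds ((d, c) # act') fr'' k"
proof -
  have act': "act' = filter (\<lambda>(e, c). tL d \<le> tR e) act" using ex by (simp add: val_expire)
  have cols: "distinct (map snd act' @ fr')" "set (map snd act' @ fr') = {..<k}"
    using expire_colours[OF ex] ok unfolding sweep_ok_def
    by (metis mset_eq_imp_distinct_iff, metis mset_eq_setD)
  have 1: "distinct (map fst act' @ d # ds)"
    using ok unfolding sweep_ok_def act' by (auto simp: distinct_map_filter)
  have 2: "sorted_wrt by_start ds" "\<forall>e \<in> set ds. tL d \<le> tL e"
    using ok unfolding sweep_ok_def by (auto simp: by_start_def)
  have 3: "\<forall>e \<in> set ds \<union> fst ` set ((d, x) # act'). tL e \<le> tR e" for x
    using ok unfolding sweep_ok_def act' by auto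
  have 4: "\<forall>e \<in> fst ` set act'. \<forall>d' \<in> set ds. tL e \<le> tL d'"
    using ok unfolding sweep_ok_def act' by auto
  show "sweep_ok ds ((d, k) # act') [] (Suc k)" if "fr' = []"
    unfolding sweep_ok_def using 1 2 3 4 cols that by (auto simp: lessThan_Suc)
  show "sweep_ok ds ((d, c) # act') fr'' k" if "fr' = c # fr''"
    unfolding sweep_ok_def using 1 2 3 4 cols that by auto
qed

text \<open>The current delivery and all survivors contain its start \<open>tL d\<close>; an expired
  one ends before it, hence before every later delivery begins. The clique bounds the number of
  colours, the conflicts pay for the survivors, and the last claim lets an expired colour be
  reused.\<close>

lemma expire_conflicting:
  assumes ok: "sweep_ok (d # ds) act fr k" and ex: "val (expire (tL d) act fr) = (act', fr')"
  shows "pairwise conflicting (insert d (fst ` set act'))"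
    and "\<And>e. e \<in> fst ` set act' \<Longrightarrow> conflicting d e"
    and "\<And>e c d'. (e, c) \<in> set act - set act' \<Longrightarrow> d' \<in> set (d # ds) \<Longrightarrow> \<not> conflicting e d'"
proof -
  have act': "act' = filter (\<lambda>(e, c). tL d \<le> tR e) act" using ex by (simp add: val_expire)
  have sweep: "tL d \<in> interval e" if "e \<in> insert d (fst ` set act')" for e
    using ok that unfolding sweep_ok_def act' interval_def by auto
  then show "pairwise conflicting (insert d (fst ` set act'))"
    unfolding conflicting_def by (intro pairwiseI) blast
  show "conflicting d e" if "e \<in> fst ` set act'" for e
    using sweep that unfolding conflicting_def by blast
  show "\<not> conflicting e d'" if "(e, c) \<in> set act - set act'" "d' \<in> set (d # ds)" for e c d'
  proof -
    have "tR e < tL d" using that(1) by (auto simp: act')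
    moreover have "tL d \<le> tL d'" using ok that(2) unfolding sweep_ok_def by (auto simp: by_start_def)
    ultimately show ?thesis by (auto simp: conflicting_def interval_def)
  qed
qed

abbreviation differ :: "delivery \<times> nat \<Rightarrow> delivery \<times> nat \<Rightarrow> bool" where
  "differ x y \<equiv> conflicting (fst x) (fst y) \<longrightarrow> snd x \<noteq> snd y"

text \<open>The clause on \<open>act\<close> is what the induction needs for the head: its colour
  must differ from that of every later delivery in conflict with it, also after it has
  expired.\<close>

lemma sweep_colouring:
  assumes "sweep_ok ds act fr k" "val (sweep ds act fr k) = (cs, m)"
  shows "map fst cs = ds \<and> k \<le> m \<and> (\<forall>x \<in> set cs. snd x < m) \<and>
    (\<forall>x \<in> set act. \<forall>y \<in> set cs. differ x y) \<and> sorted_wrt differ cs"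
  using assms
proof (induction ds arbitrary: act fr k cs m)
  case Nil
  then show ?case by auto
next
  case (Cons d ds)
  obtain act' fr' where ex: "val (expire (tL d) act fr) = (act', fr')" by fastforce
  \<comment> \<open>Both branches at once: \<open>c\<close> is the colour given to \<open>d\<close>,
    and \<open>fr''\<close>, \<open>k'\<close> are the free list and colour count passed on.\<close>
  obtain c fr'' k' where step: "fr' = [] \<and> c = k \<and> fr'' = [] \<and> k' = Suc k \<or> fr' = c # fr'' \<and> k' = k"
    by (cases fr') auto
  have ok: "sweep_ok ds ((d, c) # act') fr'' k'"
    using sweep_ok_expire[OF Cons.prems(1) ex] step by auto
  obtain cs' where cs': "val (sweep ds ((d, c) # act') fr'' k') = (cs', m)" "cs = (d, c) # cs'"
    using Cons.prems(2) step ex by (auto simp: case_prod_beta prod_eq_iff)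
  have IH: "map fst cs' = ds \<and> k' \<le> m \<and> (\<forall>x \<in> set cs'. snd x < m) \<and>
    (\<forall>x \<in> set ((d, c) # act'). \<forall>y \<in> set cs'. differ x y) \<and> sorted_wrt differ cs'"
    by (rule Cons.IH[OF ok cs'(1)])
  have "c < k'" "k \<le> k'" using ok step unfolding sweep_ok_def by auto
  moreover have "differ x y" if x: "x \<in> set act" and y: "y \<in> set cs" for x y
  proof (cases "x \<in> set act'")
    case True
    then have "snd x \<noteq> c" using ok unfolding sweep_ok_def by auto
    then show ?thesis using IH True y cs' by auto
  next
    case False
    have "fst y \<in> set (d # ds)" using IH y cs' by auto
    then show ?thesis
      using expire_conflicting(3)[OF Cons.prems(1) ex, of "fst x" "snd x" "fst y"] x False by auto
  qed
  ultimately show ?case using IH cs' by auto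
qed

text \<open>A new colour is opened only when the survivors hold all \<open>k\<close> colours; with
  the current delivery they form a clique of size \<open>k + 1\<close>.\<close>

lemma sweep_count:
  assumes "sweep_ok ds act fr k" "k \<le> w"
    and "\<And>S. S \<subseteq> fst ` set act \<union> set ds \<Longrightarrow> pairwise conflicting S \<Longrightarrow> card S \<le> w"
  shows "snd (val (sweep ds act fr k)) \<le> w"
  using assms
proof (induction ds arbitrary: act fr k)
  case (Cons d ds)
  obtain act' fr' where ex: "val (expire (tL d) act fr) = (act', fr')" by fastforce
  have act': "act' = filter (\<lambda>(e, c). tL d \<le> tR e) act" using ex by (simp add: val_expire)
  have sub: "fst ` set ((d, c) # act') \<union> set ds \<subseteq> fst ` set act \<union> set (d # ds)" for c
    by (auto simp: act')
  show ?case
  proof (cases fr')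
    case fr: Nil
    have ok: "sweep_ok ds ((d, k) # act') [] (Suc k)"
      using sweep_ok_expire(1)[OF Cons.prems(1) ex] fr by simp
    have "distinct (map snd ((d, k) # act'))" "set (map snd ((d, k) # act')) = {..<Suc k}"
      "distinct (map fst ((d, k) # act'))"
      using ok unfolding sweep_ok_def by auto
    then have "Suc k = card (set (map fst ((d, k) # act')))"
      by (metis card_lessThan distinct_card length_map)
    also have "\<dots> \<le> w"
      using expire_conflicting(1)[OF Cons.prems(1) ex] by (intro Cons.prems(3)) (auto simp: act')
    finally have Suc: "Suc k \<le> w" .
    have "snd (val (sweep ds ((d, k) # act') [] (Suc k))) \<le> w"
    proof (rule Cons.IH[OF ok Suc])
      fix S assume "S \<subseteq> fst ` set ((d, k) # act') \<union> set ds" "pairwise conflicting S"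
      then show "card S \<le> w" using sub[of k] by (intro Cons.prems(3)) (rule order_trans)
    qed
    then show ?thesis using ex fr by (simp add: case_prod_beta)
  next
    case fr: (Cons c fr'')
    have ok: "sweep_ok ds ((d, c) # act') fr'' k"
      using sweep_ok_expire(2)[OF Cons.prems(1) ex] fr by simp
    have "snd (val (sweep ds ((d, c) # act') fr'' k)) \<le> w"
    proof (rule Cons.IH[OF ok Cons.prems(2)])
      fix S assume "S \<subseteq> fst ` set ((d, c) # act') \<union> set ds" "pairwise conflicting S"
      then show "card S \<le> w" using sub[of c] by (intro Cons.prems(3)) (rule order_trans)
    qed
    then show ?thesis using ex fr by (simp add: case_prod_beta)
  qed
qed simp

text \<open>\<open>sweep_count\<close> gives at most \<open>omega\<close> colours; conversely a
  proper colouring is injective on a clique.\<close>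

lemma colour_correct:
  assumes "distinct ds" "\<And>d. d \<in> set ds \<Longrightarrow> tL d \<le> tR d" "val (colour ds) = (cs, m)"
  shows "mset (map fst cs) = mset ds" "m = omega (set ds)"
    "proper_colouring (set ds) m (\<lambda>d. the (map_of cs d))"
proof -
  let ?xs = "val (msort by_start ds)" and ?c = "\<lambda>d. the (map_of cs d)"
  have ok: "sweep_ok ?xs [] [] 0"
    using assms(1,2) sorted_by_start unfolding sweep_ok_def by simp
  have sw: "val (sweep ?xs [] [] 0) = (cs, m)" using assms(3) by (simp add: colour_def)
  note S = sweep_colouring[OF ok sw]
  have fst_cs: "map fst cs = ?xs" using S by simp
  then show mset: "mset (map fst cs) = mset ds" by simp
  have dist: "distinct (map fst cs)" using fst_cs assms(1) by simp
  have set: "fst ` set cs = set ds" using fst_cs by (metis list.set_map set_msort)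
  have col: "(d, ?c d) \<in> set cs" if "d \<in> set ds" for d
  proof -
    have "d \<in> fst ` set cs" using that set by simp
    then obtain c where "(d, c) \<in> set cs" by force
    then show ?thesis using dist by simp
  qed
  have pw: "differ x y" if x: "x \<in> set cs" and y: "y \<in> set cs" and ne: "x \<noteq> y" for x y
  proof -
    have srt: "sorted_wrt differ cs" using S by simp
    have comm: "conflicting (fst x) (fst y) = conflicting (fst y) (fst x)"
      by (simp add: conflicting_def Int_commute)
    obtain i where i: "i < length cs" "cs ! i = x" using x by (auto simp: in_set_conv_nth)
    obtain j where j: "j < length cs" "cs ! j = y" using y by (auto simp: in_set_conv_nth)
    consider "i < j" | "j < i" using i j ne by fastforce
    then show ?thesis
    proof cases
      case 1
      show ?thesis using sorted_wrt_nth_less[OF srt 1 j(1)] i j by simp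
    next
      case 2
      show ?thesis using sorted_wrt_nth_less[OF srt 2 i(1)] i j comm by auto
    qed
  qed
  have proper: "?c d \<noteq> ?c e" if "d \<in> set ds" "e \<in> set ds" "d \<noteq> e" "conflicting d e" for d e
    using pw[OF col[OF that(1)] col[OF that(2)]] that(3,4) by simp
  have less: "?c d < m" if "d \<in> set ds" for d using col[OF that] S by fastforce
  show "proper_colouring (set ds) m ?c"
    unfolding proper_colouring_def using proper less by blast
  have "m \<le> omega (set ds)"
    using sweep_count[OF ok, of "omega (set ds)"] sw omega_upper[of "set ds"] by simp
  moreover have "omega (set ds) \<le> m"
  proof (rule omega_least)
    fix S assume S: "S \<subseteq> set ds" "pairwise conflicting S"
    have "inj_on ?c S"
      using S proper unfolding inj_on_def pairwise_def by blast
    moreover have "?c ` S \<subseteq> {..<m}" using S less by blast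
    ultimately show "card S \<le> m" using card_inj_on_le[of ?c S "{..<m}"] by simp
  qed simp
  ultimately show "m = omega (set ds)" by simp
qed

section \<open>Filling the drones class by class\<close>

lemma pack_Nil: "pack B Ss [] Ss' \<longleftrightarrow> Ss' = Ss"
  by (auto elim: pack.cases intro: pack.intros)

text \<open>\<open>P0\<close> are the closed drones of the current class \<open>c\<close>, and
  \<open>b\<close> is the open one. Within a class costs increase, so what no longer fits into the
  open drone shows that nothing later in the class will fit either; the last hypothesis records this
  for \<open>P0\<close> and justifies opening a new drone. All colours are treated in one statement
  because \<open>fill\<close> runs through the classes in a single pass: class \<open>c\<close>
  continues from its present drones, the later ones start from nothing.\<close>

lemma fill_packs:
  assumes "sorted_wrt by_colour_cost xs" "\<And>x. x \<in> set xs \<Longrightarrow> c \<le> snd x"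
    and "distinct (b @ map fst xs)" "rem = B - sum cost (set b)"
    and "\<And>S x. S \<in> set P0 \<Longrightarrow> x \<in> set xs \<Longrightarrow> snd x = c \<Longrightarrow> \<not> fits B S (fst x)"
  shows "\<exists>P. (\<forall>k. pack B (if k = c then P0 @ [set b] else [])
        (map fst (filter (\<lambda>x. snd x = k) xs)) (P k)) \<and>
      (\<Union>k. set (P k)) = set P0 \<union> set ` set (val (fill B c rem b xs))"
  using assms
proof (induction B c rem b xs arbitrary: P0 rule: fill.induct)
  case (1 B c rem b)
  show ?case
    by (rule exI[of _ "\<lambda>k. if k = c then P0 @ [set b] else []"]) (auto simp: pack_Nil)
next
  case (2 B c rem b d c' xs)
  have le: "by_colour_cost (d, c') x" if "x \<in> set xs" for x using 2(3) that by simp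
  have srt: "sorted_wrt by_colour_cost xs" using 2(3) by simp
  have cc': "c \<le> c'" using 2(4)[of "(d, c')"] by simp
  have dst: "d \<notin> set b" "distinct (b @ map fst xs)" "distinct ([d] @ map fst xs)"
    using 2(5) by auto
  show ?case
  proof (cases "c' = c \<and> cost d \<le> rem")
    case True
    have "\<exists>P. (\<forall>k. pack B (if k = c then P0 @ [set (d # b)] else [])
        (map fst (filter (\<lambda>x. snd x = k) xs)) (P k)) \<and>
      (\<Union>k. set (P k)) = set P0 \<union> set ` set (val (fill B c (rem - cost d) (d # b) xs))"
      using 2(4,5,6,7) dst srt by (intro 2(1)[OF True]) auto
    then obtain P where P: "\<And>k. pack B (if k = c then P0 @ [set (d # b)] else [])
        (map fst (filter (\<lambda>x. snd x = k) xs)) (P k)"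
      "(\<Union>k. set (P k)) = set P0 \<union> set ` set (val (fill B c (rem - cost d) (d # b) xs))"
      by blast
    have "place B (P0 @ [set b]) d ((P0 @ [set b])[length P0 := insert d ((P0 @ [set b]) ! length P0)])"
      using True 2(6) by (intro place.used_drone) (auto simp: fits_def)
    then have "place B (P0 @ [set b]) d (P0 @ [set (d # b)])" by simp
    then have "pack B (if k = c then P0 @ [set b] else [])
        (map fst (filter (\<lambda>x. snd x = k) ((d, c') # xs))) (P k)" for k
      using P(1)[of k] True by (auto intro: pack.intros)
    then show ?thesis using P(2) True by (intro exI[of _ P]) simp
  next
    case False
    \<comment> \<open>Closed drones relevant to the next delivery: within the class the open drone
      joins them, after a change of colour there are none.\<close>
    let ?P1 = "if c' = c then P0 @ [set b] else []"
    have nofit: "\<not> fits B S (fst x)" if "S \<in> set ?P1" "x \<in> set ((d, c') # xs)" "snd x = c'" for S x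
    proof -
      have "c' = c" using that(1) by (auto split: if_splits)
      have "cost d \<le> cost (fst x)" using that(2,3) le[of x]
        by (cases "x = (d, c')") (auto simp: by_colour_cost_def)
      then show ?thesis
        using that False 2(6) 2(7)[of S x] \<open>c' = c\<close> by (auto simp: fits_def)
    qed
    have "\<exists>P. (\<forall>k. pack B (if k = c' then ?P1 @ [set [d]] else [])
        (map fst (filter (\<lambda>x. snd x = k) xs)) (P k)) \<and>
      (\<Union>k. set (P k)) = set ?P1 \<union> set ` set (val (fill B c' (B - cost d) [d] xs))"
    proof (rule 2(2)[OF False])
      show "c' \<le> snd x" if "x \<in> set xs" for x using le[OF that] by (auto simp: by_colour_cost_def)
    qed (use dst srt nofit in auto)
    then obtain P where P: "\<And>k. pack B (if k = c' then ?P1 @ [set [d]] else [])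
        (map fst (filter (\<lambda>x. snd x = k) xs)) (P k)"
      "(\<Union>k. set (P k)) = set ?P1 \<union> set ` set (val (fill B c' (B - cost d) [d] xs))"
      by blast
    have "place B ?P1 d (?P1 @ [{d}])"
      using nofit[of _ "(d, c')"] by (intro place.new_drone) auto
    then have pack: "pack B (if k = c' then ?P1 else [])
        (map fst (filter (\<lambda>x. snd x = k) ((d, c') # xs))) (P k)" for k
      using P(1)[of k] by (cases "k = c'") (auto intro: pack.intros)
    show ?thesis
    proof (cases "c' = c")
      case True
      have "pack B (if k = c then P0 @ [set b] else [])
        (map fst (filter (\<lambda>x. snd x = k) ((d, c') # xs))) (P k)" for k
        using pack[of k] True by (cases "k = c") simp_all
      moreover have "(\<Union>k. set (P k)) = set P0 \<union> set ` set (val (fill B c rem b ((d, c') # xs)))"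
        using P(2) True False by auto
      ultimately show ?thesis by blast
    next
      case ne: False
      then have none: "filter (\<lambda>x. snd x = c) ((d, c') # xs) = []"
        using le cc' by (fastforce simp: filter_empty_conv by_colour_cost_def)
      \<comment> \<open>Colours increase, so class \<open>c\<close> receives nothing more. The
        induction hypothesis leaves it empty, and its finished drones can be put there.\<close>
      have "P c = []" using pack[of c] none ne by (simp add: pack_Nil)
      then have "(\<Union>k. set ((P(c := P0 @ [set b])) k)) = set P0 \<union> {set b} \<union> (\<Union>k. set (P k))"
        by (auto split: if_splits) (metis empty_iff empty_set)
      moreover have "pack B (if k = c then P0 @ [set b] else [])
        (map fst (filter (\<lambda>x. snd x = k) ((d, c') # xs))) ((P(c := P0 @ [set b])) k)" for k
        using pack[of k] none ne by (auto simp: pack_Nil)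
      ultimately show ?thesis
        using P(2) False ne by (intro exI[of _ "P(c := P0 @ [set b])"]) auto
    qed
  qed
qed

lemma impl_NS_algo_NS:
  assumes "valid_NS B D" "impl_NS B D BB"
  shows "algo_NS B D BB"
proof -
  obtain ds where ds: "distinct ds" "set ds = D" "BB = set ` set (val (prog_NS B ds))"
    using assms(2) unfolding impl_NS_def by blast
  obtain cs m where cm: "val (colour ds) = (cs, m)" by fastforce
  note C = colour_correct[OF ds(1) _ cm]
  have tl: "tL d \<le> tR d" if "d \<in> set ds" for d using that assms(1) ds by (auto simp: valid_NS_iff)
  let ?c = "\<lambda>d. the (map_of cs d)"
  let ?xs = "val (msort by_colour_cost cs)"
  have dcs: "distinct (map fst cs)" using C(1) tl ds(1) mset_eq_imp_distinct_iff by blast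
  have mfx: "mset (map fst ?xs) = mset (map fst cs)" by (metis mset_map mset_msort)
  have dxs: "distinct (map fst ?xs)" using dcs mfx mset_eq_imp_distinct_iff by blast
  have setcs: "fst ` set cs = D" using C(1) tl ds(2) by (metis list.set_map mset_eq_setD)
  have BB: "BB = set ` set (val (case ?xs of [] \<Rightarrow> ret [] | (d, c) # ys \<Rightarrow> fill B c (B - cost d) [d] ys))"
    using ds(3) cm by (simp add: prog_NS_def)
  have "\<exists>P. (\<forall>k. pack B [] (map fst (filter (\<lambda>x. snd x = k) ?xs)) (P k)) \<and> (\<Union>k. set (P k)) = BB"
  proof (cases ?xs)
    case Nil
    then show ?thesis using BB by (intro exI[of _ "\<lambda>_. []"]) (simp add: pack_Nil)
  next
    case (Cons x ys)
    obtain d c where x: "x = (d, c)" by fastforce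
    have srt: "sorted_wrt by_colour_cost ((d, c) # ys)"
      using sorted_by_colour_cost[of cs] Cons x by simp
    have BB': "BB = set ` set (val (fill B c (B - cost d) [d] ys))" using BB Cons x by simp
    have "\<exists>P. (\<forall>k. pack B (if k = c then [] @ [set [d]] else [])
        (map fst (filter (\<lambda>x. snd x = k) ys)) (P k)) \<and>
      (\<Union>k. set (P k)) = set [] \<union> set ` set (val (fill B c (B - cost d) [d] ys))"
    proof (rule fill_packs)
      show "c \<le> snd y" if "y \<in> set ys" for y
        using srt that by (auto simp: by_colour_cost_def)
    qed (use srt dxs Cons x in auto)
    then obtain P where P': "\<forall>k. pack B (if k = c then [] @ [set [d]] else [])
        (map fst (filter (\<lambda>x. snd x = k) ys)) (P k)"
      "(\<Union>k. set (P k)) = set [] \<union> set ` set (val (fill B c (B - cost d) [d] ys))"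
      by blast
    have P: "pack B (if k = c then [{d}] else [])
        (map fst (filter (\<lambda>x. snd x = k) ys)) (P k)" "(\<Union>k. set (P k)) = BB" for k
      using P'(1)[rule_format, of k] P'(2) BB' by (cases "k = c"; simp)+
    have "place B [] d ([] @ [{d}])" by (rule place.new_drone) simp
    then have "pack B [] (map fst (filter (\<lambda>x. snd x = k) ?xs)) (P k)" for k
      using P(1)[of k] Cons x by (auto intro: pack.intros)
    then show ?thesis using P(2) by blast
  qed
  then obtain P where P: "\<And>k. pack B [] (map fst (filter (\<lambda>x. snd x = k) ?xs)) (P k)"
    "(\<Union>k. set (P k)) = BB" by blast
  have sel: "set (map fst (filter (\<lambda>x. snd x = k) ?xs)) = {d \<in> D. ?c d = k}" for k
  proof -
    have "the (map_of cs (fst x)) = snd x" if "x \<in> set cs" for x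
      using map_of_is_SomeI[OF dcs, of "fst x" "snd x"] that by simp
    then show ?thesis using setcs by force
  qed
  have pc: "proper_colouring D (omega D) ?c" using C(2,3) tl ds(2) by simp
  \<comment> \<open>The filling describes every natural number as a colour, whereas
    \<open>algo_NS\<close> only collects the colours below \<open>omega D\<close>.\<close>
  have empty: "P k = []" if "\<not> k < omega D" for k
  proof -
    have "{d \<in> D. ?c d = k} = {}" using pc that by (auto simp: proper_colouring_def)
    then have "map fst (filter (\<lambda>x. snd x = k) ?xs) = []" by (simp only: sel[of k, symmetric] set_empty)
    then show ?thesis using P(1)[of k] by (simp add: pack_Nil)
  qed
  have "BB = (\<Union>k < omega D. set (P k))"
    unfolding P(2)[symmetric] using empty by fastforce
  moreover have "\<exists>ds. distinct ds \<and> set ds = {d \<in> D. ?c d = k} \<and> pack B [] ds (P k)" for k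
    using P(1)[of k] sel[of k] dxs by (intro exI[of _ "map fst (filter (\<lambda>x. snd x = k) ?xs)"])
      (simp add: distinct_map_filter)
  ultimately show ?thesis unfolding algo_NS_def using pc by blast
qed

lemma fill_blocks:
  "b \<noteq> [] \<Longrightarrow> mset (concat (val (fill B c rem b xs))) = mset b + mset (map fst xs) \<and>
    [] \<notin> set (val (fill B c rem b xs))"
  by (induction B c rem b xs rule: fill.induct) auto

text \<open>Stated with multisets because list lengths, and the fact that different blocks of the
  list are different sets, depend on no delivery being repeated.\<close>

lemma prog_NS_blocks:
  assumes "distinct ds" "\<And>d. d \<in> set ds \<Longrightarrow> tL d \<le> tR d"
  shows "mset (concat (val (prog_NS B ds))) = mset ds \<and> [] \<notin> set (val (prog_NS B ds))"
proof -
  obtain cs m where cm: "val (colour ds) = (cs, m)" by fastforce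
  let ?xs = "val (msort by_colour_cost cs)"
  have "mset (map fst ?xs) = mset (map fst cs)" by (metis mset_map mset_msort)
  then have "mset (map fst ?xs) = mset ds" using colour_correct(1)[OF assms cm] by simp
  then show ?thesis
    using cm fill_blocks[of "[_]"]
    by (cases ?xs) (auto simp: prog_NS_def)
qed


section \<open>The implementation of AlgoFor-DDP-SC\<close>

lemma val_split_before:
  "sorted_wrt by_start ds \<Longrightarrow> concat [fst (val (split_before t ds)), snd (val (split_before t ds))] = ds \<and>
    set (fst (val (split_before t ds))) = {d \<in> set ds. tL d < t} \<and>
    set (snd (val (split_before t ds))) = {d \<in> set ds. t \<le> tL d}"
  by (induction t ds rule: split_before.induct) (auto simp: case_prod_beta by_start_def)

text \<open>Positions count from 0: entry \<open>l\<close> is group \<open>l + 1\<close>, bounded by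
  stations \<open>l\<close> and \<open>l + 1\<close>, which are \<open>ss ! (l - 1)\<close> and
  \<open>ss ! l\<close>.\<close>

lemma groups_correct:
  assumes "sorted_wrt by_start ds" "sorted (map arr ss)"
  shows "length (val (groups ss ds)) = Suc (length ss) \<and> concat (val (groups ss ds)) = ds \<and>
    (\<forall>l \<le> length ss. set (val (groups ss ds) ! l) =
      {d \<in> set ds. (0 < l \<longrightarrow> arr (ss ! (l - 1)) \<le> tL d) \<and> (l < length ss \<longrightarrow> tL d < arr (ss ! l))})"
  using assms
proof (induction ss ds rule: groups.induct)
  case (1 ds)
  then show ?case by simp
next
  case (2 s ss ds)
  obtain xs ys where xy: "val (split_before (arr s) ds) = (xs, ys)" by fastforce
  note S = val_split_before[OF 2(2), of "arr s", unfolded xy, simplified]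
  have "sorted_wrt by_start (xs @ ys)" using S 2(2) by simp
  then have ys: "sorted_wrt by_start ys" by (simp add: sorted_wrt_append)
  have IH: "length (val (groups ss ys)) = Suc (length ss)" "concat (val (groups ss ys)) = ys"
    "\<And>l. l \<le> length ss \<Longrightarrow> set (val (groups ss ys) ! l) =
      {d \<in> set ys. (0 < l \<longrightarrow> arr (ss ! (l - 1)) \<le> tL d) \<and> (l < length ss \<longrightarrow> tL d < arr (ss ! l))}"
    using 2(1)[OF ys] 2(3) by auto
  have g: "val (groups (s # ss) ds) = xs # val (groups ss ys)" using xy by (simp add: case_prod_beta)
  have "set (val (groups (s # ss) ds) ! l) = {d \<in> set ds. (0 < l \<longrightarrow> arr ((s # ss) ! (l - 1)) \<le> tL d) \<and>
      (l < length (s # ss) \<longrightarrow> tL d < arr ((s # ss) ! l))}" if l: "l \<le> length (s # ss)" for l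
  proof (cases l)
    case 0
    then show ?thesis using S g by auto
  next
    case (Suc k)
    have k: "k \<le> length ss" using l Suc by simp
    have nth: "val (groups (s # ss) ds) ! l = val (groups ss ys) ! k" using g Suc by simp
    have set_ys: "set ys = {d \<in> set ds. arr s \<le> tL d}" using S by simp
    show ?thesis
    proof (cases k)
      case 0
      then show ?thesis unfolding nth IH(3)[OF k] set_ys using \<open>l = Suc k\<close> by auto
    next
      case (Suc j)
      \<comment> \<open>The deliveries passed on satisfy \<open>arr s \<le> tL d\<close>; this is
        absorbed by the bound from the later station.\<close>
      then have "arr s \<le> arr (ss ! j)" using 2(3) k by simp
      then show ?thesis unfolding nth IH(3)[OF k] set_ys using Suc \<open>l = Suc k\<close> by auto
    qed
  qed
  then show ?case using g S IH(1,2) by simp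
qed

lemma val_blocks:
  "fst (val (blocks B gs)) = map (\<lambda>g. val (prog_NS B g)) gs \<and>
    snd (val (blocks B gs)) = Max (insert 0 (length ` set (fst (val (blocks B gs)))))"
proof (induction gs)
  case (Cons g gs)
  let ?X = "length ` set (fst (val (blocks B gs)))"
  have Max: "Max (insert 0 (insert n ?X)) = max n (Max (insert 0 ?X))" for n
    unfolding insert_commute[of 0 n ?X] by (rule Max_insert) simp_all
  have eqs: "fst (val (blocks B (g # gs))) = val (prog_NS B g) # fst (val (blocks B gs))"
    "snd (val (blocks B (g # gs))) = max (length (val (prog_NS B g))) (snd (val (blocks B gs)))"
    by (simp_all add: case_prod_beta)
  show ?case
    unfolding eqs list.set image_insert Max using Cons.IH by (metis list.map(2))
qed simp

lemma val_any_contains: "val (any_contains t ds) \<longleftrightarrow> (\<exists>d \<in> set ds. t \<in> interval d)"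
  by (induction t ds rule: any_contains.induct) (auto simp: interval_def)

lemma val_split_first:
  "val (split_first p bs) =
    (filter (\<lambda>b. \<exists>t d. p = Some t \<and> d \<in> set b \<and> t \<in> interval d) bs,
     filter (\<lambda>b. \<not> (\<exists>t d. p = Some t \<and> d \<in> set b \<and> t \<in> interval d)) bs)"
  by (induction p bs rule: split_first.induct)
    (auto simp: case_prod_beta val_any_contains split: option.split)

lemma val_hand_out:
  "length bs \<le> length is \<Longrightarrow> val (hand_out bs is) = (zip is bs, drop (length bs) is)"
  by (induction bs "is" rule: hand_out.induct) (auto simp: case_prod_beta)

lemma set_log_block: "set (val (log_block i ds acc)) = set acc \<union> {(i, Deliver d) | d. d \<in> set ds}"
  by (induction i ds acc rule: log_block.induct) auto

lemma set_log_blocks: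
  "set (val (log_blocks as acc)) = set acc \<union> {(i, Deliver d) | i b d. (i, b) \<in> set as \<and> d \<in> set b}"
proof (induction as acc rule: log_blocks.induct)
  case (2 i b as acc)
  show ?case by (simp add: 2 set_log_block) blast
qed simp

lemma set_log_recharges:
  "set (val (log_recharges l s is acc)) = set acc \<union> {(i, Recharge l (arr s) (dep s)) | i. i \<in> set is}"
  by (induction l s "is" acc rule: log_recharges.induct) auto

lemma val_split_last:
  "val (split_last t as) =
    (map fst (filter (\<lambda>(i, b). \<not> (\<exists>d \<in> set b. t \<in> interval d)) as),
     map fst (filter (\<lambda>(i, b). \<exists>d \<in> set b. t \<in> interval d) as))"
  by (induction t as rule: split_last.induct) (auto simp: case_prod_beta val_any_contains)

section \<open>Batches of assignment steps\<close>

definition assign_all :: "(nat \<times> delivery list) list \<Rightarrow> state \<Rightarrow> state" where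
  "assign_all as = fold (\<lambda>(i, b) s. assign s (set b) i) as"

lemma assign_all_simps [simp]:
  "assign_all [] s = s"
  "assign_all ((i, b) # as) s = assign_all as (assign s (set b) i)"
  "assign_all (as @ bs) s = assign_all bs (assign_all as s)"
  by (simp_all add: assign_all_def)

lemma assign_simps [simp]:
  "stage (assign s b i) = stage s" "charged (assign s b i) = charged s"
  "assigned (assign s b i) = insert (stage s, b, i) (assigned s)"
  by (simp_all add: assign_def)

lemma assign_all_fields:
  "stage (assign_all as s) = stage s \<and> charged (assign_all as s) = charged s \<and>
    assigned (assign_all as s) = assigned s \<union> {(stage s, set b, i) | i b. (i, b) \<in> set as}"
  by (induction as arbitrary: s) auto

lemma done_block_assign: "done_block (assign s b i) b' \<longleftrightarrow> b' = b \<or> done_block s b'"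
  by (auto simp: done_block_def)

text \<open>All conditions are checked in the initial state only. Since drones and blocks of the
  batch are distinct and the stage stays fixed, no assignment of the batch spoils a later
  one.\<close>

lemma assign_all_first:
  assumes "1 \<le> stage s" "distinct (map fst as)" "distinct (map (set \<circ> snd) as)"
    and "\<And>i b. (i, b) \<in> set as \<Longrightarrow> set b \<in> Bl (stage s) \<and> set b \<inter> I_first I (stage s) \<noteq> {} \<and>
      \<not> done_block s (set b) \<and> i < num_drones I Bl \<and> i \<notin> busy s (stage s) \<and>
      i \<notin> busy s (stage s - 1) \<and> i \<notin> D_last I s (stage s - 2)"
  shows "(step I Bl)\<^sup>*\<^sup>* s (assign_all as s)"
  using assms
proof (induction as arbitrary: s)
  case (Cons a as)
  obtain i b where a: "a = (i, b)" by fastforce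
  have ib: "set b \<in> Bl (stage s) \<and> set b \<inter> I_first I (stage s) \<noteq> {} \<and>
      \<not> done_block s (set b) \<and> i < num_drones I Bl \<and> i \<notin> busy s (stage s) \<and>
      i \<notin> busy s (stage s - 1) \<and> i \<notin> D_last I s (stage s - 2)"
    using Cons.prems(4)[of i b] a by simp
  then have "step I Bl s (assign s (set b) i)" by (intro step.assign_first) auto
  moreover have "(step I Bl)\<^sup>*\<^sup>* (assign s (set b) i) (assign_all as (assign s (set b) i))"
  proof (rule Cons.IH)
    fix j c assume jc: "(j, c) \<in> set as"
    have "j \<noteq> i" "set c \<noteq> set b" using Cons.prems(2,3) jc a by force+
    then show "set c \<in> Bl (stage (assign s (set b) i)) \<and>
      set c \<inter> I_first I (stage (assign s (set b) i)) \<noteq> {} \<and>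
      \<not> done_block (assign s (set b) i) (set c) \<and> j < num_drones I Bl \<and>
      j \<notin> busy (assign s (set b) i) (stage (assign s (set b) i)) \<and>
      j \<notin> busy (assign s (set b) i) (stage (assign s (set b) i) - 1) \<and>
      j \<notin> D_last I (assign s (set b) i) (stage (assign s (set b) i) - 2)"
      using Cons.prems(4)[of j c] Cons.prems(1) jc
      by (simp add: busy_assign D_last_assign done_block_assign)
  qed (use Cons.prems a in auto)
  ultimately show ?case using a by simp
qed simp

lemma assign_all_rest:
  assumes "1 \<le> stage s" "distinct (map fst as)" "distinct (map (set \<circ> snd) as)"
    and "\<And>b. b \<in> Bl (stage s) \<Longrightarrow> b \<inter> I_first I (stage s) \<noteq> {} \<Longrightarrow> done_block s b"
    and "\<And>i b. (i, b) \<in> set as \<Longrightarrow> set b \<in> Bl (stage s) \<and> set b \<inter> I_first I (stage s) = {} \<and>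
      \<not> done_block s (set b) \<and> i < num_drones I Bl \<and> i \<notin> busy s (stage s) \<and>
      i \<notin> D_last I s (stage s - 1)"
  shows "(step I Bl)\<^sup>*\<^sup>* s (assign_all as s)"
  using assms
proof (induction as arbitrary: s)
  case (Cons a as)
  obtain i b where a: "a = (i, b)" by fastforce
  have ib: "set b \<in> Bl (stage s) \<and> set b \<inter> I_first I (stage s) = {} \<and>
      \<not> done_block s (set b) \<and> i < num_drones I Bl \<and> i \<notin> busy s (stage s) \<and>
      i \<notin> D_last I s (stage s - 1)"
    using Cons.prems(5)[of i b] a by simp
  then have "step I Bl s (assign s (set b) i)"
    using Cons.prems(4) D_first_busy[of I s "stage s"] by (intro step.assign_rest) auto
  moreover have "(step I Bl)\<^sup>*\<^sup>* (assign s (set b) i) (assign_all as (assign s (set b) i))"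
  proof (rule Cons.IH)
    fix j c assume jc: "(j, c) \<in> set as"
    have "j \<noteq> i" "set c \<noteq> set b" using Cons.prems(2,3) jc a by force+
    then show "set c \<in> Bl (stage (assign s (set b) i)) \<and>
      set c \<inter> I_first I (stage (assign s (set b) i)) = {} \<and>
      \<not> done_block (assign s (set b) i) (set c) \<and> j < num_drones I Bl \<and>
      j \<notin> busy (assign s (set b) i) (stage (assign s (set b) i)) \<and>
      j \<notin> D_last I (assign s (set b) i) (stage (assign s (set b) i) - 1)"
      using Cons.prems(5)[of j c] Cons.prems(1) jc
      by (simp add: busy_assign D_last_assign done_block_assign)
  next
    fix c assume "c \<in> Bl (stage (assign s (set b) i))" "c \<inter> I_first I (stage (assign s (set b) i)) \<noteq> {}"
    then show "done_block (assign s (set b) i) c"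
      using Cons.prems(4)[of c] by (simp add: done_block_assign)
  qed (use Cons.prems a in auto)
  ultimately show ?case using a by simp
qed simp

section \<open>Simulation of one stage by one round of \<open>allot\<close>\<close>

context
  fixes I :: instance_SC and Bl :: "nat \<Rightarrow> delivery set set"
  assumes valid: "valid_SC I" and families: "block_families I Bl"
begin

text \<open>Distinctness as sets makes the length of the list equal to the number of blocks.\<close>

definition lists_family :: "nat \<Rightarrow> delivery list list \<Rightarrow> bool" where
  "lists_family l bs \<longleftrightarrow> set ` set bs = Bl l \<and> distinct (map set bs)"

text \<open>The invariant turns the test on battery levels into a condition on assignments, which is
  why the program stores no batteries.\<close>

lemma rechargers_eq:
  assumes "inv I Bl s"
  shows "rechargers I s = (busy s (stage s) \<union> D_last I s (stage s - 1)) - D_last I s (stage s)"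
proof -
  have "busy s (stage s) \<union> D_last I s (stage s - 1) \<subseteq> used s"
    by (auto simp: busy_def D_last_def used_def)
  then show ?thesis using invD(7)[OF assms] by (auto simp: rechargers_def)
qed

definition pools :: "state \<Rightarrow> nat list \<Rightarrow> nat list \<Rightarrow> nat list \<Rightarrow> nat list \<Rightarrow> bool" where
  "pools s F N L1 L2 \<longleftrightarrow>
    distinct (F @ N @ L1 @ L2) \<and> set (F @ N @ L1 @ L2) = {..<num_drones I Bl} \<and>
    set N = busy s (stage s - 1) - D_last I s (stage s - 1) \<and>
    set L1 = D_last I s (stage s - 1) \<and> set L2 = D_last I s (stage s - 2)"

text \<open>\<open>hand_out\<close> silently drops blocks when drones run out, so the lists must be
  long enough. \<open>F\<close> lacks the drones of the preceding group and \<open>L2\<close>, which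
  leaves at least \<open>omega\<close>, enough for \<open>fs\<close>. Later only \<open>L1\<close>
  and the drones just used are barred; \<open>L1\<close> costs at most one
  \<open>omega\<close>.\<close>

lemma pools_sizes:
  assumes inv: "inv I Bl s" and pools: "pools s F N L1 L2"
    and bs: "lists_family (stage s) bs"
    and fs: "fs = filter (\<lambda>b. set b \<inter> I_first I (stage s) \<noteq> {}) bs"
    and rs: "rs = filter (\<lambda>b. \<not> set b \<inter> I_first I (stage s) \<noteq> {}) bs"
  shows "length fs \<le> length F" "length rs \<le> length (N @ L2 @ drop (length fs) F)"
proof -
  let ?w = "omega (deliveries I)" and ?M = "num_drones I Bl"
  note D = invD[OF inv]
  have dl: "distinct (F @ N @ L1 @ L2)" and "set (F @ N @ L1 @ L2) = {..<?M}"
    using pools unfolding pools_def by blast+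
  then have "length (F @ N @ L1 @ L2) = ?M" by (metis card_lessThan distinct_card)
  then have M: "length F + length N + length L1 + length L2 = ?M" by simp
  have L1: "length L1 \<le> ?w"
    using card_D_last[OF valid families inv, of "stage s - 1"] pools distinct_card[of L1]
    unfolding pools_def by auto
  have L2: "length L2 \<le> ?w"
    using card_D_last[OF valid families inv, of "stage s - 2"] pools distinct_card[of L2]
    unfolding pools_def by auto
  have "set (N @ L1) = busy s (stage s - 1)"
    using pools D_last_busy[of I s "stage s - 1"] unfolding pools_def by auto
  moreover have "distinct (N @ L1)" using dl by auto
  ultimately have "length N + length L1 = card (busy s (stage s - 1))"
    by (metis distinct_card length_append)
  then have NL: "length N + length L1 + 2 * ?w \<le> ?M"
    using card_busy_le[OF valid families inv, of "stage s - 1"] by linarith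
  have "length bs = card (Bl (stage s))"
    using bs distinct_card[of "map set bs"] unfolding lists_family_def by simp
  then have bsM: "length bs + 2 * ?w \<le> ?M" using card_family_le[OF valid families D(1,2)] by simp
  have len: "length fs + length rs = length bs" unfolding fs rs by (rule sum_length_filter_compl)
  have "length fs = card (set ` set fs)"
    using bs distinct_card[of "map set fs"] unfolding lists_family_def fs
    by (simp add: distinct_map_filter)
  also have "set ` set fs \<subseteq> {b \<in> Bl (stage s). b \<inter> I_first I (stage s) \<noteq> {}}"
    using bs unfolding lists_family_def fs by auto
  then have "card (set ` set fs) \<le> card {b \<in> Bl (stage s). b \<inter> I_first I (stage s) \<noteq> {}}"
    using families_facts(1)[OF valid families D(1,2)] by (intro card_mono) auto
  also have "\<dots> \<le> ?w" by (rule card_first_blocks[OF valid families D(1,2)])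
  finally have fw: "length fs \<le> ?w" .
  show "length fs \<le> length F" using M NL L2 fw by linarith
  then show "length rs \<le> length (N @ L2 @ drop (length fs) F)" using M L1 len bsM by simp
qed

text \<open>\<open>F\<close> consists of the drones allowed by \<open>assign_first\<close>, and
  \<open>G\<close> of those then allowed by \<open>assign_rest\<close>. The multiset equation says
  that drones are merely moved between the lists, from which the partition for the next stage
  follows.\<close>

lemma stage_simulation:
  assumes inv: "inv I Bl s" and pools: "pools s F N L1 L2" and fresh: "busy s (stage s) = {}"
    and bs: "lists_family (stage s) bs"
    and fs: "fs = filter (\<lambda>b. set b \<inter> I_first I (stage s) \<noteq> {}) bs"
    and rs: "rs = filter (\<lambda>b. \<not> set b \<inter> I_first I (stage s) \<noteq> {}) bs"
    and G: "G = N @ L2 @ drop (length fs) F"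
    and as: "as = zip F fs @ zip G rs"
  shows "(step I Bl)\<^sup>*\<^sup>* s (assign_all as s)"
    "\<And>b. b \<in> Bl (stage s) \<Longrightarrow> done_block (assign_all as s) b"
    "mset (map fst as @ drop (length rs) G @ L1) = mset (F @ N @ L1 @ L2)"
    "busy (assign_all as s) (stage s) = fst ` set as"
    "D_last I (assign_all as s) (stage s) = {i. \<exists>b. (i, b) \<in> set as \<and> set b \<inter> I_last I (stage s) \<noteq> {}}"
    "D_last I (assign_all as s) (stage s - 1) = set L1"
    "set as \<subseteq> UNIV \<times> set bs"
proof -
  let ?l = "stage s" and ?s1 = "assign_all (zip F fs) s"
  note D = invD[OF inv]
  note len = pools_sizes[OF inv pools bs fs rs, folded G]
  have dl: "distinct (F @ N @ L1 @ L2)" using pools unfolding pools_def by blast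
  have dbs: "distinct (map set bs)" and Bl: "set ` set bs = Bl ?l"
    using bs unfolding lists_family_def by auto
  have dfs: "distinct (map set fs)" "distinct (map set rs)"
    using dbs unfolding fs rs by (simp_all add: distinct_map_filter)
  have mf: "map fst (zip F fs) = take (length fs) F" "map fst (zip G rs) = take (length rs) G"
    "map snd (zip F fs) = fs" "map snd (zip G rs) = rs"
    using len by (simp_all add: map_fst_zip_take map_snd_zip_take)
  have "mset (map fst as @ drop (length rs) G @ L1) =
      mset (take (length fs) F) + (mset (take (length rs) G) + mset (drop (length rs) G)) + mset L1"
    unfolding as by (simp add: mf)
  also have "mset (take (length rs) G) + mset (drop (length rs) G) = mset G"
    by (metis append_take_drop_id mset_append)
  also have "mset (take (length fs) F) + mset G = mset F + mset N + mset L2"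
    unfolding G using mset_append[of "take (length fs) F" "drop (length fs) F"]
    by (simp add: ac_simps)
  finally show ms: "mset (map fst as @ drop (length rs) G @ L1) = mset (F @ N @ L1 @ L2)"
    by (simp add: ac_simps)
  have das: "distinct (map fst as @ drop (length rs) G @ L1)"
    using ms dl mset_eq_imp_distinct_iff by blast
  have lt: "i < num_drones I Bl" if "(i, b) \<in> set as" for i b
  proof -
    have "i \<in> set (map fst as)" using that by force
    then have "i \<in> set (F @ N @ L1 @ L2)" using mset_eq_setD[OF ms] by auto
    then show ?thesis using pools unfolding pools_def by auto
  qed
  have not_done: "\<not> done_block s b" for b using fresh by (auto simp: busy_def done_block_def)
  have 1: "(step I Bl)\<^sup>*\<^sup>* s ?s1"
  proof (rule assign_all_first[OF D(1)])
    show "distinct (map fst (zip F fs))" using das unfolding as by simp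
    show "distinct (map (set \<circ> snd) (zip F fs))" using dfs mf by (simp flip: map_map)
    fix i b assume ib: "(i, b) \<in> set (zip F fs)"
    have "b \<in> set fs" "i \<in> set F" using ib by (auto dest: set_zip_leftD set_zip_rightD)
    moreover from this have "i \<notin> set (N @ L1 @ L2)" using dl by auto
    moreover have "set (N @ L1) = busy s (?l - 1)"
      using pools D_last_busy[of I s "?l - 1"] unfolding pools_def by auto
    ultimately show "set b \<in> Bl ?l \<and> set b \<inter> I_first I ?l \<noteq> {} \<and>
      \<not> done_block s (set b) \<and> i < num_drones I Bl \<and> i \<notin> busy s ?l \<and>
      i \<notin> busy s (?l - 1) \<and> i \<notin> D_last I s (?l - 2)"
      using lt[of i b] ib Bl not_done fresh pools unfolding as fs pools_def by auto
  qed
  have a1: "stage ?s1 = ?l" "assigned ?s1 = assigned s \<union> {(?l, set b, i) | i b. (i, b) \<in> set (zip F fs)}"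
    using assign_all_fields[of "zip F fs" s] by auto
  have done1: "done_block ?s1 (set b) \<longleftrightarrow> set b \<in> set ` set fs" for b
  proof -
    have "set ` set fs = {set b | i b. (i, b) \<in> set (zip F fs)}"
      by (subst mf(3)[symmetric]) force
    then show ?thesis using not_done[of "set b"] by (auto simp: done_block_def a1)
  qed
  have ne1: "?l - 1 \<noteq> ?l" using D(1) by simp
  have last1: "D_last I ?s1 (?l - 1) = D_last I s (?l - 1)"
    using ne1 by (auto simp: D_last_def a1)
  have busy1: "busy ?s1 ?l = set (take (length fs) F)"
  proof -
    have "busy ?s1 ?l = busy s ?l \<union> fst ` set (zip F fs)" by (force simp: busy_def a1)
    then show ?thesis using fresh mf(1) by (metis list.set_map sup_bot.left_neutral)
  qed
  have 2: "(step I Bl)\<^sup>*\<^sup>* ?s1 (assign_all (zip G rs) ?s1)"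
  proof (rule assign_all_rest)
    show "1 \<le> stage ?s1" using D(1) a1 by simp
    show "distinct (map fst (zip G rs))" using das unfolding as by simp
    show "distinct (map (set \<circ> snd) (zip G rs))" using dfs mf by (simp flip: map_map)
    fix b assume "b \<in> Bl (stage ?s1)" "b \<inter> I_first I (stage ?s1) \<noteq> {}"
    then have "b \<in> set ` set bs" "b \<inter> I_first I ?l \<noteq> {}" using Bl by (simp_all add: a1)
    then show "done_block ?s1 b" using done1 unfolding fs by auto
  next
    fix i b assume ib: "(i, b) \<in> set (zip G rs)"
    have b: "b \<in> set rs" using ib by (auto dest: set_zip_rightD)
    have "i \<in> set (take (length rs) G)"
      using ib mf(2) by (metis fst_conv image_eqI list.set_map)
    then have "i \<in> set (map fst (zip G rs))" using mf by simp
    then have "i \<notin> set (take (length fs) F)" "i \<notin> set L1"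
      using das unfolding as by (auto simp: mf)
    moreover have "set b \<notin> set ` set fs" using b unfolding fs rs by auto
    ultimately show "set b \<in> Bl (stage ?s1) \<and> set b \<inter> I_first I (stage ?s1) = {} \<and>
      \<not> done_block ?s1 (set b) \<and> i < num_drones I Bl \<and> i \<notin> busy ?s1 (stage ?s1) \<and>
      i \<notin> D_last I ?s1 (stage ?s1 - 1)"
      using lt[of i b] ib b Bl pools busy1 last1 done1 unfolding as rs pools_def by (auto simp: a1)
  qed
  show "(step I Bl)\<^sup>*\<^sup>* s (assign_all as s)" using 1 2 unfolding as by simp
  have a2: "assigned (assign_all as s) = assigned s \<union> {(?l, set b, i) | i b. (i, b) \<in> set as}"
    "stage (assign_all as s) = ?l"
    using assign_all_fields[of as s] by auto
  have snd_as: "snd ` set as = set bs"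
  proof -
    have "map snd as = fs @ rs" unfolding as by (simp add: mf)
    then have "snd ` set as = set fs \<union> set rs" by (metis list.set_map set_append)
    then show ?thesis unfolding fs rs by auto
  qed
  then show "set as \<subseteq> UNIV \<times> set bs" by force
  show "done_block (assign_all as s) b" if "b \<in> Bl ?l" for b
  proof -
    have "b \<in> set ` set bs" using that Bl by simp
    then obtain b' where "b' \<in> set bs" "b = set b'" by blast
    then obtain i where "(i, b') \<in> set as" using snd_as by force
    then show ?thesis using \<open>b = set b'\<close> by (auto simp: done_block_def a2)
  qed
  have old: "(?l, b, i) \<notin> assigned s" for b i using fresh by (auto simp: busy_def)
  show "busy (assign_all as s) ?l = fst ` set as" using old by (force simp: busy_def a2)
  show "D_last I (assign_all as s) ?l = {i. \<exists>b. (i, b) \<in> set as \<and> set b \<inter> I_last I ?l \<noteq> {}}"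
    using old by (auto simp: D_last_def a2)
  have "D_last I (assign_all as s) (?l - 1) = D_last I s (?l - 1)"
    using ne1 by (auto simp: D_last_def a2)
  then show "D_last I (assign_all as s) (?l - 1) = set L1" using pools unfolding pools_def by simp
qed

lemma schedule_assign_all:
  "schedule I (assign_all as s) i =
    schedule I s i \<union> {Deliver d | b d. (i, b) \<in> set as \<and> d \<in> set b}"
  using assign_all_fields[of as s] by (auto simp: schedule_def)

text \<open>The arguments determine the stage: \<open>ss\<close> are the stations not yet passed,
  and there is one more group than stations left, so the blocks run out exactly after the last
  group.\<close>

lemma allot_simulation:
  assumes "inv I Bl s" "pools s F N L1 L2" "busy s (stage s) = {}"
    and "l = stage s" "p = (if l = 1 then None else Some (tD I (l - 1)))"
    and "ss = drop (l - 1) (stations I)" "length bss = Suc (length ss)"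
    and "\<And>j. j < length bss \<Longrightarrow> lists_family (l + j) (bss ! j)"
    and "\<And>i. log_of acc i = schedule I s i"
  shows "\<exists>t. (step I Bl)\<^sup>*\<^sup>* s t \<and> final I Bl t \<and>
    (\<forall>i. log_of (val (allot l p ss bss F N L1 L2 acc)) i = schedule I t i)"
  using assms
proof (induction bss arbitrary: s l p ss F N L1 L2 acc)
  case (Cons bs bss)
  note inv = Cons.prems(1) and pools = Cons.prems(2) and fresh = Cons.prems(3)
  note l = Cons.prems(4) and ss = Cons.prems(6) and len = Cons.prems(7)
  note D = invD[OF inv]
  define fs where "fs = filter (\<lambda>b. set b \<inter> I_first I (stage s) \<noteq> {}) bs"
  define rs where "rs = filter (\<lambda>b. \<not> set b \<inter> I_first I (stage s) \<noteq> {}) bs"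
  define G where "G = N @ L2 @ drop (length fs) F"
  define as where "as = zip F fs @ zip G rs"
  let ?t = "assign_all as s"
  have bs: "lists_family (stage s) bs" using Cons.prems(8)[of 0] l by simp
  note S = stage_simulation[OF inv pools fresh bs fs_def rs_def G_def as_def]
  note sz = pools_sizes[OF inv pools bs fs_def rs_def, folded G_def]
  have sub: "set b \<subseteq> group I l" if "b \<in> set bs" for b
    using block_facts(5)[OF valid families D(1,2)] bs that l unfolding lists_family_def by blast
  \<comment> \<open>For the first group \<open>p = None\<close> reproduces the empty
    \<open>I_first\<close>; later \<open>p\<close> is the departure time in its definition.\<close>
  have first: "(\<exists>t d. p = Some t \<and> d \<in> set b \<and> t \<in> interval d) \<longleftrightarrow> set b \<inter> I_first I (stage s) \<noteq> {}"
    if "b \<in> set bs" for b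
    using sub[OF that] Cons.prems(5) D(1) l by (auto simp: I_first_def)
  have fr: "val (split_first p bs) = (fs, rs)"
    unfolding val_split_first fs_def rs_def using first by (auto intro!: filter_cong)
  have inv_t: "inv I Bl ?t" using inv_reachable[OF valid families S(1) inv] .
  have st: "stage ?t = l" using assign_all_fields[of as s] l by simp
  define acc1 where "acc1 = val (log_blocks as acc)"
  have acc1: "log_of acc1 i = schedule I ?t i" for i
    using Cons.prems(9)[of i]
    by (auto simp: log_of_def acc1_def set_log_blocks schedule_assign_all)
  show ?case
  proof (cases ss)
    case Nil
    have "num_stations I \<le> l - 1" using Nil ss by (simp add: num_stations_def)
    then have "l = num_stations I + 1" using D(1,2) l by simp
    then have "final I Bl ?t" using S(2) st l by (simp add: final_def)
    moreover have "val (allot l p ss (bs # bss) F N L1 L2 acc) = acc1"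
      using fr sz Nil by (simp add: val_hand_out acc1_def as_def G_def)
    ultimately show ?thesis using S(1) acc1 by auto
  next
    case st0: (Cons s0 ss')
    have "l - 1 < length (stations I)" using st0 ss by (metis drop_all linorder_not_less list.discI)
    then have lr: "l \<le> num_stations I" and s0: "s0 = station_at I l" and ss': "ss' = drop l (stations I)"
      using st0 ss D(1) l by (auto simp: num_stations_def station_at_def Cons_nth_drop_Suc[symmetric])
    have ad: "arr s0 = tA I l" "dep s0 = tD I l" by (simp_all add: s0 tA_def tD_def)
    define ns where "ns = map fst (filter (\<lambda>(i, b). \<not> (\<exists>d \<in> set b. arr s0 \<in> interval d)) as)"
    define ls where "ls = map fst (filter (\<lambda>(i, b). \<exists>d \<in> set b. arr s0 \<in> interval d) as)"
    define acc3 where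
      "acc3 = val (log_recharges l s0 L1 (val (log_recharges l s0 ns acc1)))"
    let ?u = "recharge I ?t"
    have last: "(\<exists>d \<in> set b. arr s0 \<in> interval d) \<longleftrightarrow> set b \<inter> I_last I l \<noteq> {}" if "(i, b) \<in> set as" for i b
      using sub[of b] S(7) that lr by (auto simp: I_last_def ad)
    have ls: "set ls = D_last I ?t l"
      unfolding S(5)[folded l] ls_def using last by force
    have dist: "distinct (map fst as @ drop (length rs) G @ L1)"
      using S(3) pools mset_eq_imp_distinct_iff unfolding pools_def by blast
    have "mset ns + mset ls = mset (map fst as)"
      unfolding ns_def ls_def using mset_filter_part[of fst "\<lambda>(i, b). \<exists>d \<in> set b. arr s0 \<in> interval d" as]
      by (simp add: case_prod_unfold)
    then have ms_nl: "mset (ns @ ls) = mset (map fst as)" by simp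
    have set_nl: "set ns \<union> set ls = fst ` set as" using mset_eq_setD[OF ms_nl] by simp
    have "distinct (map fst as)" using dist by simp
    then have "distinct (ns @ ls)" using mset_eq_imp_distinct_iff[OF ms_nl] by blast
    then have ns: "set ns = busy ?t l - D_last I ?t l"
      using set_nl ls S(4) l by auto
    have disj: "set L1 \<inter> fst ` set as = {}" using dist by auto
    have rech: "rechargers I ?t = set ns \<union> set L1"
    proof -
      have "D_last I ?t l \<subseteq> fst ` set as" using set_nl ls by blast
      then show ?thesis
        unfolding rechargers_eq[OF inv_t] st ns S(4)[folded l] S(6)[folded l] using disj by blast
    qed
    have step: "step I Bl ?t ?u"
      using S(2) l st lr by (intro step.recharge) auto
    have inv_u: "inv I Bl ?u" by (rule inv_step[OF valid families step inv_t])
    have stu: "stage ?u = Suc l" by (simp add: recharge_simps st)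
    have ms: "mset (drop (length rs) G @ ns @ ls @ L1) = mset (F @ N @ L1 @ L2)"
      using S(3) ms_nl by (simp add: ac_simps)
    \<comment> \<open>The roles advance by one stage: the drones just used split into
      \<open>ns\<close> and \<open>ls\<close>, the old \<open>L1\<close> becomes the new
      \<open>L2\<close>, and drones of the old \<open>N\<close>, \<open>L2\<close> and
      \<open>F\<close> left without a block form the new general pool.\<close>
    have "pools ?u (drop (length rs) G) ns ls L1"
      unfolding pools_def
    proof (intro conjI)
      show "distinct (drop (length rs) G @ ns @ ls @ L1)"
        using ms pools mset_eq_imp_distinct_iff unfolding pools_def by blast
      show "set (drop (length rs) G @ ns @ ls @ L1) = {..<num_drones I Bl}"
        using mset_eq_setD[OF ms] pools unfolding pools_def by blast
      show "set ns = busy ?u (stage ?u - 1) - D_last I ?u (stage ?u - 1)"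
        using ns by (simp add: st recharge_simps)
      show "set ls = D_last I ?u (stage ?u - 1)" using ls by (simp add: st recharge_simps)
      show "set L1 = D_last I ?u (stage ?u - 2)"
        using S(6)[folded l] by (simp add: st recharge_simps numeral_2_eq_2)
    qed
    moreover have "busy ?u (stage ?u) = {}"
      using invD(3)[OF inv_t] st unfolding stu by (force simp: busy_def recharge_simps)
    moreover have "log_of acc3 i = schedule I ?u i" for i
      using acc1[of i]
      by (auto simp: log_of_def acc3_def set_log_recharges schedule_recharge rech st ad)
    moreover have "lists_family (Suc l + j) (bss ! j)" if "j < length bss" for j
      using Cons.prems(8)[of "Suc j"] that by simp
    ultimately have "\<exists>t. (step I Bl)\<^sup>*\<^sup>* ?u t \<and> final I Bl t \<and>
      (\<forall>i. log_of (val (allot (Suc l) (Some (dep s0)) ss' bss (drop (length rs) G) ns ls L1 acc3)) i = schedule I t i)"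
      using inv_u stu ss' len st0 D(1) l by (intro Cons.IH) (auto simp: ad)
    moreover have "val (allot l p ss (bs # bss) F N L1 L2 acc) =
      val (allot (Suc l) (Some (dep s0)) ss' bss (drop (length rs) G) ns ls L1 acc3)"
      using fr sz st0
      by (simp add: val_hand_out acc1_def as_def G_def val_split_last ns_def ls_def acc3_def)
    moreover have "(step I Bl)\<^sup>*\<^sup>* s ?u" using S(1) step by simp
    ultimately show ?thesis by (metis rtranclp_trans)
  qed
qed simp

end

lemma sorted_arrivals:
  assumes "valid_SC I"
  shows "sorted (map arr (stations I))"
  unfolding sorted_iff_nth_mono_less
  using arr_mono[OF assms, of "Suc i" "Suc j" for i j]
  by (auto simp: tA_def station_at_def num_stations_def)

lemma prog_SC_correct:
  assumes valid: "valid_SC I" and ds: "distinct ds" "set ds = deliveries I"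
    and run: "val (prog_SC (cap I) ds (stations I)) = (M, acc)"
  shows "algo_SC impl_NS I M (log_of acc)"
proof -
  obtain cs w where cw: "val (colour ds) = (cs, w)" by fastforce
  have tl: "tL d \<le> tR d" if "d \<in> set ds" for d using that ds delivery_bounds[OF valid] by blast
  have w: "w = omega (deliveries I)" using colour_correct(2)[OF ds(1) tl cw] ds(2) by simp
  let ?ss = "stations I" and ?xs = "val (msort by_start ds)"
  define gs where "gs = val (groups ?ss ?xs)"
  define bss where "bss = map (\<lambda>g. val (prog_NS (cap I) g)) gs"
  define m where "m = Max (insert 0 (length ` set bss))"
  define Bl where "Bl = (\<lambda>l. set ` set (bss ! (l - 1)))"
  note G = groups_correct[OF sorted_by_start[of ds] sorted_arrivals[OF valid], folded gs_def]
  have leng: "length gs = num_stations I + 1" using G by (simp add: num_stations_def)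
  have g: "distinct (gs ! (l - 1))" "set (gs ! (l - 1)) = group I l"
    if l: "l \<in> {1..num_stations I + 1}" for l
  proof -
    have "gs ! (l - 1) \<in> set gs" using l leng by (intro nth_mem) auto
    moreover have "distinct (concat gs)" using G ds by simp
    ultimately show "distinct (gs ! (l - 1))" by (simp add: distinct_concat_iff)
    have "l - 1 \<le> length ?ss" using l by (auto simp: num_stations_def)
    then have "set (gs ! (l - 1)) = {d \<in> set ?xs. (0 < l - 1 \<longrightarrow> arr (?ss ! (l - 1 - 1)) \<le> tL d) \<and>
      (l - 1 < length ?ss \<longrightarrow> tL d < arr (?ss ! (l - 1)))}"
      by (rule G[THEN conjunct2, THEN conjunct2, rule_format])
    then show "set (gs ! (l - 1)) = group I l"
      using l ds by (auto simp: group_def tA_def station_at_def num_stations_def)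
  qed
  have impl: "SC_blocks impl_NS I Bl"
    unfolding SC_blocks_def
  proof
    fix l assume l: "l \<in> {1..num_stations I + 1}"
    then have "Bl l = set ` set (val (prog_NS (cap I) (gs ! (l - 1))))"
      using leng by (auto simp: Bl_def bss_def)
    then show "impl_NS (cap I) (group I l) (Bl l)" using g[OF l] unfolding impl_NS_def by blast
  qed
  have fam: "block_families I Bl" by (rule SC_blocks_families[OF impl_NS_algo_NS valid impl])
  have lf: "lists_family Bl (1 + j) (bss ! j)" if j: "j < length bss" for j
  proof -
    let ?g = "gs ! j"
    have jl: "1 + j \<in> {1..num_stations I + 1}" using j leng by (simp add: bss_def)
    have "tL d \<le> tR d" if "d \<in> set ?g" for d
      using that g(2)[OF jl] group_subset[OF valid] delivery_bounds[OF valid] by auto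
    then have "mset (concat (bss ! j)) = mset ?g \<and> [] \<notin> set (bss ! j)"
      using prog_NS_blocks[of ?g "cap I"] g(1)[OF jl] j by (simp add: bss_def)
    then have d: "distinct (concat (bss ! j))" "[] \<notin> set (bss ! j)"
      using g(1)[OF jl] mset_eq_imp_distinct_iff by auto
    \<comment> \<open>Different blocks of the list are disjoint, so equal sets would both be empty,
      and no block is empty.\<close>
    have "inj_on set (set (bss ! j))"
    proof (rule inj_onI, rule ccontr)
      fix x y assume xy: "x \<in> set (bss ! j)" "y \<in> set (bss ! j)" "set x = set y" "x \<noteq> y"
      have "set x \<inter> set y = {}" using d(1) xy(1,2,4) unfolding distinct_concat_iff by blast
      then have "y = []" using xy(3) by simp
      then show False using xy(2) d(2) by simp
    qed
    moreover have "distinct (bss ! j)"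
      using d by (simp add: distinct_concat_iff removeAll_id)
    ultimately show ?thesis unfolding lists_family_def[OF valid fam] by (simp add: distinct_map Bl_def)
  qed
  have card: "card (Bl l) = length (bss ! (l - 1))" if "l \<in> {1..num_stations I + 1}" for l
  proof -
    have "l - 1 < length bss" "1 + (l - 1) = l" using that leng by (auto simp: bss_def)
    then have "lists_family Bl l (bss ! (l - 1))" using lf[of "l - 1"] by simp
    then show ?thesis
      using distinct_card[of "map set (bss ! (l - 1))"]
      unfolding lists_family_def[OF valid fam] by simp
  qed
  have "(\<lambda>l. card (Bl l)) ` {1..num_stations I + 1} = length ` set bss"
  proof -
    have "(\<lambda>l. card (Bl l)) ` {1..num_stations I + 1} = (\<lambda>j. length (bss ! j)) ` ((\<lambda>l. l - 1) ` {1..num_stations I + 1})"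
      using card by (simp add: image_image)
    also have "(\<lambda>l. l - 1) ` {1..num_stations I + 1} = {..<length bss}"
      using leng by (force simp: bss_def image_iff)
    also have "(\<lambda>j. length (bss ! j)) ` {..<length bss} = length ` set bss"
      by (auto simp: set_conv_nth)
    finally show ?thesis .
  qed
  moreover have "Max (insert 0 (length ` set bss)) = Max (length ` set bss)"
    using leng by (subst Max_insert) (auto simp: bss_def)
  ultimately have M: "num_drones I Bl = m + 2 * w" by (simp add: num_drones_def m_def w)
  have blocks: "val (blocks (cap I) gs) = (bss, m)"
    using val_blocks[of "cap I" gs] by (simp add: bss_def m_def prod_eq_iff)
  have pools: "pools I Bl (init I) (rev [0..<m + 2 * w]) [] [] []"
    unfolding pools_def[OF valid fam] M by (auto simp: init_def busy_def D_last_def)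
  have "\<exists>t. (step I Bl)\<^sup>*\<^sup>* (init I) t \<and> final I Bl t \<and>
    (\<forall>i. log_of (val (allot 1 None ?ss bss (rev [0..<m + 2 * w]) [] [] [] [])) i = schedule I t i)"
    using lf leng
    by (intro allot_simulation[OF valid fam inv_init[OF valid fam] pools])
      (auto simp: init_def busy_def schedule_def log_of_def bss_def num_stations_def)
  then obtain t where t: "(step I Bl)\<^sup>*\<^sup>* (init I) t \<and> final I Bl t \<and>
    (\<forall>i. log_of (val (allot 1 None ?ss bss (rev [0..<m + 2 * w]) [] [] [] [])) i = schedule I t i)" ..
  have acc: "M = m + 2 * w \<and> acc = val (allot 1 None ?ss bss (rev [0..<m + 2 * w]) [] [] [] [])"
    using run cw blocks by (auto simp: prog_SC_def gs_def[symmetric])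
  show ?thesis
    unfolding algo_SC_def
  proof (intro exI[of _ Bl] exI[of _ t] conjI)
    show "log_of acc = schedule I t" using t acc by auto
  qed (use impl t M acc in simp_all)
qed


section \<open>Running time\<close>

lemma time_len [simp]: "time (len xs) = Suc (length xs)"
  by (induction xs) auto

lemma time_app [simp]: "time (app xs ys) = Suc (length xs)"
  by (induction xs) auto

lemma time_countdown [simp]: "time (countdown k) = Suc k"
  by (induction k) auto

lemma time_merge: "time (merge le xs ys) \<le> Suc (length xs + length ys)"
  by (induction le xs ys rule: merge.induct) auto

section \<open>Time of merge sort\<close>

lemma length_sort_prefix:
  assumes "k \<le> length xs"
  shows "length (fst (val (sort_prefix le k xs))) = k" "snd (val (sort_prefix le k xs)) = drop k xs"
  using mset_sort_prefix[OF assms, of le] mset_eq_length[of "fst (val (sort_prefix le k xs))" "take k xs"] assms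
  by auto

text \<open>The slack 2 closes the induction: the two halves return 4, which pays for the call
  itself, the constant step of \<open>merge\<close> and the slack 2 of the goal. The remaining
  \<open>k\<close> steps of merging raise the factor from \<open>p + 3\<close> to
  \<open>p + 4\<close>.\<close>

lemma time_sort_prefix:
  "1 \<le> k \<Longrightarrow> k \<le> 2 ^ p \<Longrightarrow> k \<le> length xs \<Longrightarrow> time (sort_prefix le k xs) + 2 \<le> k * (p + 3)"
proof (induction p arbitrary: k xs)
  case 0
  then show ?case by (simp add: sort_prefix.simps)
next
  case (Suc p)
  show ?case
  proof (cases "k = 1")
    case True
    then show ?thesis using Suc.prems by (simp add: sort_prefix.simps)
  next
    case False
    let ?h = "k div 2" and ?as = "sort_prefix le (k div 2) xs"
    let ?bs = "sort_prefix le (k - ?h) (drop ?h xs)"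
    have k: "2 \<le> k" "xs \<noteq> []" using False Suc.prems by auto
    have a: "snd (val ?as) = drop ?h xs" "length (fst (val ?as)) = ?h"
      using length_sort_prefix[of ?h xs le] Suc.prems by auto
    have b: "length (fst (val ?bs)) = k - ?h"
      using length_sort_prefix[of "k - ?h" "drop ?h xs" le] Suc.prems by auto
    have ta: "time ?as + 2 \<le> ?h * (p + 3)" using k Suc.prems by (intro Suc.IH) auto
    have tb: "time ?bs + 2 \<le> (k - ?h) * (p + 3)" using k Suc.prems by (intro Suc.IH) auto
    have "time (merge le (fst (val ?as)) (fst (val ?bs))) \<le> Suc k"
      using time_merge[of le "fst (val ?as)" "fst (val ?bs)"] a b by simp
    moreover have "time (sort_prefix le k xs) =
        Suc (time ?as + (time ?bs + time (merge le (fst (val ?as)) (fst (val ?bs)))))"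
      using k a by (subst sort_prefix.simps) (simp add: case_prod_beta)
    moreover have "?h * (p + 3) + (k - ?h) * (p + 3) = k * (p + 3)"
      by (simp flip: add_mult_distrib)
    ultimately show ?thesis using ta tb by (simp add: algebra_simps)
  qed
qed

lemma time_msort:
  assumes "length xs \<le> 2 ^ p"
  shows "time (msort le xs) \<le> length xs * (p + 4) + 3"
proof (cases "xs = []")
  case True
  then show ?thesis by (simp add: msort_def case_prod_beta sort_prefix.simps)
next
  case False
  then have "1 \<le> length xs" by (cases xs) auto
  then show ?thesis
    using time_sort_prefix[OF _ assms order_refl, of le]
    by (simp add: msort_def case_prod_beta algebra_simps)
qed

section \<open>Conflicting pairs met by the sweep\<close>

fun conflicts :: "delivery list \<Rightarrow> delivery list \<Rightarrow> nat" where
  "conflicts act [] = 0"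
| "conflicts act (d # ds) = length (filter (conflicting d) act) + conflicts (d # act) ds"

lemma length_filter_le_mset:
  "mset xs \<subseteq># mset ys \<Longrightarrow> length (filter P xs) \<le> length (filter P ys)"
  by (metis mset_filter multiset_filter_mono size_mset size_mset_mono)

lemma conflicts_mono: "mset act \<subseteq># mset act' \<Longrightarrow> conflicts act ds \<le> conflicts act' ds"
proof (induction ds arbitrary: act act')
  case (Cons d ds)
  have "conflicts (d # act) ds \<le> conflicts (d # act') ds" using Cons by (intro Cons.IH) simp
  then show ?case using length_filter_le_mset[OF Cons.prems, of "conflicting d"] by simp
qed simp

lemma n_conf_insert:
  assumes "finite D" "d \<notin> D"
  shows "card {e \<in> D. conflicting d e} + n_conf D \<le> n_conf (insert d D)"
proof -
  let ?E = "\<lambda>D. {{d, e} | d e. d \<in> D \<and> e \<in> D \<and> d \<noteq> e \<and> conflicting d e}"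
  let ?N = "(\<lambda>e. {d, e}) ` {e \<in> D. conflicting d e}"
  have fin: "finite (?E (insert d D))"
    by (rule finite_subset[of _ "Pow (insert d D)"]) (use assms in auto)
  have "inj_on (\<lambda>e. {d, e}) {e \<in> D. conflicting d e}"
    by (auto simp: inj_on_def doubleton_eq_iff)
  then have "card {e \<in> D. conflicting d e} + n_conf D = card ?N + card (?E D)"
    by (simp add: card_image n_conf_def)
  also have "\<dots> = card (?N \<union> ?E D)"
    using assms by (intro card_Un_disjoint[symmetric] finite_subset[of "?E D" "Pow D"])
      (auto simp: doubleton_eq_iff)
  also have "\<dots> \<le> n_conf (insert d D)"
    unfolding n_conf_def using assms fin by (intro card_mono) auto
  finally show ?thesis .
qed

lemma n_conf_Un:
  assumes "finite A" "finite B" "A \<inter> B = {}"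
  shows "n_conf A + n_conf B \<le> n_conf (A \<union> B)"
proof -
  let ?E = "\<lambda>D. {{d, e} | d e. d \<in> D \<and> e \<in> D \<and> d \<noteq> e \<and> conflicting d e}"
  have fin: "finite (?E D)" if "finite D" for D
    by (rule finite_subset[of _ "Pow D"]) (use that in auto)
  have "?E A \<inter> ?E B = {}" using assms(3) by (auto simp: doubleton_eq_iff)
  then have "n_conf A + n_conf B = card (?E A \<union> ?E B)"
    unfolding n_conf_def using fin assms by (intro card_Un_disjoint[symmetric]) auto
  also have "\<dots> \<le> n_conf (A \<union> B)"
    unfolding n_conf_def using assms by (intro card_mono fin) auto
  finally show ?thesis .
qed

text \<open>Along the list each pair is counted at its later member, so every new delivery
  contributes the pairs that \<open>n_conf_insert\<close> adds.\<close>

lemma conflicts_n_conf: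
  "distinct (act @ ds) \<Longrightarrow> conflicts act ds + n_conf (set act) \<le> n_conf (set act \<union> set ds)"
proof (induction ds arbitrary: act)
  case (Cons d ds)
  have "length (filter (conflicting d) act) = card {e \<in> set act. conflicting d e}"
    using Cons.prems distinct_card[of "filter (conflicting d) act"] by simp
  then have "length (filter (conflicting d) act) + n_conf (set act) \<le> n_conf (set (d # act))"
    using n_conf_insert[of "set act" d] Cons.prems by simp
  moreover have "conflicts (d # act) ds + n_conf (set (d # act)) \<le> n_conf (set (d # act) \<union> set ds)"
    using Cons.prems by (intro Cons.IH) auto
  ultimately show ?case by (simp add: insert_commute)
qed simp

lemma time_expire [simp]: "time (expire t act fr) = Suc (length act)"
  by (induction t act fr rule: expire.induct) (auto simp: case_prod_beta)

text \<open>\<open>length act\<close> is a potential paying for the next expiry. Each survivor is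
  renewed by its conflict with \<open>d\<close>; the 3 per delivery are the step of
  \<open>sweep\<close>, the final step of \<open>expire\<close> and the unit with which
  \<open>d\<close> enters the active list.\<close>

lemma time_sweep:
  assumes "sweep_ok ds act fr k"
  shows "time (sweep ds act fr k) \<le> 1 + length act + 3 * length ds + conflicts (map fst act) ds"
  using assms
proof (induction ds arbitrary: act fr k)
  case Nil
  then show ?case by simp
next
  case (Cons d ds)
  obtain act' fr' where ex: "val (expire (tL d) act fr) = (act', fr')" by fastforce
  have act': "act' = filter (\<lambda>(e, c). tL d \<le> tR e) act" using ex by (simp add: val_expire)
  obtain c fr'' k' where step: "fr' = [] \<and> c = k \<and> fr'' = [] \<and> k' = Suc k \<or> fr' = c # fr'' \<and> k' = k"
    by (cases fr') auto
  have ok: "sweep_ok ds ((d, c) # act') fr'' k'"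
    using sweep_ok_expire[OF Cons.prems(1) ex] step by auto
  have "time (sweep (d # ds) act fr k) = length act + 2 + time (sweep ds ((d, c) # act') fr'' k')"
    using step ex by (auto simp: case_prod_beta)
  also have "\<dots> \<le> length act + 2 + (1 + Suc (length act') + 3 * length ds + conflicts (d # map fst act') ds)"
    using Cons.IH[OF ok] by simp
  also have "length act' \<le> length (filter (conflicting d) (map fst act))"
  proof -
    have sub: "mset (map fst act') \<subseteq># mset (map fst act)" unfolding act' by (simp add: image_mset_subseteq_mono)
    have "filter (conflicting d) (map fst act') = map fst act'"
      using expire_conflicting(2)[OF Cons.prems ex] by (auto simp: filter_id_conv)
    then show ?thesis using length_filter_le_mset[OF sub, of "conflicting d"] by simp
  qed
  also have "conflicts (d # map fst act') ds \<le> conflicts (d # map fst act) ds"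
    unfolding act' by (intro conflicts_mono) (simp add: image_mset_subseteq_mono)
  finally show ?case by simp
qed

lemma time_colour:
  assumes "distinct ds" "\<And>d. d \<in> set ds \<Longrightarrow> tL d \<le> tR d" "length ds \<le> 2 ^ p"
  shows "time (colour ds) \<le> length ds * (p + 7) + n_conf (set ds) + 5"
proof -
  let ?xs = "val (msort by_start ds)"
  have ok: "sweep_ok ?xs [] [] 0"
    using assms(1,2) sorted_by_start unfolding sweep_ok_def by simp
  have "conflicts [] ?xs \<le> n_conf (set ds)"
    using conflicts_n_conf[of "[]" ?xs] assms(1) by simp
  then have "time (sweep ?xs [] [] 0) \<le> 1 + 3 * length ds + n_conf (set ds)"
    using time_sweep[OF ok] by simp
  then show ?thesis
    using time_msort[OF assms(3), of by_start] by (simp add: colour_def algebra_simps)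
qed

lemma time_fill: "time (fill B c rem b xs) = Suc (length xs)"
  by (induction B c rem b xs rule: fill.induct) auto

lemma time_prog_NS:
  assumes "distinct ds" "\<And>d. d \<in> set ds \<Longrightarrow> tL d \<le> tR d" "length ds \<le> 2 ^ p"
  shows "time (prog_NS B ds) \<le> length ds * (2 * p + 12) + n_conf (set ds) + 10"
proof -
  obtain cs m where cm: "val (colour ds) = (cs, m)" by fastforce
  have len: "length cs = length ds"
    using mset_eq_length[OF colour_correct(1)[OF assms(1,2) cm]] by simp
  let ?xs = "val (msort by_colour_cost cs)"
  have "time (case ?xs of [] \<Rightarrow> ret [] | (d, c) # ys \<Rightarrow> fill B c (B - cost d) [d] ys) \<le> length ?xs"
    using length_msort[of by_colour_cost cs]
    by (cases ?xs) (simp_all add: time_fill split: prod.split)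
  then have "time (prog_NS B ds) \<le> 1 + time (colour ds) + time (msort by_colour_cost cs) + length ds"
    using cm len by (simp add: prog_NS_def)
  then show ?thesis
    using time_colour[OF assms] time_msort[of cs p by_colour_cost] len assms(3)
    by (simp add: algebra_simps)
qed

lemma time_split_before: "time (split_before t ds) \<le> Suc (length (fst (val (split_before t ds))))"
  by (induction t ds rule: split_before.induct) (auto simp: case_prod_beta)

lemma length_split_before:
  "length (fst (val (split_before t ds))) + length (snd (val (split_before t ds))) = length ds"
  by (induction t ds rule: split_before.induct) (auto simp: case_prod_beta)

lemma time_groups: "time (groups ss ds) \<le> length ds + 2 * length ss + 1"
proof (induction ss ds rule: groups.induct)
  case (2 s ss ds)
  obtain xs ys where xy: "val (split_before (arr s) ds) = (xs, ys)" by fastforce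
  have "time (groups ss ys) \<le> length ys + 2 * length ss + 1" by (rule 2)
  then show ?case
    using xy time_split_before[of "arr s" ds] length_split_before[of "arr s" ds]
    by (simp add: case_prod_beta)
qed simp

lemma length_concat_ge: "[] \<notin> set xss \<Longrightarrow> length xss \<le> length (concat xss)"
proof (induction xss)
  case (Cons xs xss)
  then show ?case by (cases xs) auto
qed simp

lemma length_prog_NS:
  assumes "distinct ds" "\<And>d. d \<in> set ds \<Longrightarrow> tL d \<le> tR d"
  shows "length (concat (val (prog_NS B ds))) = length ds" "length (val (prog_NS B ds)) \<le> length ds"
  using prog_NS_blocks[OF assms, of B] mset_eq_length[of "concat (val (prog_NS B ds))" ds]
    length_concat_ge[of "val (prog_NS B ds)"] by auto

text \<open>A single exponent \<open>p\<close> for all groups makes the sorting cost additive, and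
  \<open>n_conf\<close> is superadditive on disjoint sets. Each group adds to
  \<open>time_prog_NS\<close> one step for the call and the cost of \<open>len\<close>, turning 12
  into 13 and 10 into 12.\<close>

lemma time_blocks:
  assumes "distinct (concat gs)" "\<And>d. d \<in> set (concat gs) \<Longrightarrow> tL d \<le> tR d"
    "length (concat gs) \<le> 2 ^ p"
  shows "time (blocks B gs) \<le>
      length (concat gs) * (2 * p + 13) + n_conf (set (concat gs)) + 12 * length gs + 1 \<and>
    length (fst (val (blocks B gs))) = length gs \<and>
    length (concat (concat (fst (val (blocks B gs))))) = length (concat gs) \<and>
    length (concat (fst (val (blocks B gs)))) \<le> length (concat gs) \<and>
    snd (val (blocks B gs)) \<le> length (concat gs)"
  using assms
proof (induction gs)
  case (Cons g gs)
  have g: "distinct g" "\<And>d. d \<in> set g \<Longrightarrow> tL d \<le> tR d" "length g \<le> 2 ^ p"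
    using Cons.prems by auto
  have IH: "time (blocks B gs) \<le>
      length (concat gs) * (2 * p + 13) + n_conf (set (concat gs)) + 12 * length gs + 1"
    "length (fst (val (blocks B gs))) = length gs"
    "length (concat (concat (fst (val (blocks B gs))))) = length (concat gs)"
    "length (concat (fst (val (blocks B gs)))) \<le> length (concat gs)"
    "snd (val (blocks B gs)) \<le> length (concat gs)"
    using Cons.IH Cons.prems by auto
  have nc: "n_conf (set g) + n_conf (set (concat gs)) \<le> n_conf (set (concat (g # gs)))"
    using n_conf_Un[of "set g" "set (concat gs)"] Cons.prems(1) by auto
  have "time (blocks B (g # gs)) = Suc (time (prog_NS B g) + (Suc (length (val (prog_NS B g))) + time (blocks B gs)))"
    by (simp add: case_prod_beta)
  also have "\<dots> \<le> length (concat (g # gs)) * (2 * p + 13) + n_conf (set (concat (g # gs))) + 12 * length (g # gs) + 1"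
    using time_prog_NS[OF g, of B] length_prog_NS(2)[OF g(1,2), of B] IH(1) nc
    by (simp add: algebra_simps)
  finally show ?case
    using IH length_prog_NS[OF g(1,2), of B] by (auto simp: case_prod_beta)
qed simp

section \<open>Time of the assignment phase\<close>

lemma time_any_contains: "time (any_contains t ds) \<le> Suc (length ds)"
  by (induction t ds rule: any_contains.induct) auto

lemma time_split_first:
  "time (split_first p bs) \<le> Suc (2 * length bs + length (concat bs)) \<and>
    length (fst (val (split_first p bs))) + length (snd (val (split_first p bs))) = length bs \<and>
    length (concat (fst (val (split_first p bs)))) + length (concat (snd (val (split_first p bs)))) =
      length (concat bs)"
proof (induction bs)
  case (Cons b bs)
  have "time (case p of None \<Rightarrow> ret False | Some t \<Rightarrow> any_contains t b) \<le> Suc (length b)"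
    using time_any_contains by (auto split: option.split)
  then show ?case using Cons by (auto simp: case_prod_beta)
qed simp

definition weight :: "(nat \<times> delivery list) list \<Rightarrow> nat" where
  "weight as = length (concat (map snd as))"

lemma time_hand_out:
  "time (hand_out bs is) \<le> Suc (length bs) \<and> length (fst (val (hand_out bs is))) \<le> length bs \<and>
    weight (fst (val (hand_out bs is))) \<le> length (concat bs)"
  by (induction bs "is" rule: hand_out.induct) (auto simp: case_prod_beta weight_def)

lemma time_log_block: "time (log_block i ds acc) = Suc (length ds)"
  by (induction i ds acc rule: log_block.induct) auto

lemma time_log_blocks: "time (log_blocks as acc) = 1 + 2 * length as + weight as"
  by (induction as acc rule: log_blocks.induct) (auto simp: time_log_block weight_def)

lemma time_log_recharges: "time (log_recharges l s is acc) = Suc (length is)"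
  by (induction l s "is" acc rule: log_recharges.induct) auto

lemma time_split_last:
  "time (split_last t as) \<le> 1 + 2 * length as + weight as \<and>
    length (fst (val (split_last t as))) + length (snd (val (split_last t as))) = length as"
proof (induction t as rule: split_last.induct)
  case (2 t i b as)
  then show ?case using time_any_contains[of t b] by (auto simp: case_prod_beta weight_def)
qed (simp add: weight_def)

text \<open>The terms for \<open>N\<close>, \<open>L1\<close> and \<open>L2\<close> are a potential: each drone is paid for by the block it
  was last assigned to.\<close>

lemma time_allot:
  "time (allot l p ss bss F N L1 L2 acc) \<le>
    length N + 2 * length L1 + length L2 + 11 * length (concat bss) + 3 * length (concat (concat bss)) +
    12 * length bss + 1"
proof (induction bss arbitrary: l p ss F N L1 L2 acc)
  case (Cons bs bss)
  obtain fs rs where fr: "val (split_first p bs) = (fs, rs)" by fastforce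
  obtain as1 F1 where h1: "val (hand_out fs F) = (as1, F1)" by fastforce
  obtain as2 F2 where h2: "val (hand_out rs (N @ L2 @ F1)) = (as2, F2)" by fastforce
  define acc1 where "acc1 = val (log_blocks (as1 @ as2) acc)"
  let ?as = "as1 @ as2"
  define R where "R = (case ss of [] \<Rightarrow> ret acc1 | s # ss' \<Rightarrow> do {
        (ns, ls) \<leftarrow> split_last (arr s) ?as;
        acc2 \<leftarrow> log_recharges l s ns acc1;
        acc3 \<leftarrow> log_recharges l s L1 acc2;
        allot (l + 1) (Some (dep s)) ss' bss F2 ns ls L1 acc3 })"
  have T: "time (allot l p ss (bs # bss) F N L1 L2 acc) =
    1 + time (split_first p bs) + time (hand_out fs F) + Suc (length L2) + Suc (length N) +
    time (hand_out rs (N @ L2 @ F1)) + Suc (length as1) + time (log_blocks ?as acc) + time R"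
    using fr h1 h2 by (cases ss) (simp_all add: R_def acc1_def)
  have sf: "time (split_first p bs) \<le> Suc (2 * length bs + length (concat bs))"
    "length fs + length rs = length bs" "length (concat fs) + length (concat rs) = length (concat bs)"
    using time_split_first[of p bs] fr by auto
  have t1: "time (hand_out fs F) \<le> Suc (length fs)" "length as1 \<le> length fs" "weight as1 \<le> length (concat fs)"
    using time_hand_out[of fs F] h1 by auto
  have t2: "time (hand_out rs (N @ L2 @ F1)) \<le> Suc (length rs)" "length as2 \<le> length rs"
    "weight as2 \<le> length (concat rs)"
    using time_hand_out[of rs "N @ L2 @ F1"] h2 by auto
  have w: "weight ?as = weight as1 + weight as2" by (simp add: weight_def)
  have "time R \<le> 4 + 2 * length ?as + weight ?as + length L1 + 3 * length ?as + length L1 +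
    11 * length (concat bss) + 3 * length (concat (concat bss)) + 12 * length bss"
  proof (cases ss)
    case Nil
    then show ?thesis by (simp add: R_def)
  next
    case (Cons s ss')
    obtain ns ls where sl: "val (split_last (arr s) ?as) = (ns, ls)" by fastforce
    define acc3 where "acc3 = val (log_recharges l s L1 (val (log_recharges l s ns acc1)))"
    have "time R = time (split_last (arr s) ?as) + Suc (length ns) + Suc (length L1) +
        time (allot (l + 1) (Some (dep s)) ss' bss F2 ns ls L1 acc3)"
      using sl Cons by (simp add: R_def time_log_recharges acc3_def)
    moreover have "time (allot (l + 1) (Some (dep s)) ss' bss F2 ns ls L1 acc3) \<le>
      length ns + 2 * length ls + length L1 + 11 * length (concat bss) +
      3 * length (concat (concat bss)) + 12 * length bss + 1"
      by (rule Cons.IH)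
    ultimately show ?thesis using time_split_last[of "arr s" ?as] sl by simp
  qed
  then show ?case
    unfolding T using sf t1 t2 w by (simp add: time_log_blocks)
qed simp

text \<open>The factor 4 of \<open>p\<close> is one from \<open>colour\<close>, one from sorting and
  two from \<open>blocks\<close>; the pairs count twice, in the global colouring and inside the
  groups. The drones are at most three times the deliveries, so \<open>countdown\<close> is linear.
  The other constants are rounded up.\<close>

lemma time_prog_SC:
  assumes valid: "valid_SC I" and ds: "distinct ds" "set ds = deliveries I" "length ds \<le> 2 ^ p"
  shows "time (prog_SC (cap I) ds (stations I)) \<le>
    length ds * (4 * p + 50) + 2 * n_conf (deliveries I) + 30 * num_stations I + 60"
proof -
  let ?xs = "val (msort by_start ds)" and ?n = "length ds" and ?c = "n_conf (deliveries I)"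
  obtain cs w where cw: "val (colour ds) = (cs, w)" by fastforce
  define gs where "gs = val (groups (stations I) ?xs)"
  obtain bss m where bm: "val (blocks (cap I) gs) = (bss, m)" by fastforce
  have tl: "tL d \<le> tR d" if "d \<in> set ds" for d using that ds delivery_bounds[OF valid] by blast
  have w: "w \<le> ?n"
    using colour_correct(2)[OF ds(1) tl cw] omega_le_card[of "set ds"] card_length[of ds] by simp
  have G: "length gs = Suc (num_stations I)" "concat gs = ?xs"
    using groups_correct[OF sorted_by_start[of ds] sorted_arrivals[OF valid]]
    by (simp_all add: gs_def num_stations_def)
  have B: "time (blocks (cap I) gs) \<le> ?n * (2 * p + 13) + ?c + 12 * Suc (num_stations I) + 1"
    "length bss = Suc (num_stations I)" "length (concat (concat bss)) = ?n"
    "length (concat bss) \<le> ?n" "m \<le> ?n"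
    using time_blocks[of gs p "cap I"] ds tl bm G by auto
  have "time (prog_SC (cap I) ds (stations I)) = Suc (time (colour ds) + time (msort by_start ds) +
      time (groups (stations I) ?xs) + time (blocks (cap I) gs) + Suc (m + 2 * w) +
      time (allot 1 None (stations I) bss (rev [0..<m + 2 * w]) [] [] [] []))"
    using cw bm by (simp add: prog_SC_def gs_def)
  then show ?thesis
    using time_colour[OF ds(1) tl ds(3)] time_msort[OF ds(3), of by_start] ds(2)
      time_groups[of "stations I" ?xs] B w
      time_allot[of 1 None "stations I" bss "rev [0..<m + 2 * w]" "[]" "[]" "[]" "[]"]
    by (simp add: algebra_simps num_stations_def)
qed

text \<open>From \<open>exp 1 \<le> 3\<close>, which is below 4. It allows replacing the binary
  logarithm by twice the natural one.\<close>

lemma ln_2_ge_half: "1 / 2 \<le> ln (2 :: real)"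
proof -
  have "exp (1 / 2 :: real) ^ 2 = exp 1" by (simp flip: exp_of_nat_mult)
  also have "\<dots> \<le> 2 ^ 2" using exp_le by simp
  finally have "exp (1 / 2 :: real) \<le> 2" by (rule power2_le_imp_le) simp
  then have "ln (exp (1 / 2)) \<le> ln (2 :: real)" by (subst ln_le_cancel_iff) simp_all
  then show ?thesis by simp
qed

text \<open>The exponent is the rounded-up binary logarithm: rounding costs the summand
  \<open>real n\<close>, the change of base the factor 2.\<close>

lemma log_exponent:
  "\<exists>p. n \<le> 2 ^ p \<and> real n * real p \<le> real n + 2 * (real n * ln (real n))"
proof (cases "n = 0")
  case True
  then show ?thesis by simp
next
  case False
  then have n: "1 \<le> real n" by simp
  define p where "p = nat \<lceil>log 2 (real n)\<rceil>"
  have log: "0 \<le> log 2 (real n)" using n by simp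
  then have p: "log 2 (real n) \<le> real p" "real p \<le> log 2 (real n) + 1" unfolding p_def by linarith+
  have "real n = 2 powr (log 2 (real n))" using n by simp
  also have "\<dots> \<le> 2 powr (real p)" using p by (intro powr_mono) auto
  finally have "real n \<le> real (2 ^ p)" by (simp add: powr_realpow)
  then have "n \<le> 2 ^ p" by (simp only: of_nat_le_iff)
  moreover have "log 2 (real n) \<le> 2 * ln (real n)"
  proof -
    have "ln (real n) * 1 \<le> ln (real n) * (2 * ln 2)"
      using n ln_2_ge_half by (intro mult_left_mono) auto
    then show ?thesis using ln_2_ge_half by (simp add: log_def field_simps)
  qed
  then have "real n * real p \<le> real n * (1 + 2 * ln (real n))"
    using p by (intro mult_left_mono) auto
  then have "real n * real p \<le> real n + 2 * (real n * ln (real n))" by (simp add: algebra_simps)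
  ultimately show ?thesis by blast
qed

text \<open>Absorbs linear terms; the summand 1 covers a single delivery, where the logarithm
  vanishes.\<close>

lemma le_n_ln_n: "real n \<le> 2 * (real n * ln (real n)) + 1"
proof (cases "n \<le> 1")
  case True
  then show ?thesis by (cases n) auto
next
  case False
  then have "ln 2 \<le> ln (real n)" by simp
  then have "real n * 1 \<le> real n * (2 * ln (real n))"
    using ln_2_ge_half by (intro mult_left_mono) auto
  then show ?thesis by simp
qed

lemma prog_SC_time_bound:
  assumes "valid_SC I" "distinct ds" "set ds = deliveries I"
  shows "real (time (prog_SC (cap I) ds (stations I))) \<le>
    120 * (real (length ds) * ln (real (length ds)) + real (n_conf (deliveries I))
      + real (num_stations I) + 1)"
proof -
  let ?n = "length ds" and ?X = "real (length ds) * ln (real (length ds))"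
  obtain p where p: "?n \<le> 2 ^ p" "real ?n * real p \<le> real ?n + 2 * ?X"
    using log_exponent by blast
  have "real (time (prog_SC (cap I) ds (stations I))) \<le>
    real (?n * (4 * p + 50) + 2 * n_conf (deliveries I) + 30 * num_stations I + 60)"
    using time_prog_SC[OF assms p(1)] by (simp only: of_nat_le_iff)
  also have "\<dots> = 4 * (real ?n * real p) + 50 * real ?n + 2 * real (n_conf (deliveries I)) +
      30 * real (num_stations I) + 60"
    by (simp add: algebra_simps)
  \<comment> \<open>The exponent turns into \<open>4 * n + 8 * X\<close>, and \<open>54 * n\<close>
    is at most \<open>108 * X + 54\<close>. This gives coefficient 116 for \<open>X\<close> and
    constant 114, so 120 is enough.\<close>
  finally show ?thesis using p(2) le_n_ln_n[of ?n] by (simp add: algebra_simps)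
qed

text \<open>\<open>A\<close> is AlgoFor-DDP-NS with any of its choices fixed. The first conjunct
  covers every execution of the assignment phase: it ends, its result is a solution and the drone
  bound holds. The others tie this to running time: the program for DDP-NS is an instance of
  \<open>algo_NS\<close>, the log of the full program is the outcome of an execution using it, and
  its step count has the required order. The summand 1 in the time bound accounts for the constant
  cost on instances without deliveries and stations.\<close>

theorem theorem4:
  fixes A :: "real \<Rightarrow> delivery set \<Rightarrow> delivery set set \<Rightarrow> bool" and \<beta> :: real
  assumes A: "\<And>B D BB. valid_NS B D \<Longrightarrow> A B D BB \<Longrightarrow> algo_NS B D BB"
    and \<beta>: "\<And>B D BB. valid_NS B D \<Longrightarrow> A B D BB \<Longrightarrow> real (card BB) \<le> \<beta> * real (OPT_NS B D)"
  shows
    "(\<forall>I Bl. valid_SC I \<longrightarrow> SC_blocks A I Bl \<longrightarrow>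
        always_reaches (step I Bl)
          (\<lambda>s. final I Bl s \<and> solution I (num_drones I Bl) (schedule I s)) (init I) \<and>
        real (num_drones I Bl) \<le> \<beta> * real (OPT_SC I) + 2 * real (omega (deliveries I))) \<and>
     (\<forall>B D BB. valid_NS B D \<longrightarrow> impl_NS B D BB \<longrightarrow> algo_NS B D BB) \<and>
     (\<forall>I ds. valid_SC I \<longrightarrow> distinct ds \<longrightarrow> set ds = deliveries I \<longrightarrow>
        (case val (prog_SC (cap I) ds (stations I)) of
           (M, acc) \<Rightarrow> algo_SC impl_NS I M (log_of acc))) \<and>
     (\<exists>C. \<forall>I ds. valid_SC I \<longrightarrow> distinct ds \<longrightarrow> set ds = deliveries I \<longrightarrow>
        real (time (prog_SC (cap I) ds (stations I))) \<le>
          C * (real (length ds) * ln (real (length ds)) + real (n_conf (deliveries I))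
               + real (num_stations I) + 1))"
proof (intro conjI allI impI)
  fix I Bl assume I: "valid_SC I" "SC_blocks A I Bl"
  show "always_reaches (step I Bl)
      (\<lambda>s. final I Bl s \<and> solution I (num_drones I Bl) (schedule I s)) (init I)"
    using algorithm_correct[OF I(1) SC_blocks_families[OF A I]] by blast
  show "real (num_drones I Bl) \<le> \<beta> * real (OPT_SC I) + 2 * real (omega (deliveries I))"
    using num_drones_bound[OF A \<beta> I] by blast
next
  fix B D BB assume "valid_NS B D" "impl_NS B D BB"
  then show "algo_NS B D BB" by (rule impl_NS_algo_NS)
next
  fix I ds assume "valid_SC I" "distinct ds" "set ds = deliveries I"
  then show "case val (prog_SC (cap I) ds (stations I)) of
      (M, acc) \<Rightarrow> algo_SC impl_NS I M (log_of acc)"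
    using prog_SC_correct by (auto split: prod.split)
next
  show "\<exists>C. \<forall>I ds. valid_SC I \<longrightarrow> distinct ds \<longrightarrow> set ds = deliveries I \<longrightarrow>
      real (time (prog_SC (cap I) ds (stations I))) \<le>
        C * (real (length ds) * ln (real (length ds)) + real (n_conf (deliveries I))
             + real (num_stations I) + 1)"
    using prog_SC_time_bound by blast
qed

end
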